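(* Let $u_0\in H^s(\mathbb{R})\cap BV(\mathbb{R})$ with $s\geqslant3$. For $\ell>0$ let $u^\ell$ be the dissipative solution, constructed as in the context, of the regularised Burgers equation $u_t+uu_x+\ell^2P_x=0$ with initial datum $u_0$. Let $u$ be a limit of a subsequence of $u^\ell$ as $\ell\to0$ and $\mu$ the associated measure, as described in the context, so that $u_t+\tfrac12[u^2]_x=-\mu_x$. Then for $t<1/\sup_x|u_0'(x)|$ we have $$\mu=0 .$$
   Context: $\mathcal{M}^1(\mathbb{R})$ is the space of finite Radon measures on $\mathbb{R}$; $BV(\mathbb{R})$ is understood as functions with finite total variation on $\mathbb{R}$. In the equation, $P=\mathfrak{G}\ast\tfrac12u_x^2$ with $\mathfrak{G}(x)=(2\ell)^{-1}e^{-|x|/\ell}$; $P^\ell$ denotes $P$ for $u=u^\ell$. Limit and measure. It is known that there are a function $u$ with $u\in L^\infty([0,T],BV(\mathbb{R}))$ for all $T>0$, a measure $0\leqslant\mu\in L^\infty([0,+\infty[,\mathcal{M}^1(\mathbb{R}))$ and a subsequence $\ell\to0$ along which $u^\ell\to u$ in $\mathcal{C}([0,T],L^1(\mathcal{I}))$ for all $T>0$ and bounded intervals $\mathcal{I}$, and $\ell^2P^\ell\to\mu$ weakly (as measures); then $u_t+\tfrac12[u^2]_x=-\mu_x$ in the sense of distributions. Construction of the dissipative solution $u^\ell$. Define $y_0(\xi)$, $\xi\in\mathbb{R}$, by $\int_0^{y_0(\xi)}(1+u_0'(x)^2)\,\mathrm{d}x=\xi$. Let $(v,q)$, with $(v,q)\in\mathcal{C}([0,T],L^\infty(\mathbb{R},\mathbb{R}^2))$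 for every $T>0$, be the global solution of $$v_t=\begin{cases}-P(1+\cos v)-\sin^2(v/2),&v>-\pi,\\0,&v\leqslant-\pi,\end{cases}\qquad q_t=\begin{cases}q(\tfrac12-P)\sin v,&v>-\pi,\\0,&v\leqslant-\pi,\end{cases}$$ with $v(0,\xi)=2\arctan(u_0'(y_0(\xi)))$, $q(0,\xi)=1$, where, with $\bar q=q$ if $v>-\pi$ and $\bar q=0$ if $v\leqslant-\pi$, and $k(t,\xi,\xi')=\exp\{-\tfrac1\ell|\int_\xi^{\xi'}\bar q(t,s)\cos^2\tfrac{v(t,s)}2\,\mathrm{d}s|\}$, $$P(t,\xi)=\frac1{4\ell}\int_{\mathbb{R}}k(t,\xi,\xi')\,\bar q(t,\xi')\sin^2\tfrac{v(t,\xi')}2\,\mathrm{d}\xi',$$ $$P_x(t,\xi)=\frac1{4\ell^2}\Big(\int_\xi^{+\infty}-\int_{-\infty}^\xi\Big)k(t,\xi,\xi')\,\bar q(t,\xi')\sin^2\tfrac{v(t,\xi')}2\,\mathrm{d}\xi'.$$ Let $u(t,\xi)=u_0(y_0(\xi))-\int_0^t\ell^2P_x(s,\xi)\,\mathrm{d}s$ and $y(t,\xi)=y_0(\xi)+\int_0^tu(s,\xi)\,\mathrm{d}s$. Then $u^\ell$ is defined by $u^\ell(t,x)=u(t,\xi)$ whenever $x=y(t,\xi)$. It is known that this is well defined and gives a global weak solution with $u^\ell(0,\cdot)=u_0$ satisfying $[\tfrac12u^2+\tfrac12\ell^2u_x^2]_t+[\tfrac13u^3+\ell^2uP+\tfrac12\ell^2uu_x^2]_x\leqslant0$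 in the sense of distributions and $u^\ell_x\leqslant2/t$. If $u_0=0$, $1/\sup_x|u_0'|$ is read as $+\infty$. *)

theory Defs
  imports "HOL-Analysis.Analysis"
begin

section \<open>Function spaces for the initial datum\<close>

definition total_variation :: "(real \<Rightarrow> real) \<Rightarrow> ereal" where
  "total_variation f =
     (SUP xs \<in> {xs :: real list. sorted xs}.
        ereal (\<Sum>i < length xs - 1. \<bar>f (xs ! Suc i) - f (xs ! i)\<bar>))"

definition square_integrable :: "(real \<Rightarrow> 'b :: {banach, second_countable_topology}) \<Rightarrow> bool" where
  "square_integrable f \<longleftrightarrow>
     f \<in> borel_measurable borel \<and> integrable lborel (\<lambda>x. (norm (f x))\<^sup>2)"

(* The Fourier-Plancherel transform on L^2: g is the L^2-limit, as R tends to infinity, of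
   the Fourier transforms of f restricted to [-R, R]. *)
definition plancherel_transform :: "(real \<Rightarrow> real) \<Rightarrow> (real \<Rightarrow> complex) \<Rightarrow> bool" where
  "plancherel_transform f g \<longleftrightarrow> square_integrable g \<and>
     ((\<lambda>R. \<integral>\<^sup>+ k. ennreal ((norm ((LINT x:{-R..R}|lborel. cis (- (k * x)) * complex_of_real (f x)) - g k))\<^sup>2)
        \<partial>lborel) \<longlongrightarrow> 0) at_top"

definition sobolev :: "real \<Rightarrow> (real \<Rightarrow> real) \<Rightarrow> bool" where
  "sobolev s f \<longleftrightarrow> square_integrable f \<and>
     (\<exists>g. plancherel_transform f g \<and>
          square_integrable (\<lambda>k. complex_of_real ((1 + k\<^sup>2) powr (s / 2)) * g k))"

section \<open>Test functions and weak derivatives\<close>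

definition test_function :: "(real \<Rightarrow> real) \<Rightarrow> bool" where
  "test_function \<phi> \<longleftrightarrow>
     (\<forall>k x. (deriv ^^ k) \<phi> field_differentiable at x) \<and> bounded {x. \<phi> x \<noteq> 0}"

(* D i j is the partial derivative of order i in the first and j in the second variable. *)
definition smooth_plane :: "(real \<times> real \<Rightarrow> real) \<Rightarrow> bool" where
  "smooth_plane \<phi> \<longleftrightarrow>
     (\<exists>D :: nat \<Rightarrow> nat \<Rightarrow> real \<times> real \<Rightarrow> real. D 0 0 = \<phi> \<and>
        (\<forall>i j. continuous_on UNIV (D i j) \<and>
          (\<forall>t x. ((\<lambda>r. D i j (r, x)) has_real_derivative D (Suc i) j (t, x)) (at t) \<and>
                 ((\<lambda>z. D i j (t, z)) has_real_derivative D i (Suc j) (t, x)) (at x))))"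

definition spacetime_test_function :: "(real \<times> real \<Rightarrow> real) \<Rightarrow> bool" where
  "spacetime_test_function \<phi> \<longleftrightarrow> smooth_plane \<phi> \<and> bounded {p. \<phi> p \<noteq> 0} \<and>
     closure {p. \<phi> p \<noteq> 0} \<subseteq> {0<..} \<times> UNIV"

definition has_weak_derivative :: "(real \<Rightarrow> real) \<Rightarrow> (real \<Rightarrow> real) \<Rightarrow> bool" where
  "has_weak_derivative f g \<longleftrightarrow>
     f \<in> borel_measurable borel \<and> g \<in> borel_measurable borel \<and>
     (\<forall>R. set_integrable lborel {-R..R} f \<and> set_integrable lborel {-R..R} g) \<and>
     (\<forall>\<phi>. test_function \<phi> \<longrightarrow>
        (LINT x|lborel. f x * deriv \<phi> x) = - (LINT x|lborel. g x * \<phi> x))"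

(* Unique up to equality almost everywhere. *)
definition weak_deriv :: "(real \<Rightarrow> real) \<Rightarrow> real \<Rightarrow> real" where
  "weak_deriv f = (SOME g. has_weak_derivative f g)"

definition green :: "real \<Rightarrow> real \<Rightarrow> real" where
  "green l x = exp (- \<bar>x\<bar> / l) / (2 * l)"

definition pressure :: "real \<Rightarrow> (real \<Rightarrow> real) \<Rightarrow> real \<Rightarrow> real" where
  "pressure l w x = (LINT z|lborel. green l (x - z) * ((weak_deriv w z)\<^sup>2 / 2))"

section \<open>The dissipative solution\<close>

definition y_init :: "(real \<Rightarrow> real) \<Rightarrow> real \<Rightarrow> real" where
  "y_init u0 \<xi> = (THE y. (LBINT x=ereal 0..ereal y. 1 + (deriv u0 x)\<^sup>2) = \<xi>)"

definition q_bar :: "(real \<Rightarrow> real \<Rightarrow> real) \<Rightarrow> (real \<Rightarrow> real \<Rightarrow> real) \<Rightarrow> real \<Rightarrow> real \<Rightarrow> real" where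
  "q_bar v q t \<xi> = (if v t \<xi> > - pi then q t \<xi> else 0)"

definition kern :: "real \<Rightarrow> (real \<Rightarrow> real \<Rightarrow> real) \<Rightarrow> (real \<Rightarrow> real \<Rightarrow> real) \<Rightarrow> real \<Rightarrow> real \<Rightarrow> real \<Rightarrow> real" where
  "kern l v q t \<xi> \<xi>' =
     exp (- (1 / l) * \<bar>LBINT s=ereal \<xi>..ereal \<xi>'. q_bar v q t s * (cos (v t s / 2))\<^sup>2\<bar>)"

definition P_integrand :: "real \<Rightarrow> (real \<Rightarrow> real \<Rightarrow> real) \<Rightarrow> (real \<Rightarrow> real \<Rightarrow> real) \<Rightarrow> real \<Rightarrow> real \<Rightarrow> real \<Rightarrow> real" where
  "P_integrand l v q t \<xi> \<xi>' = kern l v q t \<xi> \<xi>' * q_bar v q t \<xi>' * (sin (v t \<xi>' / 2))\<^sup>2"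

definition P_lag :: "real \<Rightarrow> (real \<Rightarrow> real \<Rightarrow> real) \<Rightarrow> (real \<Rightarrow> real \<Rightarrow> real) \<Rightarrow> real \<Rightarrow> real \<Rightarrow> real" where
  "P_lag l v q t \<xi> = 1 / (4 * l) * (LINT \<xi>'|lborel. P_integrand l v q t \<xi> \<xi>')"

definition Px_lag :: "real \<Rightarrow> (real \<Rightarrow> real \<Rightarrow> real) \<Rightarrow> (real \<Rightarrow> real \<Rightarrow> real) \<Rightarrow> real \<Rightarrow> real \<Rightarrow> real" where
  "Px_lag l v q t \<xi> = 1 / (4 * l\<^sup>2) *
     ((LINT \<xi>':{\<xi>..}|lborel. P_integrand l v q t \<xi> \<xi>') - (LINT \<xi>':{..\<xi>}|lborel. P_integrand l v q t \<xi> \<xi>'))"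

(* w belongs to C([0,T], L^infinity) for every T > 0. *)
definition continuous_Linf :: "(real \<Rightarrow> real \<Rightarrow> real) \<Rightarrow> bool" where
  "continuous_Linf w \<longleftrightarrow>
     (\<forall>t\<ge>0. w t \<in> borel_measurable borel \<and> (\<exists>C. AE \<xi> in lborel. \<bar>w t \<xi>\<bar> \<le> C)) \<and>
     (\<forall>t\<ge>0. \<forall>\<epsilon>>0. \<exists>\<delta>>0. \<forall>r\<ge>0. \<bar>r - t\<bar> < \<delta> \<longrightarrow> (AE \<xi> in lborel. \<bar>w r \<xi> - w t \<xi>\<bar> \<le> \<epsilon>))"

(* The right-hand side of the system jumps when v reaches -pi, so v_t and q_t are understood in
   the integrated (Caratheodory) sense; as v and q take values in L^infinity, the equations
   hold for almost every \<xi>. The integrability clause only says that P and P_x are given by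
   convergent integrals; the Bochner integral would otherwise silently be 0. *)
definition lagrangian_solution ::
  "real \<Rightarrow> (real \<Rightarrow> real) \<Rightarrow> (real \<Rightarrow> real \<Rightarrow> real) \<Rightarrow> (real \<Rightarrow> real \<Rightarrow> real) \<Rightarrow> bool" where
  "lagrangian_solution l u0 v q \<longleftrightarrow>
     continuous_Linf v \<and> continuous_Linf q \<and>
     (\<forall>t\<ge>0. \<forall>\<xi>. integrable lborel (P_integrand l v q t \<xi>)) \<and>
     (AE \<xi> in lborel.
        v 0 \<xi> = 2 * arctan (deriv u0 (y_init u0 \<xi>)) \<and> q 0 \<xi> = 1 \<and>
        (\<forall>t\<ge>0.
          ((\<lambda>r. if v r \<xi> > - pi
                then - P_lag l v q r \<xi> * (1 + cos (v r \<xi>)) - (sin (v r \<xi> / 2))\<^sup>2 else 0)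
             has_integral (v t \<xi> - v 0 \<xi>)) {0..t} \<and>
          ((\<lambda>r. if v r \<xi> > - pi
                then q r \<xi> * (1 / 2 - P_lag l v q r \<xi>) * sin (v r \<xi>) else 0)
             has_integral (q t \<xi> - q 0 \<xi>)) {0..t}))"

definition u_lag ::
  "real \<Rightarrow> (real \<Rightarrow> real) \<Rightarrow> (real \<Rightarrow> real \<Rightarrow> real) \<Rightarrow> (real \<Rightarrow> real \<Rightarrow> real) \<Rightarrow> real \<Rightarrow> real \<Rightarrow> real" where
  "u_lag l u0 v q t \<xi> = u0 (y_init u0 \<xi>) - integral {0..t} (\<lambda>r. l\<^sup>2 * Px_lag l v q r \<xi>)"

definition y_lag ::
  "real \<Rightarrow> (real \<Rightarrow> real) \<Rightarrow> (real \<Rightarrow> real \<Rightarrow> real) \<Rightarrow> (real \<Rightarrow> real \<Rightarrow> real) \<Rightarrow> real \<Rightarrow> real \<Rightarrow> real" where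
  "y_lag l u0 v q t \<xi> = y_init u0 \<xi> + integral {0..t} (\<lambda>r. u_lag l u0 v q r \<xi>)"

definition dissipative_solution :: "real \<Rightarrow> (real \<Rightarrow> real) \<Rightarrow> (real \<Rightarrow> real \<Rightarrow> real) \<Rightarrow> bool" where
  "dissipative_solution l u0 w \<longleftrightarrow>
     (\<exists>v q. lagrangian_solution l u0 v q \<and>
        (\<forall>t\<ge>0. \<forall>\<xi>. w t (y_lag l u0 v q t \<xi>) = u_lag l u0 v q t \<xi>))"

section \<open>The limit and its measure\<close>

definition L1_dist :: "real \<Rightarrow> real \<Rightarrow> (real \<Rightarrow> real) \<Rightarrow> (real \<Rightarrow> real) \<Rightarrow> ennreal" where
  "L1_dist a b f g = (\<integral>\<^sup>+ x \<in> {a..b}. ennreal \<bar>f x - g x\<bar> \<partial>lborel)"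

definition continuous_L1 :: "real \<Rightarrow> real \<Rightarrow> real \<Rightarrow> (real \<Rightarrow> real \<Rightarrow> real) \<Rightarrow> bool" where
  "continuous_L1 T a b w \<longleftrightarrow>
     (\<forall>t\<in>{0..T}. set_integrable lborel {a..b} (w t) \<and>
        ((\<lambda>r. L1_dist a b (w r) (w t)) \<longlongrightarrow> 0) (at t within {0..T}))"

definition converges_C_L1 :: "(nat \<Rightarrow> real \<Rightarrow> real \<Rightarrow> real) \<Rightarrow> (real \<Rightarrow> real \<Rightarrow> real) \<Rightarrow> bool" where
  "converges_C_L1 W w \<longleftrightarrow>
     (\<forall>T>0. \<forall>a b. (\<forall>n. continuous_L1 T a b (W n)) \<and> continuous_L1 T a b w \<and>
        (\<lambda>n. SUP t\<in>{0..T}. L1_dist a b (W n t) (w t)) \<longlonglongrightarrow> 0)"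

(* For each t, w t is only determined almost everywhere, so some representative is required to
   have bounded variation. *)
definition Linf_BV :: "(real \<Rightarrow> real \<Rightarrow> real) \<Rightarrow> bool" where
  "Linf_BV w \<longleftrightarrow>
     (\<forall>T>0. \<exists>C. AE t in lborel. t \<in> {0..T} \<longrightarrow>
        (\<exists>g. (AE x in lborel. g x = w t x) \<and> total_variation g \<le> ereal C))"

(* Nonnegative elements of L^infinity([0,+oo[, M^1), with weak-* measurability in t. Finite Borel
   measures on the real line are automatically Radon. *)
definition Linf_measures :: "(real \<Rightarrow> real measure) \<Rightarrow> bool" where
  "Linf_measures \<mu> \<longleftrightarrow>
     (\<forall>t\<ge>0. sets (\<mu> t) = sets borel \<and> finite_measure (\<mu> t)) \<and>
     (\<forall>A\<in>sets borel. (\<lambda>t. emeasure (\<mu> t) A) \<in> borel_measurable (restrict_space borel {0..})) \<and>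
     (\<exists>C :: real. AE t in lborel. t \<ge> 0 \<longrightarrow> emeasure (\<mu> t) UNIV \<le> ennreal C)"

(* Convergence of the measures p n (t, x) dx dt on [0,+oo[ \<times> R to \<mu> t (dx) dt. *)
definition converges_measure :: "(nat \<Rightarrow> real \<Rightarrow> real \<Rightarrow> real) \<Rightarrow> (real \<Rightarrow> real measure) \<Rightarrow> bool" where
  "converges_measure p \<mu> \<longleftrightarrow>
     (\<forall>\<phi> :: real \<times> real \<Rightarrow> real. continuous_on UNIV \<phi> \<longrightarrow> bounded {z. \<phi> z \<noteq> 0} \<longrightarrow>
        (\<lambda>n. LINT t:{0..}|lborel. (LINT x|lborel. p n t x * \<phi> (t, x)))
          \<longlonglongrightarrow> (LINT t:{0..}|lborel. (LINT x|\<mu> t. \<phi> (t, x))))"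

(* u_t + (u^2)_x / 2 = - \<mu>_x in the sense of distributions. *)
definition burgers_with_measure :: "(real \<Rightarrow> real \<Rightarrow> real) \<Rightarrow> (real \<Rightarrow> real measure) \<Rightarrow> bool" where
  "burgers_with_measure u \<mu> \<longleftrightarrow>
     (\<forall>\<phi>. spacetime_test_function \<phi> \<longrightarrow>
        (LINT t:{0..}|lborel. (LINT x|lborel.
            u t x * deriv (\<lambda>r. \<phi> (r, x)) t + (u t x)\<^sup>2 / 2 * deriv (\<lambda>z. \<phi> (t, z)) x))
        = - (LINT t:{0..}|lborel. (LINT x|\<mu> t. deriv (\<lambda>z. \<phi> (t, z)) x)))"

definition limit_pair ::
  "(real \<Rightarrow> real \<Rightarrow> real \<Rightarrow> real) \<Rightarrow> (real \<Rightarrow> real \<Rightarrow> real) \<Rightarrow> (real \<Rightarrow> real measure) \<Rightarrow> bool" where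
  "limit_pair U u \<mu> \<longleftrightarrow>
     Linf_BV u \<and> Linf_measures \<mu> \<and> burgers_with_measure u \<mu> \<and>
     (\<exists>L. (\<forall>n. L n > 0) \<and> L \<longlonglongrightarrow> 0 \<and>
        converges_C_L1 (\<lambda>n. U (L n)) u \<and>
        converges_measure (\<lambda>n t x. (L n)\<^sup>2 * pressure (L n) (U (L n) t) x) \<mu>)"

end

theory Submission
  imports Defs "HOL-Probability.Probability"
begin

text \<open>
  Before the time $1/M$, where $M$ bounds $|u_0'|$, the regularisation develops no singularity,
  uniformly in $\ell$. In Lagrangian coordinates the slope $w = \tan(v/2)$ solves
  $w_t = - w^2/2 - P$, and $0 \le P \le \frac12 \sup w^2$ because $\mathfrak{G}$ has integral 1;
  hence $\sup |w|$ grows at most like the solution $M/(1 - Mt)$ of $B' = B^2$. A continuation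
  argument in $L^\infty$ makes this rigorous and keeps $v$ away from $-\pi$ and $q$ away from 0.
  Therefore $y_\xi = q \cos^2(v/2)$ and $u_\xi = \frac12 q \sin v$, the characteristics are
  bi-Lipschitz, and the weak derivative of $u^\ell$ is bounded by a constant that does not depend
  on $\ell$. So $P^\ell$ is bounded and $\ell^2 P^\ell \to 0$ uniformly on $[0,T]$ for each
  $T < 1/M$. The Sobolev hypothesis enters only to make $u_0$ continuously differentiable, by
  Fourier inversion against Gaussians.
\<close>

section \<open>Indefinite Lebesgue integrals\<close>

text \<open>The equations and bounds hold only for almost every label, with null sets that may
  depend on the time, and the construction does not supply the spatial derivatives of u and y. For
  positive times no pointwise derivative in space is taken: absolute continuity is expressed by
  \<open>primitive\<close>, through integrals of a density over compact intervals, and the densities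
  of \<open>u_lag\<close> and \<open>y_lag\<close> are found by integrating over labels first and
  differentiating in time afterwards. Null sets of different times are merged through countable
  dense sets of times. The bound on P at time t presupposes the bound on the slope at time t, so the
  Riccati estimate is circular. A strict improvement closes it: the bound B0 + e implies B0 + e/2,
  where B0 = M/(1 - M t) and e is a fast growing exponential, and continuity in L-infinity carries
  the gap to slightly later times for almost all labels at once. As \<open>pressure\<close> uses a
  weak derivative picked by \<open>SOME\<close>, uniqueness of weak derivatives is the link from the
  Lagrangian slope to the pressure.\<close>

definition primitive :: "(real \<Rightarrow> real) \<Rightarrow> (real \<Rightarrow> real) \<Rightarrow> bool" where
  "primitive F f \<longleftrightarrow>
     (\<forall>a b. a \<le> b \<longrightarrow> set_integrable lborel {a..b} f \<and> (LINT x:{a..b}|lborel. f x) = F b - F a)"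

lemma primitiveD:
  assumes "primitive F f" "a \<le> b"
  shows "set_integrable lborel {a..b} f" "(LINT x:{a..b}|lborel. f x) = F b - F a"
  using assms by (auto simp: primitive_def)

lemma primitive_measurable [measurable_dest]:
  assumes "primitive F f"
  shows "f \<in> borel_measurable borel"
proof -
  have lim: "(\<lambda>n. indicator {- real n..real n} x *\<^sub>R f x) \<longlonglongrightarrow> f x" for x
  proof (rule tendsto_eventually)
    obtain N where N: "\<bar>x\<bar> \<le> real N" using real_arch_simple by blast
    show "eventually (\<lambda>n. indicator {- real n..real n} x *\<^sub>R f x = f x) sequentially"
      using eventually_ge_at_top[of N]
    proof eventually_elim
      case (elim n)
      then have "x \<in> {- real n..real n}" using N by (auto simp: abs_le_iff) 
      then show ?case by simp
    qed
  qed
  have "(\<lambda>x. indicator {- real n..real n} x *\<^sub>R f x) \<in> borel_measurable borel" for n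
    using primitiveD(1)[OF assms, of "- real n" "real n"]
    by (auto simp: set_integrable_def dest!: borel_measurable_integrable)
  then show ?thesis
    by (rule borel_measurable_LIMSEQ_metric) (use lim in auto)
qed

lemma primitive_continuous:
  assumes "primitive F f"
  shows "continuous_on S F"
proof -
  have "continuous_on {a..b} F" if "a \<le> b" for a b
  proof -
    have si: "set_integrable lborel {a..b} f" using primitiveD[OF assms that] by auto
    have i: "f integrable_on {a..b}" using set_borel_integral_eq_integral(1)[OF si] .
    have "continuous_on {a..b} (\<lambda>x. F a + integral {a..x} f)"
      by (intro continuous_intros indefinite_integral_continuous_1 i)
    moreover have "F a + integral {a..x} f = F x" if "x \<in> {a..b}" for x
      using that primitiveD[OF assms, of a x] set_borel_integral_eq_integral(2)[of "{a..x}" f] by auto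
    ultimately show ?thesis by (rule continuous_on_eq)
  qed
  then have "isCont F x" for x
    using continuous_on_interior[of "{x-1..x+1}" F x] by auto
  then show ?thesis by (simp add: continuous_at_imp_continuous_on)
qed

lemma primitive_bounded_mult_integrable:
  assumes f: "primitive F f" and G: "continuous_on {a..b} G" "G \<in> borel_measurable borel"
  shows "set_integrable lborel {a..b} (\<lambda>x. f x * G x :: real)"
proof (cases "a \<le> b")
  case True
  have "bounded (G ` {a..b})" using G by (simp add: compact_continuous_image compact_imp_bounded)
  then obtain K where "\<forall>x\<in>{a..b}. \<bar>G x\<bar> \<le> K" by (auto simp: bounded_iff)
  then have K: "\<And>x. x \<in> {a..b} \<Longrightarrow> \<bar>G x\<bar> \<le> K" by blast
  have [measurable]: "f \<in> borel_measurable borel" "G \<in> borel_measurable borel"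
    using G primitive_measurable[OF f] by auto
  have "integrable lborel (\<lambda>x. K * (indicator {a..b} x *\<^sub>R f x))"
    using primitiveD(1)[OF f True] unfolding set_integrable_def by (intro integrable_mult_right) 
  then show ?thesis
    unfolding set_integrable_def
  proof (rule Bochner_Integration.integrable_bound)
    show "AE x in lborel. norm (indicat_real {a..b} x *\<^sub>R (f x * G x)) \<le> norm (K * (indicat_real {a..b} x *\<^sub>R f x))"
    proof (rule AE_I2)
      fix x
      have "\<bar>f x\<bar> * \<bar>G x\<bar> \<le> \<bar>f x\<bar> * \<bar>K\<bar>" if "x \<in> {a..b}"
        using K[OF that] by (intro mult_left_mono) auto
      then show "norm (indicat_real {a..b} x *\<^sub>R (f x * G x)) \<le> norm (K * (indicat_real {a..b} x *\<^sub>R f x))"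
        by (cases "x \<in> {a..b}") (auto simp: abs_mult mult.commute)
    qed
  qed simp
qed (simp add: set_integrable_def)

text \<open>Integration by parts without pointwise derivatives. The product of the increments of F
  and G is the integral of f(x) g(y) over a square; cutting the square along its diagonal and
  applying Fubini to each triangle leaves the integrals of f (G - G a) and g (F - F a).\<close>

lemma primitive_mult:
  assumes F: "primitive F f" and G: "primitive G g"
  shows "primitive (\<lambda>x. F x * G x) (\<lambda>x. f x * G x + F x * g x)"
  unfolding primitive_def
proof (intro allI impI)
  fix a b :: real assume ab: "a \<le> b"
  have Fm[measurable]: "F \<in> borel_measurable borel" and Gm[measurable]: "G \<in> borel_measurable borel"
    using F G by (auto intro!: borel_measurable_continuous_onI primitive_continuous)
  have fm[measurable]: "f \<in> borel_measurable borel" and gm[measurable]: "g \<in> borel_measurable borel"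
    using F G by (auto dest: primitive_measurable)
  define f1 where "f1 x = indicator {a..b} x * f x" for x
  define g1 where "g1 x = indicator {a..b} x * g x" for x
  have [measurable]: "f1 \<in> borel_measurable borel" "g1 \<in> borel_measurable borel"
    unfolding f1_def g1_def by measurable
  have f1: "integrable lborel f1" and g1: "integrable lborel g1"
    using primitiveD(1)[OF F ab] primitiveD(1)[OF G ab] by (auto simp: set_integrable_def f1_def[abs_def] g1_def[abs_def])
  have prod: "integrable (lborel \<Otimes>\<^sub>M lborel) (\<lambda>(x, y). f1 x * g1 y)"
    by (rule lborel_pair.Fubini_integrable) (use f1 g1 in \<open>auto simp: abs_mult\<close>)
  define k1 where "k1 = (\<lambda>(x, y). if y \<le> x then f1 x * g1 y else 0)"
  define k2 where "k2 = (\<lambda>(x, y). if x < y then f1 x * g1 y else 0)"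
  have k1: "integrable (lborel \<Otimes>\<^sub>M lborel) k1" and k2: "integrable (lborel \<Otimes>\<^sub>M lborel) k2"
    by (rule Bochner_Integration.integrable_bound[OF prod]; auto simp: k1_def k2_def)+
  have i1: "(LINT y|lborel. k1 (x, y)) = f1 x * (G x - G a)" for x
  proof (cases "x \<in> {a..b}")
    case True
    have "(LINT y|lborel. k1 (x, y)) = (LINT y|lborel. f1 x * (indicator {a..x} y *\<^sub>R g y))"
      by (rule Bochner_Integration.integral_cong) (use True in \<open>auto simp: k1_def g1_def indicator_def\<close>)
    also have "\<dots> = f1 x * (G x - G a)"
      using primitiveD(2)[OF G, of a x] True by (simp add: set_lebesgue_integral_def)
    finally show ?thesis .
  next
    case False
    then have "f1 x = 0" by (simp add: f1_def)
    then show ?thesis by (simp add: k1_def cong: if_cong)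
  qed
  have i2: "(LINT x|lborel. k2 (x, y)) = g1 y * (F y - F a)" for y
  proof (cases "y \<in> {a..b}")
    case True
    have "(LINT x|lborel. k2 (x, y)) = (LINT x|lborel. g1 y * (indicator {a..y} x *\<^sub>R f x))"
    proof (rule integral_cong_AE)
      show "AE x in lborel. k2 (x, y) = g1 y * (indicator {a..y} x *\<^sub>R f x)"
        using AE_lborel_singleton[of y]
        by eventually_elim (use True in \<open>auto simp: k2_def f1_def indicator_def\<close>)
    qed (auto simp: k2_def)
    also have "\<dots> = g1 y * (F y - F a)"
      using primitiveD(2)[OF F, of a y] True by (simp add: set_lebesgue_integral_def)
    finally show ?thesis .
  next
    case False
    then have "g1 y = 0" by (simp add: g1_def)
    then show ?thesis by (simp add: k2_def cong: if_cong)
  qed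
  have c: "continuous_on S F" "continuous_on S G" for S using F G by (auto intro: primitive_continuous)
  have fG: "set_integrable lborel {a..b} (\<lambda>x. f x * G x)" and gF: "set_integrable lborel {a..b} (\<lambda>x. g x * F x)"
    using primitive_bounded_mult_integrable[OF F] primitive_bounded_mult_integrable[OF G] c by auto
  have fi: "set_integrable lborel {a..b} f" and gi: "set_integrable lborel {a..b} g"
    using primitiveD(1)[OF F ab] primitiveD(1)[OF G ab] .
  have "(F b - F a) * (G b - G a) = (LINT x|lborel. f1 x) * (LINT x|lborel. g1 x)"
    using primitiveD(2)[OF F ab] primitiveD(2)[OF G ab]
    by (simp add: set_lebesgue_integral_def f1_def g1_def)
  also have "\<dots> = (LINT x|lborel. LINT y|lborel. f1 x * g1 y)" by simp
  also have "\<dots> = integral\<^sup>L (lborel \<Otimes>\<^sub>M lborel) (\<lambda>(x, y). f1 x * g1 y)"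
    using lborel_pair.integral_fst'[OF prod] by simp
  also have "\<dots> = integral\<^sup>L (lborel \<Otimes>\<^sub>M lborel) (\<lambda>z. k1 z + k2 z)"
    by (rule Bochner_Integration.integral_cong) (auto simp: k1_def k2_def)
  also have "\<dots> = integral\<^sup>L (lborel \<Otimes>\<^sub>M lborel) k1 + integral\<^sup>L (lborel \<Otimes>\<^sub>M lborel) k2"
    using k1 k2 by simp
  also have "integral\<^sup>L (lborel \<Otimes>\<^sub>M lborel) k1 = (LINT x|lborel. f1 x * (G x - G a))"
    using lborel_pair.integral_fst'[OF k1] i1 by simp
  also have "integral\<^sup>L (lborel \<Otimes>\<^sub>M lborel) k2 = (LINT y|lborel. g1 y * (F y - F a))"
    using lborel_pair.integral_snd[of "\<lambda>x y. k2 (x, y)"] k2 i2 by simp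
  also have "(LINT x|lborel. f1 x * (G x - G a)) = (LINT x:{a..b}|lborel. f x * G x - f x * G a)"
    by (simp add: set_lebesgue_integral_def f1_def algebra_simps)
  also have "\<dots> = (LINT x:{a..b}|lborel. f x * G x) - (F b - F a) * G a"
    using set_integral_diff(2)[OF fG set_integrable_mult_left[of "G a", OF fi]] primitiveD(2)[OF F ab] 
    by simp
  also have "(LINT x|lborel. g1 x * (F x - F a)) = (LINT x:{a..b}|lborel. g x * F x - g x * F a)"
    by (simp add: set_lebesgue_integral_def g1_def algebra_simps)
  also have "\<dots> = (LINT x:{a..b}|lborel. g x * F x) - (G b - G a) * F a"
    using set_integral_diff(2)[OF gF set_integrable_mult_left[of "F a", OF gi]] primitiveD(2)[OF G ab] 
    by simp
  finally have "(LINT x:{a..b}|lborel. f x * G x) + (LINT x:{a..b}|lborel. g x * F x) = F b * G b - F a * G a"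
    by (simp add: algebra_simps)
  then show "set_integrable lborel {a..b} (\<lambda>x. f x * G x + F x * g x) \<and>
      (LINT x:{a..b}|lborel. f x * G x + F x * g x) = F b * G b - F a * G a"
    using set_integral_add[OF fG gF] by (simp add: mult.commute)
qed

lemma primitive_deriv:
  assumes "\<And>x. (F has_real_derivative f x) (at x)" and "continuous_on UNIV f"
  shows "primitive F f"
  unfolding primitive_def
proof (intro allI impI)
  fix a b :: real assume ab: "a \<le> b"
  have c: "continuous_on {a..b} f" using assms(2) by (rule continuous_on_subset) simp
  have "set_integrable lborel {a..b} f"
    by (rule borel_integrable_atLeastAtMost') (rule c)
  moreover have "(LINT x:{a..b}|lborel. f x) = F b - F a"
    using integral_FTC_atLeastAtMost[OF ab _ c, of F] assms(1)
    by (auto simp: set_lebesgue_integral_def has_real_derivative_iff_has_vector_derivative 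
        intro: has_vector_derivative_at_within)
  ultimately show "set_integrable lborel {a..b} f \<and> (LINT x:{a..b}|lborel. f x) = F b - F a" ..
qed

lemma primitive_cmult: "primitive F f \<Longrightarrow> primitive (\<lambda>x. c * F x) (\<lambda>x. c * f x)"
  by (simp add: primitive_def right_diff_distrib)

lemma primitive_add:
  assumes "primitive F f" "primitive G g" shows "primitive (\<lambda>x. F x + G x) (\<lambda>x. f x + g x)"
  using assms unfolding primitive_def by (auto simp: set_integral_add)

lemma primitive_cong_AE:
  assumes "primitive F f" "AE x in lborel. f x = g x" "g \<in> borel_measurable borel"
  shows "primitive F g"
  unfolding primitive_def
proof (intro allI impI)
  fix a b :: real assume ab: "a \<le> b"
  note [measurable] = primitive_measurable[OF assms(1)] assms(3)
  have "set_integrable lborel {a..b} f = set_integrable lborel {a..b} g"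
    by (rule set_integrable_cong_AE) (use assms(2) in auto)
  moreover have "(LINT x:{a..b}|lborel. f x) = (LINT x:{a..b}|lborel. g x)"
    by (rule set_lebesgue_integral_cong_AE) (use assms(2) in auto)
  ultimately show "set_integrable lborel {a..b} g \<and> (LINT x:{a..b}|lborel. g x) = F b - F a"
    using primitiveD[OF assms(1) ab] by simp
qed

lemma set_integrable_bounded_Icc:
  fixes f :: "real \<Rightarrow> real"
  assumes "f \<in> borel_measurable borel" "\<And>x. x \<in> {a..b} \<Longrightarrow> \<bar>f x\<bar> \<le> (C :: real)"
  shows "set_integrable lborel {a..b} f"
  unfolding set_integrable_def
proof (rule integrableI_bounded_set[where A="{a..b}" and B="C"])
  note [measurable] = assms(1)
  show "(\<lambda>x. indicator {a..b} x *\<^sub>R f x) \<in> borel_measurable lborel"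
    by measurable
qed (use assms(2) in \<open>auto simp: emeasure_lborel_Icc_eq\<close>)

lemma set_integral_Icc_split:
  assumes "a \<le> b" "b \<le> c" "set_integrable lborel {a..c} (f :: real \<Rightarrow> real)"
  shows "(LINT x:{a..c}|lborel. f x) = (LINT x:{a..b}|lborel. f x) + (LINT x:{b..c}|lborel. f x)"
proof -
  have s: "set_integrable lborel {a..b} f" "set_integrable lborel {b..c} f"
    using assms by (auto intro: set_integrable_subset)
  have "(LINT x:{a..b} \<union> {b..c}|lborel. f x) = (LINT x:{a..b}|lborel. f x) + (LINT x:{b..c}|lborel. f x)"
  proof (rule set_integral_Un_AE)
    show "AE x in lborel. \<not> (x \<in> {a..b} \<and> x \<in> {b..c})"
      using AE_lborel_singleton[of b] by eventually_elim auto
  qed (use s in auto)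
  moreover have "{a..b} \<union> {b..c} = {a..c}" using assms by auto
  ultimately show ?thesis by simp
qed

lemma primitive_bounded:
  assumes "f \<in> borel_measurable borel" "\<And>x. \<bar>f x\<bar> \<le> C"
  shows "primitive (\<lambda>x. if 0 \<le> x then LINT z:{0..x}|lborel. f z else - (LINT z:{x..0}|lborel. f z)) f"
  unfolding primitive_def
proof (intro allI impI)
  fix a b :: real assume ab: "a \<le> b"
  have i: "set_integrable lborel {a..b} f" for a b
    using assms by (rule set_integrable_bounded_Icc)
  show "set_integrable lborel {a..b} f \<and> (LINT x:{a..b}|lborel. f x) =
    (if 0 \<le> b then LINT z:{0..b}|lborel. f z else - (LINT z:{b..0}|lborel. f z)) -
    (if 0 \<le> a then LINT z:{0..a}|lborel. f z else - (LINT z:{a..0}|lborel. f z))"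
    using ab set_integral_Icc_split[OF _ _ i, of a 0 b] set_integral_Icc_split[OF _ _ i, of 0 a b] 
      set_integral_Icc_split[OF _ _ i, of a b 0]
    by (auto simp: i)
qed

text \<open>Three changes of variables have this form: the map inverted by \<open>y_init\<close>,
  the position as a function of the label at a fixed time, and \<open>y_lag\<close> itself. The
  density is merely measurable, but its two-sided bound makes F a bijection of the line, and
  substitution works without differentiating F.\<close>

locale bi_Lipschitz_primitive =
  fixes F \<rho> :: "real \<Rightarrow> real" and c C :: real
  assumes prim: "primitive F \<rho>" and c_pos: "0 < c"
    and lower: "\<And>x. c \<le> \<rho> x" and upper: "\<And>x. \<rho> x \<le> C"
begin

lemma density_measurable [measurable]: "\<rho> \<in> borel_measurable borel"
  using prim by (rule primitive_measurable)

lemma density_pos: "0 < \<rho> x" "0 \<le> \<rho> x"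
  using lower[of x] c_pos by linarith+

lemma increment_bounds:
  assumes "a \<le> b"
  shows "c * (b - a) \<le> F b - F a" "F b - F a \<le> C * (b - a)"
proof -
  have i: "set_integrable lborel {a..b} \<rho>" "(LINT x:{a..b}|lborel. \<rho> x) = F b - F a"
    using primitiveD[OF prim assms] .
  have k: "set_integrable lborel {a..b} (\<lambda>_. k)" for k :: real
    by (rule borel_integrable_atLeastAtMost') simp
  have e: "(LINT x:{a..b}|lborel. k) = k * (b - a)" for k :: real
    using assms by (simp add: set_lebesgue_integral_def)
  show "c * (b - a) \<le> F b - F a"
    using set_integral_mono[OF k i(1), of c] lower i(2) e by simp
  show "F b - F a \<le> C * (b - a)"
    using set_integral_mono[OF i(1) k, of C] upper i(2) e by simp
qed

lemma strict_mono: "strict_mono F"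
proof (rule strict_monoI)
  fix a b :: real assume "a < b"
  then have "0 < c * (b - a)" using c_pos by simp
  then show "F a < F b" using increment_bounds(1)[of a b] \<open>a < b\<close> by linarith
qed

lemma less_iff [simp]: "F a < F b \<longleftrightarrow> a < b" and le_iff [simp]: "F a \<le> F b \<longleftrightarrow> a \<le> b"
  using strict_mono by (auto simp: strict_mono_less strict_mono_less_eq)

lemma surj: "surj F"
proof -
  have "\<exists>x. F x = y" for y
  proof -
    \<comment> \<open>At distance r from 0 the lower Lipschitz bound forces F to have passed the
      value y.\<close>
    define r where "r = (\<bar>y - F 0\<bar>) / c"
    have r: "0 \<le> r" "c * r = \<bar>y - F 0\<bar>" using c_pos by (auto simp: r_def)
    have "F (-r) \<le> y" "y \<le> F r"
      using increment_bounds(1)[of "-r" 0] increment_bounds(1)[of 0 r] r by auto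
    then show ?thesis
      using IVT'[of F "-r" y r] primitive_continuous[OF prim] r by auto
  qed
  then show ?thesis by (metis surjI)
qed

definition G :: "real \<Rightarrow> real" where "G = inv F"

lemma FG [simp]: "F (G x) = x"
  unfolding G_def using surj by (rule surj_f_inv_f)

lemma GF [simp]: "G (F x) = x"
  unfolding G_def using strict_mono by (intro inv_f_f strict_mono_imp_inj_on)

lemma G_le_iff [simp]: "G x \<le> G y \<longleftrightarrow> x \<le> y"
  using le_iff[of "G x" "G y"] by auto

lemma F_measurable [measurable]: "F \<in> borel_measurable borel"
  by (intro borel_measurable_mono monoI) simp

lemma G_measurable [measurable]: "G \<in> borel_measurable borel"
  by (intro borel_measurable_mono monoI) simp

text \<open>The interval (l, u) pulls back to (G l, G u), whose mass is F (G u) - F (G l) = u - l,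
  and boxes determine Lebesgue measure. The substitution rules of the locale all derive from this
  identity of measures.\<close>

lemma distr_density: "distr (density lborel (\<lambda>x. ennreal (\<rho> x))) borel F = lborel"
proof (rule lborel_eqI[symmetric])
  fix l u :: real assume lu: "\<And>b. b \<in> Basis \<Longrightarrow> l \<bullet> b \<le> u \<bullet> b"
  then have le: "l \<le> u" by simp
  have i: "set_integrable lborel {G l..G u} \<rho>" "(LINT x:{G l..G u}|lborel. \<rho> x) = F (G u) - F (G l)"
    using primitiveD[OF prim, of "G l" "G u"] le by auto
  have "emeasure (distr (density lborel (\<lambda>x. ennreal (\<rho> x))) borel F) (box l u)
      = emeasure (density lborel (\<lambda>x. ennreal (\<rho> x))) (F -` {l<..<u})"
    by (subst emeasure_distr) (auto simp: box_real)
  also have "F -` {l<..<u} = {G l<..<G u}"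
    using less_iff[of "G l"] less_iff[of _ "G u"] by (auto simp del: less_iff)
  also have "emeasure (density lborel (\<lambda>x. ennreal (\<rho> x))) {G l<..<G u}
      = (\<integral>\<^sup>+ x. ennreal (\<rho> x) * indicator {G l<..<G u} x \<partial>lborel)"
    by (rule emeasure_density) auto
  also have "\<dots> = (\<integral>\<^sup>+ x. ennreal (indicator {G l..G u} x *\<^sub>R \<rho> x) \<partial>lborel)"
  proof (rule nn_integral_cong_AE)
    show "AE x in lborel. ennreal (\<rho> x) * indicator {G l<..<G u} x = ennreal (indicator {G l..G u} x *\<^sub>R \<rho> x)"
      using AE_lborel_singleton[of "G l"] AE_lborel_singleton[of "G u"]
      by eventually_elim (auto simp: indicator_def)
  qed
  also have "\<dots> = ennreal (LINT x|lborel. indicator {G l..G u} x *\<^sub>R \<rho> x)"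
    by (rule nn_integral_eq_integral) (use i density_pos in \<open>auto simp: set_integrable_def\<close>)
  also have "\<dots> = ennreal (u - l)" using i by (simp add: set_lebesgue_integral_def)
  finally show "emeasure (distr (density lborel (\<lambda>x. ennreal (\<rho> x))) borel F) (box l u)
      = (\<Prod>b\<in>Basis. (u - l) \<bullet> b)" by simp
qed simp

lemma integral_subst:
  assumes [measurable]: "h \<in> borel_measurable borel"
  shows "(LINT x|lborel. \<rho> x * h (F x)) = (LINT x|lborel. (h x :: real))"
  by (subst (2) distr_density[symmetric])
     (simp add: integral_distr integral_density density_pos)

lemma integrable_subst:
  assumes [measurable]: "h \<in> borel_measurable borel"
  shows "integrable lborel (\<lambda>x. \<rho> x * h (F x)) \<longleftrightarrow> integrable lborel (h :: real \<Rightarrow> real)"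
  by (subst (2) distr_density[symmetric])
     (simp add: integrable_distr_eq integrable_density density_pos)

lemma set_integral_subst:
  assumes [measurable]: "h \<in> borel_measurable borel" "A \<in> sets borel"
  shows "(LINT x:F -` A|lborel. \<rho> x * h (F x)) = (LINT x:A|lborel. (h x :: real))"
    "set_integrable lborel (F -` A) (\<lambda>x. \<rho> x * h (F x)) \<longleftrightarrow> set_integrable lborel A (h :: real \<Rightarrow> real)"
  using integral_subst[of "\<lambda>x. indicator A x * h x"] integrable_subst[of "\<lambda>x. indicator A x * h x"]
  by (simp_all add: set_lebesgue_integral_def set_integrable_def indicator_def[abs_def] if_distrib mult_ac
      cong: if_cong)

lemma vimage_Icc: "F -` {F a..F b} = {a..b}" "F -` {x..y} = {G x..G y}"
  using le_iff[of "G x"] le_iff[of _ "G y"] by (auto simp del: le_iff) (auto)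

text \<open>The exceptional set is the image under F of a null set of labels. That F preserves null
  sets is read off from \<open>distr_density\<close>: a Lebesgue null set is null for the density
  measure, so its image is null for the push-forward.\<close>

lemma AE_G:
  assumes "AE x in lborel. P x" shows "AE x in lborel. P (G x)"
proof -
  obtain N where N: "{x. \<not> P x} \<subseteq> N" "N \<in> sets borel" "emeasure lborel N = 0"
    using assms by (auto elim!: AE_E)
  note [measurable] = N(2)
  have "AE x in lborel. x \<notin> N" using N by (intro AE_not_in) (auto simp: null_sets_def)
  then have "AE x in lborel. G (F x) \<notin> N" by simp
  then have "AE x in density lborel (\<lambda>x. ennreal (\<rho> x)). G (F x) \<notin> N"
    by (subst AE_density) (auto simp: density_pos)
  then have "AE x in distr (density lborel (\<lambda>x. ennreal (\<rho> x))) borel F. G x \<notin> N"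
    by (subst AE_distr_iff) auto
  then have "AE x in lborel. G x \<notin> N" by (simp only: distr_density)
  then show ?thesis by eventually_elim (use N in auto)
qed

lemma primitive_compose:
  assumes H: "primitive H h"
  shows "primitive (\<lambda>x. H (F x)) (\<lambda>x. \<rho> x * h (F x))"
  unfolding primitive_def
proof (intro allI impI)
  fix a b :: real assume "a \<le> b"
  then show "set_integrable lborel {a..b} (\<lambda>x. \<rho> x * h (F x)) \<and>
       (LINT x:{a..b}|lborel. \<rho> x * h (F x)) = H (F b) - H (F a)"
    using primitiveD[OF H, of "F a" "F b"] set_integral_subst[OF primitive_measurable[OF H], of "{F a..F b}"]
    by (simp add: vimage_Icc)
qed

text \<open>Substitution backwards: the factor \<rho> cancels the denominator. This is where slopes
  appear as quotients of label densities.\<close>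

lemma primitive_compose_inverse:
  assumes H: "primitive H h"
  shows "primitive (\<lambda>x. H (G x)) (\<lambda>x. h (G x) / \<rho> (G x))"
  unfolding primitive_def
proof (intro allI impI)
  fix a b :: real assume "a \<le> b"
  note [measurable] = primitive_measurable[OF H]
  have e: "\<rho> x * (h (G (F x)) / \<rho> (G (F x))) = h x" for x using density_pos(1)[of x] by simp
  have "set_integrable lborel {G a..G b} h" "(LINT x:{G a..G b}|lborel. h x) = H (G b) - H (G a)"
    using primitiveD[OF H, of "G a" "G b"] \<open>a \<le> b\<close> by auto
  then show "set_integrable lborel {a..b} (\<lambda>x. h (G x) / \<rho> (G x)) \<and>
       (LINT x:{a..b}|lborel. h (G x) / \<rho> (G x)) = H (G b) - H (G a)"
    using set_integral_subst[of "\<lambda>x. h (G x) / \<rho> (G x)" "{a..b}"] 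
    by (simp only: vimage_Icc e) simp
qed

end

section \<open>Weak derivatives\<close>

definition smooth :: "(real \<Rightarrow> real) \<Rightarrow> bool" where
  "smooth f \<longleftrightarrow> (\<forall>k x. (deriv ^^ k) f field_differentiable at x)"

text \<open>A class of differentiable functions closed under \<open>deriv\<close> contains all
  iterated derivatives of its members; exhibiting such a class replaces a formula for the k-th
  derivative.\<close>

lemma smooth_coinduct:
  assumes "f \<in> S" and step: "\<And>f. f \<in> S \<Longrightarrow> (\<forall>x. f field_differentiable at x) \<and> deriv f \<in> S"
  shows "smooth f"
proof -
  have "(deriv ^^ k) f \<in> S" for k by (induction k) (use assms in auto)
  then show ?thesis using step by (auto simp: smooth_def)
qed

lemma smooth_differentiable: "smooth f \<Longrightarrow> f field_differentiable at x"
  unfolding smooth_def by (metis funpow_0)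

lemma smooth_deriv: "smooth f \<Longrightarrow> smooth (deriv f)"
  unfolding smooth_def by (metis funpow_Suc_right o_apply)

lemma smooth_has_derivative: "smooth f \<Longrightarrow> (f has_real_derivative deriv f x) (at x)"
  using smooth_differentiable field_differentiable_derivI by blast

lemma smooth_affine:
  assumes "smooth f" shows "smooth (\<lambda>x. f (a * x + b))"
proof (rule smooth_coinduct[where S = "{(\<lambda>x. c * g (a * x + b)) | c g. smooth g}"])
  show "(\<lambda>x. f (a * x + b)) \<in> {(\<lambda>x. c * g (a * x + b)) | c g. smooth g}"
    using assms by (auto intro!: exI[of _ 1] exI[of _ f])
next
  fix h assume "h \<in> {(\<lambda>x. c * g (a * x + b)) | c g. smooth g}"
  then obtain c g where h: "h = (\<lambda>x. c * g (a * x + b))" and g: "smooth g" by auto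
  have d: "(h has_real_derivative c * a * deriv g (a * x + b)) (at x)" for x
    unfolding h by (auto intro!: derivative_eq_intros DERIV_chain2[OF smooth_has_derivative[OF g]])
  then have "deriv h = (\<lambda>x. (c * a) * deriv g (a * x + b))" by (auto intro!: DERIV_imp_deriv)
  then show "(\<forall>x. h field_differentiable at x) \<and> deriv h \<in> {(\<lambda>x. c * g (a * x + b)) | c g. smooth g}"
    using d smooth_deriv[OF g] unfolding field_differentiable_def by blast
qed

text \<open>By the Leibniz rule the derivative of a product is a sum of products, so this class,
  unlike the class of single products, is visibly closed under \<open>deriv\<close>.\<close>

inductive_set product_sums :: "(real \<Rightarrow> real) set" where
  "smooth f \<Longrightarrow> smooth g \<Longrightarrow> (\<lambda>x. f x * g x) \<in> product_sums"
| "f \<in> product_sums \<Longrightarrow> g \<in> product_sums \<Longrightarrow> (\<lambda>x. f x + g x) \<in> product_sums"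

lemma smooth_mult:
  assumes "smooth f" "smooth g" shows "smooth (\<lambda>x. f x * g x)"
proof (rule smooth_coinduct[where S = product_sums])
  show "(\<lambda>x. f x * g x) \<in> product_sums" using assms by (rule product_sums.intros)
next
  fix h assume "h \<in> product_sums"
  then show "(\<forall>x. h field_differentiable at x) \<and> deriv h \<in> product_sums"
  proof induction
    case (1 f g)
    have d: "((\<lambda>x. f x * g x) has_real_derivative deriv f x * g x + f x * deriv g x) (at x)" for x
      using smooth_has_derivative[OF 1(1)] smooth_has_derivative[OF 1(2)]
      by (auto intro!: derivative_eq_intros)
    then have "deriv (\<lambda>x. f x * g x) = (\<lambda>x. deriv f x * g x + f x * deriv g x)"
      by (auto intro!: DERIV_imp_deriv)
    then show ?case using d 1 smooth_deriv
      unfolding field_differentiable_def by (auto intro!: product_sums.intros)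
  next
    case (2 f g)
    then have "deriv (\<lambda>x. f x + g x) = (\<lambda>x. deriv f x + deriv g x)" by auto
    then show ?case using 2 by (auto intro!: product_sums.intros field_differentiable_add)
  qed
qed

text \<open>The derivatives of $e^{-1/x}$ have the form $p(1/x)\,e^{-1/x}$ with a polynomial $p$.\<close>

definition flat :: "real poly \<Rightarrow> real \<Rightarrow> real" where
  "flat p x = (if 0 < x then poly p (inverse x) * exp (- inverse x) else 0)"

lemma tendsto_poly_exp: "((\<lambda>y. poly p y * exp (- y)) \<longlongrightarrow> (0::real)) at_top"
proof -
  have "((\<lambda>y. \<Sum>i\<le>degree p. coeff p i * (y ^ i / exp y)) \<longlongrightarrow> (\<Sum>i\<le>degree p. coeff p i * 0)) at_top"
    by (intro tendsto_intros tendsto_power_div_exp_0)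
  then show ?thesis
    by (simp add: poly_altdef exp_minus field_simps sum_distrib_left sum_divide_distrib)
qed

lemma flat_tendsto_0: "(flat p \<longlongrightarrow> 0) (at 0)"
proof (rule filterlim_split_at)
  have "eventually (\<lambda>x. flat p x = 0) (at_left 0)"
    by (auto simp: flat_def eventually_at_left_field intro!: exI[of _ "-1"])
  then show "(flat p \<longlongrightarrow> 0) (at_left 0)" by (rule tendsto_eventually)
  have "((\<lambda>x. poly p (inverse x) * exp (- inverse x)) \<longlongrightarrow> 0) (at_right 0)"
    by (rule filterlim_compose[OF tendsto_poly_exp filterlim_inverse_at_top_right])
  moreover have "eventually (\<lambda>x. poly p (inverse x) * exp (- inverse x) = flat p x) (at_right 0)"
    by (auto simp: flat_def eventually_at_right_field intro!: exI[of _ 1])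
  ultimately show "(flat p \<longlongrightarrow> 0) (at_right 0)"
    by (rule Lim_transform_eventually)
qed

text \<open>With y = 1/x the chain rule contributes the factor -y^2, so the polynomial p becomes y^2
  (p - p'); \<open>monom 1 2\<close> stands for y^2.\<close>

lemma flat_has_derivative:
  "(flat p has_real_derivative flat (monom 1 2 * (p - pderiv p)) x) (at x)"
proof -
  consider "x < 0" | "x = 0" | "0 < x" by linarith
  then show ?thesis
  proof cases
    case 1
    have "((\<lambda>_. 0) has_real_derivative flat (monom 1 2 * (p - pderiv p)) x) (at x)"
      using 1 by (simp add: flat_def)
    then show ?thesis
      by (rule has_field_derivative_transform_within_open[where S="{..<0}"]) (use 1 in \<open>auto simp: flat_def\<close>)
  next
    case 2
    \<comment> \<open>Division by h multiplies the polynomial in 1/h by its variable, so the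
      difference quotient at 0 has the same form again and tends to 0.\<close>
    have "flat (pCons 0 p) = (\<lambda>h. (flat p (0 + h) - flat p 0) / h)"
      by (auto simp: flat_def fun_eq_iff field_simps)
    then have "((\<lambda>h. (flat p (0 + h) - flat p 0) / h) \<longlongrightarrow> 0) (at 0)"
      using flat_tendsto_0[of "pCons 0 p"] by simp
    then show ?thesis using 2 by (simp add: DERIV_def flat_def)
  next
    case 3
    have "((\<lambda>x. poly p (inverse x) * exp (- inverse x)) has_real_derivative
        flat (monom 1 2 * (p - pderiv p)) x) (at x)"
      using 3
      by (auto intro!: derivative_eq_intros DERIV_chain2[OF poly_DERIV]
          simp: flat_def poly_monom power2_eq_square algebra_simps)
    then show ?thesis
      by (rule has_field_derivative_transform_within_open[where S="{0<..}"]) (use 3 in \<open>auto simp: flat_def\<close>)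
  qed
qed

lemma smooth_flat: "smooth (flat p)"
proof (rule smooth_coinduct[where S = "range flat"])
  fix f assume "f \<in> range flat"
  then obtain p where p: "f = flat p" by auto
  have "deriv f = flat (monom 1 2 * (p - pderiv p))"
    unfolding p using flat_has_derivative by (auto intro!: DERIV_imp_deriv)
  then show "(\<forall>x. f field_differentiable at x) \<and> deriv f \<in> range flat"
    using flat_has_derivative unfolding p field_differentiable_def by blast
qed simp

text \<open>Two flat functions, one for each end point, are multiplied. Stretching their arguments
  by n + 1 sends the exponents -1/((n + 1)(x - a)) and -1/((n + 1)(b - x)) to 0, so the product
  tends to 1 inside the interval, while it is exactly 0 outside.\<close>

lemma indicator_limit_of_test_functions:
  assumes "a < b"
  obtains \<phi> where "\<And>n. test_function (\<phi> n)" "\<And>n x. \<bar>\<phi> n x\<bar> \<le> indicator {a..b} x"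
    "\<And>x. (\<lambda>n. \<phi> n x) \<longlonglongrightarrow> indicator {a<..<b} x"
proof
  define \<phi> where "\<phi> n x = flat 1 (real (Suc n) * x + - real (Suc n) * a) * flat 1 ((- real (Suc n)) * x + real (Suc n) * b)" for n x
  have e: "\<phi> n x = (if a < x \<and> x < b then exp (- inverse (real (Suc n) * (x - a))) * exp (- inverse (real (Suc n) * (b - x))) else 0)" for n x
  proof -
    have "real (Suc n) * x + - real (Suc n) * a = real (Suc n) * (x - a)"
      "(- real (Suc n)) * x + real (Suc n) * b = real (Suc n) * (b - x)"
      by (auto simp: algebra_simps)
    then show ?thesis unfolding \<phi>_def by (simp only: flat_def zero_less_mult_iff) auto
  qed
  show "test_function (\<phi> n)" for n
  proof -
    have "smooth (\<phi> n)" unfolding \<phi>_def by (intro smooth_mult smooth_affine smooth_flat)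
    moreover have "bounded {x. \<phi> n x \<noteq> 0}"
      by (rule bounded_subset[of "{a..b}"]) (auto simp: e)
    ultimately show ?thesis by (auto simp: test_function_def smooth_def)
  qed
  show "\<bar>\<phi> n x\<bar> \<le> indicator {a..b} x" for n x
    by (auto simp: e abs_mult intro!: mult_le_one)
  show "(\<lambda>n. \<phi> n x) \<longlonglongrightarrow> indicator {a<..<b} x" for x
  proof (cases "a < x \<and> x < b")
    case True
    have *: "(\<lambda>n. inverse (real (Suc n) * d)) \<longlonglongrightarrow> 0" for d
      using tendsto_mult[OF LIMSEQ_inverse_real_of_nat tendsto_const[of "inverse d"]] by (simp add: inverse_mult_distrib)
    have "(\<lambda>n. exp (- inverse (real (Suc n) * (x - a))) * exp (- inverse (real (Suc n) * (b - x)))) \<longlonglongrightarrow> exp (-0) * exp (-0)"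
      by (intro tendsto_intros *)
    then show ?thesis using True by (simp add: e)
  qed (auto simp: e)
qed

text \<open>After restriction to [-n, n] the integral vanishes over every interval, hence over every
  Borel set, since this property passes to complements and countable disjoint unions. An integrable
  function all of whose set integrals vanish is zero almost everywhere.\<close>

lemma AE_zero_if_interval_integrals_zero:
  fixes f :: "real \<Rightarrow> real"
  assumes int: "\<And>a b. set_integrable lborel {a..b} f"
    and zero: "\<And>a b. a < b \<Longrightarrow> (LINT x:{a<..<b}|lborel. f x) = 0"
  shows "AE x in lborel. f x = 0"
proof -
  have "AE x in lborel. indicator {- real n..real n} x *\<^sub>R f x = 0" for n
  proof (rule density_unique_real)
    let ?f = "\<lambda>x. indicator {- real n..real n} x *\<^sub>R f x"
    show i: "integrable lborel ?f" using int[of "- real n" "real n"] by (simp add: set_integrable_def)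
    show "integrable lborel (\<lambda>_. 0 :: real)" by simp
    have si: "set_integrable lborel A ?f" if "A \<in> sets borel" for A
      unfolding set_integrable_def by (rule integrable_mult_indicator) (use that i in auto)
    have box0: "(LINT x:{a..b}|lborel. ?f x) = 0" for a b
    proof -
      let ?a = "max a (- real n)" and ?b = "min b (real n)"
      have "(LINT x:{a..b}|lborel. ?f x) = (LINT x:{?a<..<?b}|lborel. f x)"
        unfolding set_lebesgue_integral_def
      proof (rule integral_cong_AE)
        show "(\<lambda>x. indicator {a..b} x *\<^sub>R ?f x) \<in> borel_measurable lborel"
          using si[of "{a..b}"] unfolding set_integrable_def by (auto dest!: borel_measurable_integrable)
        have "set_integrable lborel {?a<..<?b} f"
          by (rule set_integrable_subset[OF int[of ?a ?b]]) auto
        then show "(\<lambda>x. indicator {?a<..<?b} x *\<^sub>R f x) \<in> borel_measurable lborel"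
          unfolding set_integrable_def by (auto dest!: borel_measurable_integrable)
        show "AE x in lborel. indicator {a..b} x *\<^sub>R ?f x = indicator {?a<..<?b} x *\<^sub>R f x"
          using AE_lborel_singleton[of "- real n"] AE_lborel_singleton[of "real n"]
            AE_lborel_singleton[of a] AE_lborel_singleton[of b]
          by eventually_elim (auto simp: indicator_def)
      qed
      also have "\<dots> = 0" 
      proof (cases "?a < ?b")
        case True then show ?thesis by (rule zero)
      next
        case False
        then have "{?a<..<?b} = {}" by (simp only: greaterThanLessThan_empty_iff not_less)
        then show ?thesis by (simp only:) (simp add: set_lebesgue_integral_def)
      qed
      finally show ?thesis .
    qed
    fix A :: "real set" assume "A \<in> sets lborel"
    then have "A \<in> sets borel" by simp
    then have "(LINT x:A|lborel. ?f x) = 0"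
    proof (induction rule: borel_set_induct)
      case (compl A)
      then have "(LINT x:A \<union> - A|lborel. ?f x) = (LINT x:A|lborel. ?f x) + (LINT x:- A|lborel. ?f x)"
        by (intro set_integral_Un si) auto
      moreover have "(LINT x:A \<union> - A|lborel. ?f x) = (LINT x:{- real n..real n}|lborel. ?f x)"
        unfolding set_lebesgue_integral_def by (rule Bochner_Integration.integral_cong) (auto simp: indicator_def)
      ultimately show ?case using box0 compl by simp
    next
      case (union A)
      then have "(LINT x:(\<Union>i. A i)|lborel. ?f x) = (\<Sum>i. LINT x:A i|lborel. ?f x)"
        by (intro lebesgue_integral_countable_add si) (auto simp: disjoint_family_on_def)
      then show ?case using union by simp
    qed (simp_all only: box0, simp add: set_lebesgue_integral_def)
    then show "(LINT x:A|lborel. ?f x) = (LINT x:A|lborel. 0)" by simp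
  qed
  then have "AE x in lborel. \<forall>n. indicator {- real n..real n} x *\<^sub>R f x = 0"
    by (intro iffD2[OF AE_all_countable] allI)
  then show ?thesis
  proof eventually_elim
    case (elim x)
    obtain n where "\<bar>x\<bar> \<le> real n" using real_arch_simple by blast
    then have "x \<in> {- real n..real n}" by (auto simp: abs_le_iff)
    then show ?case using elim by (metis indicator_simps(1) scaleR_one)
  qed
qed

text \<open>The du Bois-Reymond lemma: test functions tending boundedly to the indicator of an
  interval turn the weak identity into vanishing interval integrals of g - h. Any explicit weak
  derivative can thereby stand in for \<open>weak_deriv\<close>.\<close>

lemma weak_derivative_unique:
  assumes "has_weak_derivative f g" "has_weak_derivative f h"
  shows "AE x in lborel. g x = h x"
proof -
  have gm: "g \<in> borel_measurable borel" and hm: "h \<in> borel_measurable borel"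
    using assms by (auto simp: has_weak_derivative_def)
  have si: "set_integrable lborel {a..b} k" if "has_weak_derivative f k" for k a b
  proof -
    have "set_integrable lborel {- max \<bar>a\<bar> \<bar>b\<bar>..max \<bar>a\<bar> \<bar>b\<bar>} k"
      using that by (auto simp: has_weak_derivative_def)
    then show ?thesis by (rule set_integrable_subset) auto
  qed
  have "AE x in lborel. g x - h x = 0"
  proof (rule AE_zero_if_interval_integrals_zero)
    show si_diff: "set_integrable lborel {a..b} (\<lambda>x. g x - h x)" for a b
      using si assms by (intro set_integral_diff) auto
    fix a b :: real assume "a < b"
    then obtain \<phi> where \<phi>: "\<And>n. test_function (\<phi> n)" "\<And>n x. \<bar>\<phi> n x\<bar> \<le> indicator {a..b} x"
      "\<And>x. (\<lambda>n. \<phi> n x) \<longlonglongrightarrow> indicator {a<..<b} x"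
      by (rule indicator_limit_of_test_functions) blast
    have [measurable]: "\<phi> n \<in> borel_measurable borel" for n
    proof -
      have "smooth (\<phi> n)" using \<phi>(1)[of n] by (auto simp: test_function_def smooth_def)
      then show ?thesis
        by (intro borel_measurable_continuous_onI continuous_at_imp_continuous_on ballI)
           (auto dest!: smooth_has_derivative intro: DERIV_isCont)
    qed
    note [measurable] = gm hm
    have bound: "\<bar>k x * \<phi> n x\<bar> \<le> \<bar>indicator {a..b} x *\<^sub>R k x\<bar>" for k n and x :: real
    proof (cases "x \<in> {a..b}")
      case True
      then have "\<bar>\<phi> n x\<bar> \<le> 1" using \<phi>(2)[of n x] by simp
      then have "\<bar>k x\<bar> * \<bar>\<phi> n x\<bar> \<le> \<bar>k x\<bar> * 1" by (intro mult_left_mono) auto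
      then show ?thesis using True by (simp add: abs_mult)
    next
      case False
      then show ?thesis using \<phi>(2)[of n x] by simp
    qed
    have int: "integrable lborel (\<lambda>x. k x * \<phi> n x)"
      if "set_integrable lborel {a..b} k" "k \<in> borel_measurable borel" for k n
      by (rule Bochner_Integration.integrable_bound[OF that(1)[unfolded set_integrable_def]])
         (use bound that(2) in auto)
    have "(LINT x|lborel. (g x - h x) * \<phi> n x) = 0" for n
    proof -
      have "(LINT x|lborel. (g x - h x) * \<phi> n x) = (LINT x|lborel. g x * \<phi> n x) - (LINT x|lborel. h x * \<phi> n x)"
        using int[OF si[OF assms(1)] gm] int[OF si[OF assms(2)] hm] by (simp add: left_diff_distrib)
      also have "\<dots> = 0"
        using assms \<phi>(1)[of n] by (auto simp: has_weak_derivative_def)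
      finally show ?thesis .
    qed
    moreover have "(\<lambda>n. LINT x|lborel. (g x - h x) * \<phi> n x) \<longlonglongrightarrow> (LINT x|lborel. (g x - h x) * indicator {a<..<b} x)"
    proof (rule integral_dominated_convergence)
      show "integrable lborel (\<lambda>x. \<bar>indicator {a..b} x *\<^sub>R (g x - h x)\<bar>)"
        using si_diff[of a b] unfolding set_integrable_def by (rule integrable_abs)
      show "AE x in lborel. (\<lambda>n. (g x - h x) * \<phi> n x) \<longlonglongrightarrow> (g x - h x) * indicator {a<..<b} x"
        by (intro AE_I2 tendsto_mult tendsto_const \<phi>(3))
      show "AE x in lborel. norm ((g x - h x) * \<phi> n x) \<le> \<bar>indicator {a..b} x *\<^sub>R (g x - h x)\<bar>" for n
        using bound[of "\<lambda>x. g x - h x" _ n] by auto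
    qed auto
    ultimately have "(LINT x|lborel. (g x - h x) * indicator {a<..<b} x) = 0"
      by (simp add: LIMSEQ_const_iff)
    then show "(LINT x:{a<..<b}|lborel. g x - h x) = 0"
      by (simp add: set_lebesgue_integral_def mult.commute)
  qed
  then show ?thesis by eventually_elim simp
qed

text \<open>The product rule for primitives is applied on an interval whose end points lie outside
  the support of the test function, so that the boundary terms vanish.\<close>

lemma primitive_has_weak_derivative:
  assumes "primitive f g" shows "has_weak_derivative f g"
proof -
  have [measurable]: "f \<in> borel_measurable borel" "g \<in> borel_measurable borel"
    using assms by (auto intro!: borel_measurable_continuous_onI primitive_continuous dest: primitive_measurable)
  have "(LINT x|lborel. f x * deriv \<phi> x) = - (LINT x|lborel. g x * \<phi> x)" if \<phi>: "test_function \<phi>" for \<phi>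
  proof -
    have sm: "smooth \<phi>" using \<phi> by (auto simp: test_function_def smooth_def)
    have cont: "continuous_on UNIV \<psi>" if "smooth \<psi>" for \<psi>
      using smooth_has_derivative[OF that] by (meson DERIV_isCont continuous_at_imp_continuous_on)
    have p: "primitive \<phi> (deriv \<phi>)"
      using sm by (intro primitive_deriv smooth_has_derivative cont smooth_deriv)
    have "bounded {x. \<phi> x \<noteq> 0}" using \<phi> by (simp add: test_function_def)
    then obtain R where "\<forall>x\<in>{x. \<phi> x \<noteq> 0}. norm x \<le> R" unfolding bounded_iff by blast
    then have R: "\<phi> x = 0" if "\<bar>x\<bar> > R" for x using that by force
    have dR: "deriv \<phi> x = 0" if "\<bar>x\<bar> > R" for x
    proof (rule DERIV_imp_deriv)
      have "open {x :: real. \<bar>x\<bar> > R}" by (intro open_Collect_less continuous_intros)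
      then show "(\<phi> has_real_derivative 0) (at x)"
        using that R by (intro has_field_derivative_transform_within_open[of "\<lambda>_. 0" 0 x "{x. \<bar>x\<bar> > R}" \<phi>]) auto
    qed
    define r where "r = \<bar>R\<bar> + 1"
    have r: "\<phi> x = 0" "deriv \<phi> x = 0" if "x \<notin> {- r..r}" for x
    proof -
      have "\<bar>x\<bar> > R" using that by (auto simp: r_def)
      then show "\<phi> x = 0" "deriv \<phi> x = 0" using R dR by auto
    qed
    have r0: "\<phi> r = 0" "\<phi> (- r) = 0" using R by (auto simp: r_def)
    have rle: "- r \<le> r" by (simp add: r_def)
    have i1: "set_integrable lborel {-r..r} (\<lambda>x. g x * \<phi> x)"
      by (rule primitive_bounded_mult_integrable[OF assms])
         (auto intro: continuous_on_subset[OF cont[OF sm]] borel_measurable_continuous_onI cont sm)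
    have i2: "set_integrable lborel {-r..r} (\<lambda>x. f x * deriv \<phi> x)"
      using primitive_bounded_mult_integrable[OF p, of "-r" r f] primitive_continuous[OF assms]
      by (simp add: mult.commute)
    have "(LINT x:{-r..r}|lborel. g x * \<phi> x + f x * deriv \<phi> x) = 0"
      using primitiveD(2)[OF primitive_mult[OF assms p] rle] r0 by simp
    then have "(LINT x:{-r..r}|lborel. g x * \<phi> x) + (LINT x:{-r..r}|lborel. f x * deriv \<phi> x) = 0"
      using i1 i2 by simp
    moreover have "(LINT x:{-r..r}|lborel. g x * \<phi> x) = (LINT x|lborel. g x * \<phi> x)"
      unfolding set_lebesgue_integral_def
      by (rule Bochner_Integration.integral_cong) (use r(1) in \<open>auto simp: indicator_def\<close>)
    moreover have "(LINT x:{-r..r}|lborel. f x * deriv \<phi> x) = (LINT x|lborel. f x * deriv \<phi> x)"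
      unfolding set_lebesgue_integral_def
      by (rule Bochner_Integration.integral_cong) (use r(2) in \<open>auto simp: indicator_def\<close>)
    ultimately show ?thesis by simp
  qed
  moreover have "set_integrable lborel {- R..R} f \<and> set_integrable lborel {- R..R} g" for R
  proof (cases "- R \<le> R")
    case True
    then show ?thesis
      using primitiveD(1)[OF assms True] borel_integrable_atLeastAtMost'[OF primitive_continuous[OF assms]] by auto
  qed (simp add: set_integrable_def)
  ultimately show ?thesis by (auto simp: has_weak_derivative_def)
qed

section \<open>Exponential kernels\<close>

lemma exp_kernel_right:
  assumes "0 < l"
  shows "integrable lborel (\<lambda>z. indicator {x..} z * exp (- (z - x) / l))"
    "(LINT z|lborel. indicator {x..} z * exp (- (z - x) / l)) = (l :: real)"
proof -
  have "has_bochner_integral lborel (\<lambda>z. indicator {x..} z * exp (- (z - x) / l)) l"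
  proof (rule has_bochner_integral_nn_integral)
    have lim: "((\<lambda>z. exp (- (z - x) / l)) \<longlongrightarrow> 0) at_top"
    proof (rule filterlim_compose[OF exp_at_bot])
      have "filterlim (\<lambda>z. (1 / l) * ((- x) + z)) at_top at_top"
        using assms by (intro filterlim_tendsto_pos_mult_at_top[OF tendsto_const]
            filterlim_tendsto_add_at_top[OF tendsto_const] filterlim_ident) auto
      moreover have "(1 / l) * ((- x) + z) = - (- (z - x) / l)" for z
        by (simp add: diff_divide_distrib)
      ultimately show "filterlim (\<lambda>z. - (z - x) / l) at_bot at_top"
        by (subst filterlim_uminus_at_bot) simp
    qed
    have "(\<integral>\<^sup>+z. ennreal (exp (- (z - x) / l)) * indicator {x..} z \<partial>lborel)
        = ennreal (0 - (- l * exp (- (x - x) / l)))"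
    proof (rule nn_integral_FTC_atLeast[where F = "\<lambda>z. - l * exp (- (z - x) / l)"])
      show "DERIV (\<lambda>z. - l * exp (- (z - x) / l)) z :> exp (- (z - x) / l)" for z
      proof -
        have "((\<lambda>z. - l * exp ((x - z) / l)) has_real_derivative exp ((x - z) / l)) (at z)"
          using assms by (auto intro!: derivative_eq_intros)
        then show ?thesis by simp
      qed
      have "((\<lambda>z. - l * exp (- (z - x) / l)) \<longlongrightarrow> - l * 0) at_top"
        by (intro tendsto_intros lim)
      then show "((\<lambda>z. - l * exp (- (z - x) / l)) \<longlongrightarrow> 0) at_top" by simp
    qed simp_all
    then show "(\<integral>\<^sup>+z. ennreal (indicator {x..} z * exp (- (z - x) / l)) \<partial>lborel) = ennreal l"
      by (simp add: mult.commute ennreal_mult'' ennreal_indicator)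
  qed (use assms in auto)
  then show "integrable lborel (\<lambda>z. indicator {x..} z * exp (- (z - x) / l))"
    "(LINT z|lborel. indicator {x..} z * exp (- (z - x) / l)) = (l :: real)"
    by (auto simp: has_bochner_integral_iff)
qed

lemma exp_kernel_left:
  assumes "0 < l"
  shows "integrable lborel (\<lambda>z. indicator {..x} z * exp (- (x - z) / l))"
    "(LINT z|lborel. indicator {..x} z * exp (- (x - z) / l)) = (l :: real)"
proof -
  have e: "indicator {-x..} (0 + (-1) * z) * exp (- ((0 + (-1) * z) - (-x)) / l) = indicator {..x} z * exp (- (x - z) / l)" for z
    by (auto simp: indicator_def)
  show "integrable lborel (\<lambda>z. indicator {..x} z * exp (- (x - z) / l))"
    using lborel_integrable_real_affine[OF exp_kernel_right(1)[OF assms, of "-x"], of "-1" 0] unfolding e by simp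
  show "(LINT z|lborel. indicator {..x} z * exp (- (x - z) / l)) = (l :: real)"
    using lborel_integral_real_affine[of "-1" "\<lambda>z. indicator {-x..} z * exp (- (z - (-x)) / l)" 0] 
      exp_kernel_right(2)[OF assms, of "-x"] unfolding e by simp
qed

lemma exp_kernel:
  assumes "0 < l"
  shows "integrable lborel (\<lambda>z. exp (- \<bar>x - z\<bar> / l))" "(LINT z|lborel. exp (- \<bar>x - z\<bar> / l)) = (2 * l :: real)"
proof -
  let ?s = "\<lambda>z. indicator {x..} z * exp (- (z - x) / l) + indicator {..x} z * exp (- (x - z) / l)"
  have i: "integrable lborel ?s" and v: "(LINT z|lborel. ?s z) = 2 * l"
    using exp_kernel_right[OF assms, of x] exp_kernel_left[OF assms, of x] by simp_all
  have ae: "AE z in lborel. ?s z = exp (- \<bar>x - z\<bar> / l)"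
    using AE_lborel_singleton[of x] by eventually_elim (auto simp: indicator_def diff_divide_distrib)
  show "integrable lborel (\<lambda>z. exp (- \<bar>x - z\<bar> / l))"
    using integrable_cong_AE[OF _ _ ae] i by simp
  show "(LINT z|lborel. exp (- \<bar>x - z\<bar> / l)) = 2 * l"
    using integral_cong_AE[OF _ _ ae] v by simp
qed

text \<open>The Green function is nonnegative with integral 1, so a bound on half the squared slope
  passes to the convolution with no dependence on l. The existence of g guarantees that
  \<open>weak_deriv w\<close> is a weak derivative, and uniqueness transfers the bound B to
  it.\<close>

lemma pressure_bounds:
  assumes "0 < l" and w: "has_weak_derivative w g" and B: "AE x in lborel. \<bar>g x\<bar> \<le> B"
  shows "0 \<le> pressure l w x" "pressure l w x \<le> B\<^sup>2 / 2"
proof -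
  have wd: "has_weak_derivative w (weak_deriv w)"
    unfolding weak_deriv_def using w by (rule someI[of "has_weak_derivative w"])
  have ae: "AE z in lborel. (weak_deriv w z)\<^sup>2 \<le> B\<^sup>2"
    using weak_derivative_unique[OF wd w] B 
    by eventually_elim (metis abs_le_square_iff abs_ge_self order_trans)
  have [measurable]: "weak_deriv w \<in> borel_measurable borel"
    using wd by (auto simp: has_weak_derivative_def)
  show "0 \<le> pressure l w x" unfolding pressure_def
    by (rule integral_nonneg_AE) (use assms(1) in \<open>auto simp: green_def\<close>)
  have i: "integrable lborel (\<lambda>z. green l (x - z) * (B\<^sup>2 / 2))"
    unfolding green_def using exp_kernel(1)[OF assms(1), of x] by simp
  have m: "AE z in lborel. green l (x - z) * ((weak_deriv w z)\<^sup>2 / 2) \<le> green l (x - z) * (B\<^sup>2 / 2)"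
    using ae by eventually_elim (use assms(1) in \<open>simp add: green_def divide_right_mono mult_left_mono\<close>)
  have "integrable lborel (\<lambda>z. green l (x - z) * ((weak_deriv w z)\<^sup>2 / 2))"
  proof (rule Bochner_Integration.integrable_bound[OF i])
    show "AE z in lborel. norm (green l (x - z) * ((weak_deriv w z)\<^sup>2 / 2)) \<le> norm (green l (x - z) * (B\<^sup>2 / 2))"
      using m by eventually_elim (use assms(1) in \<open>auto simp: green_def abs_mult\<close>)
  qed (simp add: green_def)
  then have "pressure l w x \<le> (LINT z|lborel. green l (x - z) * (B\<^sup>2 / 2))"
    unfolding pressure_def using i m by (intro integral_mono_AE) auto
  also have "\<dots> = B\<^sup>2 / 2"
    unfolding green_def using exp_kernel(2)[OF assms(1), of x] assms(1) by simp
  finally show "pressure l w x \<le> B\<^sup>2 / 2" .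
qed

lemma primitive_reflect:
  assumes "primitive F f" shows "primitive (\<lambda>x. F (- x)) (\<lambda>x. - f (- x))"
  unfolding primitive_def
proof (intro allI impI)
  fix a b :: real assume "a \<le> b"
  have e: "{x. - x \<in> {- b..- a}} = {a..b}" by auto
  have i: "set_integrable lborel {-b..-a} f" "(LINT x:{-b..-a}|lborel. f x) = F (-a) - F (-b)"
    using primitiveD[OF assms, of "-b" "-a"] \<open>a \<le> b\<close> by auto
  moreover have "set_integrable lborel {a..b} (\<lambda>x. f (- x))"
  proof -
    have "indicator {-b..-a} (0 + -1 * x) *\<^sub>R f (0 + -1 * x) = indicator {a..b} x *\<^sub>R f (- x)" for x
      by (auto simp: indicator_def)
    moreover have "integrable lborel (\<lambda>x. indicator {-b..-a} (0 + -1 * x) *\<^sub>R f (0 + -1 * x))"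
      using i(1) unfolding set_integrable_def by (intro lborel_integrable_real_affine) auto
    ultimately show ?thesis unfolding set_integrable_def by (simp only:)
  qed
  ultimately show "set_integrable lborel {a..b} (\<lambda>x. - f (- x)) \<and> (LINT x:{a..b}|lborel. - f (- x)) = F (- b) - F (- a)"
    using set_integral_reflect[of "{-b..-a}" f] unfolding e by (simp add: set_integrable_def set_lebesgue_integral_def)
qed

text \<open>When s is the square of the slope, the next two integrals are, up to a factor, the two halves
  of the convolution of s with the Green function, so that $P$ and $P_x$ are their sum and difference.\<close>

lemma primitive_exp_kernel_right:
  assumes "0 < l" and s[measurable]: "s \<in> borel_measurable borel" and K: "\<And>x. \<bar>s x\<bar> \<le> (K :: real)"
  defines "A \<equiv> \<lambda>x. LINT z:{x..}|lborel. exp (- (z - x) / l) * s z"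
  shows "primitive A (\<lambda>x. A x / l - s x)" "\<bar>A x\<bar> \<le> K * l"
    "set_integrable lborel {x..} (\<lambda>z. exp (- (z - x) / l) * s z)"
proof -
  have iA: "set_integrable lborel {x..} (\<lambda>z. exp (- (z - x) / l) * s z)" for x
    unfolding set_integrable_def
  proof (rule Bochner_Integration.integrable_bound)
    show "integrable lborel (\<lambda>z. K * (indicator {x..} z * exp (- (z - x) / l)))"
      using exp_kernel_right(1)[OF assms(1)] by simp
    show "AE z in lborel. norm (indicator {x..} z *\<^sub>R (exp (- (z - x) / l) * s z)) \<le> norm (K * (indicator {x..} z * exp (- (z - x) / l)))"
    proof (rule AE_I2)
      fix z show "norm (indicator {x..} z *\<^sub>R (exp (- (z - x) / l) * s z)) \<le> norm (K * (indicator {x..} z * exp (- (z - x) / l)))"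
        using K[of z] by (auto simp: abs_mult indicator_def mult.commute)
    qed
  qed simp
  then show "set_integrable lborel {x..} (\<lambda>z. exp (- (z - x) / l) * s z)" .
  have "\<bar>A x\<bar> \<le> (LINT z|lborel. K * (indicator {x..} z * exp (- (z - x) / l)))"
    unfolding A_def set_lebesgue_integral_def
  proof (rule order_trans[OF integral_abs_bound integral_mono])
    show "integrable lborel (\<lambda>z. \<bar>indicator {x..} z *\<^sub>R (exp (- (z - x) / l) * s z)\<bar>)"
      using iA[of x] unfolding set_integrable_def by (rule integrable_abs)
    show "integrable lborel (\<lambda>z. K * (indicator {x..} z * exp (- (z - x) / l)))"
      using exp_kernel_right(1)[OF assms(1)] by simp
    fix z show "\<bar>indicator {x..} z *\<^sub>R (exp (- (z - x) / l) * s z)\<bar> \<le> K * (indicator {x..} z * exp (- (z - x) / l))"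
        using K[of z] by (auto simp: abs_mult indicator_def mult.commute)
  qed
  then show "\<bar>A x\<bar> \<le> K * l" using exp_kernel_right(2)[OF assms(1)] by simp
  \<comment> \<open>Factoring exp (x / l) out of A leaves the tail integral H, in which x occurs
    only as the lower limit; the product rule then yields the density A / l - s.\<close>
  define H where "H x = (LINT z:{x..}|lborel. exp (- z / l) * s z)" for x
  have e: "exp (- z / l) * s z = exp (- y / l) * (exp (- (z - y) / l) * s z)" for y z
    by (simp add: exp_add[symmetric] mult.assoc[symmetric] diff_divide_distrib)
  have iH: "set_integrable lborel {y..} (\<lambda>z. exp (- z / l) * s z)" for y
    unfolding e[of _ y] using iA[of y] by simp
  have AH: "A x = exp (x / l) * H x" for x
    unfolding H_def A_def e[of _ x] by (simp add: exp_minus)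
  have H: "primitive H (\<lambda>z. - (exp (- z / l) * s z))"
    unfolding primitive_def
  proof (intro allI impI)
    fix a b :: real assume ab: "a \<le> b"
    have i1: "set_integrable lborel {a..b} (\<lambda>z. exp (- z / l) * s z)"
      by (rule set_integrable_subset[OF iH[of a]]) auto
    have "(LINT z:{a..b} \<union> {b..}|lborel. exp (- z / l) * s z) = (LINT z:{a..b}|lborel. exp (- z / l) * s z) + H b"
      unfolding H_def
    proof (rule set_integral_Un_AE)
      show "AE x in lborel. \<not> (x \<in> {a..b} \<and> x \<in> {b..})"
        using AE_lborel_singleton[of b] by eventually_elim auto
    qed (use i1 iH in auto)
    moreover have "{a..b} \<union> {b..} = {a..}" using ab by auto
    ultimately have "H a = (LINT z:{a..b}|lborel. exp (- z / l) * s z) + H b" by (simp add: H_def)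
    then show "set_integrable lborel {a..b} (\<lambda>z. - (exp (- z / l) * s z)) \<and>
         (LINT z:{a..b}|lborel. - (exp (- z / l) * s z)) = H b - H a"
      using i1 by (simp add: set_integrable_def set_lebesgue_integral_def)
  qed
  have E: "primitive (\<lambda>x. exp (x / l)) (\<lambda>x. exp (x / l) / l)"
    by (rule primitive_deriv) (use assms(1) in \<open>auto intro!: derivative_eq_intros continuous_intros\<close>)
  have "(exp (x / l) / l) * H x + exp (x / l) * - (exp (- x / l) * s x) = A x / l - s x" for x
    by (simp add: AH mult.assoc[symmetric] exp_add[symmetric])
  then show "primitive A (\<lambda>x. A x / l - s x)"
    using primitive_mult[OF E H] by (simp add: AH[abs_def, symmetric] del: mult_minus_right)
qed

lemma primitive_exp_kernel_left:
  assumes "0 < l" and s[measurable]: "s \<in> borel_measurable borel" and K: "\<And>x. \<bar>s x\<bar> \<le> (K :: real)"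
  defines "A \<equiv> \<lambda>x. LINT z:{..x}|lborel. exp (- (x - z) / l) * s z"
  shows "primitive A (\<lambda>x. s x - A x / l)" "\<bar>A x\<bar> \<le> K * l"
    "set_integrable lborel {..x} (\<lambda>z. exp (- (x - z) / l) * s z)"
proof -
  have [measurable]: "(\<lambda>x. s (- x)) \<in> borel_measurable borel" by measurable
  note R = primitive_exp_kernel_right[OF assms(1) this, of K]
  have set: "{z. - z \<in> {..x}} = {- x..}" for x :: real by auto
  \<comment> \<open>By reflection, A at x is the right-hand kernel integral of s (- z) at -x, so the
    claims are transported from the right half line.\<close>
  have A: "A x = (LINT z:{- x..}|lborel. exp (- (z - (- x)) / l) * s (- z))" for x
    unfolding A_def set_integral_reflect[of "{..x}"] set by (simp add: add.commute)
  show "\<bar>A x\<bar> \<le> K * l" unfolding A by (rule R) (rule K)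
  have "(\<lambda>z. indicator {- x..} (0 + -1 * z) *\<^sub>R (exp (- ((0 + -1 * z) - (- x)) / l) * s (- (0 + -1 * z))))
      = (\<lambda>z. indicator {..x} z *\<^sub>R (exp (- (x - z) / l) * s z))"
    by (auto simp: indicator_def fun_eq_iff)
  moreover have "integrable lborel (\<lambda>z. indicator {- x..} (0 + -1 * z) *\<^sub>R (exp (- ((0 + -1 * z) - (- x)) / l) * s (- (0 + -1 * z))))"
    using R(3)[OF K, of "- x"] unfolding set_integrable_def by (intro lborel_integrable_real_affine) auto
  ultimately show "set_integrable lborel {..x} (\<lambda>z. exp (- (x - z) / l) * s z)"
    unfolding set_integrable_def by (simp only:)
  have "primitive (\<lambda>x. A x) (\<lambda>x. - (A x / l - s x))"
    using primitive_reflect[OF R(1)[OF K]] unfolding A by simp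
  then show "primitive A (\<lambda>x. s x - A x / l)" by simp
qed

section \<open>Continuity and differentiation under the integral sign\<close>

lemma continuous_on_integral_dominated:
  fixes f :: "real \<Rightarrow> 'a \<Rightarrow> real"
  assumes meas: "\<And>r. r \<in> S \<Longrightarrow> f r \<in> borel_measurable M"
    and cont: "AE x in M. continuous_on S (\<lambda>r. f r x)"
    and K: "integrable M K" and bound: "\<And>r. r \<in> S \<Longrightarrow> AE x in M. \<bar>f r x\<bar> \<le> K x"
  shows "continuous_on S (\<lambda>r. LINT x|M. f r x)"
proof (rule continuous_on_sequentiallyI)
  fix X a assume X: "\<forall>n. X n \<in> S" "a \<in> S" "X \<longlonglongrightarrow> a"
  show "(\<lambda>n. LINT x|M. f (X n) x) \<longlonglongrightarrow> (LINT x|M. f a x)"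
  proof (rule integral_dominated_convergence[OF _ _ K])
    show "AE x in M. (\<lambda>n. f (X n) x) \<longlonglongrightarrow> f a x"
      using cont
    proof eventually_elim
      case (elim x)
      then show ?case using X continuous_on_tendsto_compose[of S "\<lambda>r. f r x" X a sequentially] by auto
    qed
  qed (use X meas bound in auto)
qed

text \<open>The mean value inequality bounds all difference quotients by K, and dominated
  convergence applies along sequences. Derivatives within a convex S include the end points of a
  time interval.\<close>

lemma has_derivative_integral_dominated:
  fixes f f' :: "real \<Rightarrow> 'a \<Rightarrow> real"
  assumes S: "convex S" and t: "t \<in> S"
    and int: "\<And>r. r \<in> S \<Longrightarrow> integrable M (f r)"
    and deriv: "AE x in M. \<forall>r\<in>S. ((\<lambda>r. f r x) has_real_derivative f' r x) (at r within S)"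
    and K: "integrable M K" and bound: "AE x in M. \<forall>r\<in>S. \<bar>f' r x\<bar> \<le> K x"
    and meas: "f' t \<in> borel_measurable M"
  shows "((\<lambda>r. LINT x|M. f r x) has_real_derivative (LINT x|M. f' t x)) (at t within S)"
  unfolding has_field_derivative_iff tendsto_at_iff_sequentially
proof (intro allI impI)
  fix X :: "nat \<Rightarrow> real" assume X: "\<forall>i. X i \<in> S - {t}" and lim: "X \<longlonglongrightarrow> t"
  have fm: "f r \<in> borel_measurable M" if "r \<in> S" for r
    using int[OF that] by (rule borel_measurable_integrable)
  have "(\<lambda>n. LINT x|M. (f (X n) x - f t x) / (X n - t)) \<longlonglongrightarrow> (LINT x|M. f' t x)"
  proof (rule integral_dominated_convergence[OF meas _ K])
    show "(\<lambda>x. (f (X n) x - f t x) / (X n - t)) \<in> borel_measurable M" for n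
      using fm[OF t] fm[of "X n"] X by (intro borel_measurable_divide borel_measurable_diff) auto
    show "AE x in M. (\<lambda>n. (f (X n) x - f t x) / (X n - t)) \<longlonglongrightarrow> f' t x"
      using deriv
    proof eventually_elim
      case (elim x)
      then show ?case
        using t X lim unfolding has_field_derivative_iff tendsto_at_iff_sequentially comp_def by blast
    qed
    show "AE x in M. norm ((f (X n) x - f t x) / (X n - t)) \<le> K x" for n
      using deriv bound
    proof eventually_elim
      case (elim x)
      have "norm (f (X n) x - f t x) \<le> K x * norm (X n - t)"
        by (rule field_differentiable_bound[OF S, where f' = "\<lambda>r. f' r x"]) (use elim t X in auto)
      moreover have "X n \<noteq> t" using X by auto
      ultimately show ?case by (simp add: divide_le_eq)
    qed
  qed
  moreover have "(LINT x|M. (f (X n) x - f t x) / (X n - t)) = ((LINT x|M. f (X n) x) - (LINT x|M. f t x)) / (X n - t)" for n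
    using int[of "X n"] int[OF t] X by simp
  ultimately show "((\<lambda>y. ((LINT x|M. f y x) - (LINT x|M. f t x)) / (y - t)) \<circ> X) \<longlonglongrightarrow> (LINT x|M. f' t x)"
    by (simp only: comp_def)
qed

section \<open>Regularity of the initial datum\<close>

text \<open>Lists of two points bound every difference f x - f 0. The resulting global bound
  provides the dominating functions when \<open>u0\<close> is averaged against Gaussians in the
  Fourier inversion.\<close>

lemma bounded_if_total_variation_finite:
  assumes "total_variation f < \<infinity>"
  obtains K where "\<And>x. \<bar>f x\<bar> \<le> K"
proof -
  have inc: "ereal \<bar>f b - f a\<bar> \<le> total_variation f" if "a \<le> b" for a b
    unfolding total_variation_def
    by (rule SUP_upper2[of "[a, b]"]) (use that in auto)
  then have "0 \<le> total_variation f" using inc[of 0 0] by (simp add: zero_ereal_def)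
  then obtain V where V: "total_variation f = ereal V"
    using assms by (cases "total_variation f") auto
  have "\<bar>f x\<bar> \<le> \<bar>f 0\<bar> + V" for x
  proof (cases "0 \<le> x")
    case True then show ?thesis using inc[of 0 x] V by simp
  next
    case False then show ?thesis using inc[of x 0] V by simp
  qed
  then show ?thesis by (rule that)
qed

section \<open>Fourier inversion with Gaussian weights\<close>

lemma std_normal_density_fourier:
  assumes "0 < \<epsilon>"
  shows "(LINT k|lborel. std_normal_density (\<epsilon> * k) *\<^sub>R cis (k * y)) = complex_of_real (sqrt (2 * pi) * std_normal_density (y / \<epsilon>) / \<epsilon>)"
    "integrable lborel (\<lambda>k. std_normal_density (\<epsilon> * k))"
proof -
  have "complex_of_real (exp (- ((y / \<epsilon>)\<^sup>2) / 2)) = char std_normal_distribution (y / \<epsilon>)"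
    by (simp add: char_std_normal_distribution)
  also have "\<dots> = (CLINT z|std_normal_distribution. cis (y / \<epsilon> * z))"
    by (simp add: char_def cis_conv_exp)
  also have "\<dots> = (LINT z|lborel. std_normal_density z *\<^sub>R cis (y / \<epsilon> * z))"
    by (subst integral_density) (auto simp: normal_density_nonneg cis_conv_exp)
  also have "\<dots> = \<epsilon> *\<^sub>R (LINT k|lborel. std_normal_density (0 + \<epsilon> * k) *\<^sub>R cis (y / \<epsilon> * (0 + \<epsilon> * k)))"
    using assms by (subst lborel_integral_real_affine[where c = \<epsilon> and t = 0]) auto
  also have "(\<lambda>k. y / \<epsilon> * (0 + \<epsilon> * k)) = (\<lambda>k. k * y)" using assms by auto
  finally have "\<epsilon> *\<^sub>R (LINT k|lborel. std_normal_density (\<epsilon> * k) *\<^sub>R cis (k * y)) = complex_of_real (exp (- ((y / \<epsilon>)\<^sup>2) / 2))"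
    using assms by (simp add: mult.commute)
  then show "(LINT k|lborel. std_normal_density (\<epsilon> * k) *\<^sub>R cis (k * y)) = complex_of_real (sqrt (2 * pi) * std_normal_density (y / \<epsilon>) / \<epsilon>)"
    using assms by (simp add: std_normal_density_def field_simps scaleR_conv_of_real)
  have "integrable lborel std_normal_density" by (rule integrable_normal_density) simp
  then show "integrable lborel (\<lambda>k. std_normal_density (\<epsilon> * k))"
    using lborel_integrable_real_affine[of std_normal_density \<epsilon> 0] assms by simp
qed

lemma std_normal_density_le_1: "std_normal_density x \<le> 1"
proof -
  have "1 \<le> sqrt (2 * pi)" using pi_gt3 by simp
  then have "1 / sqrt (2 * pi) \<le> 1" by simp
  moreover have "exp (- x\<^sup>2 / 2) \<le> 1" by simp
  ultimately show ?thesis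
    unfolding std_normal_density_def by (intro mult_le_one) auto
qed

text \<open>Fubini moves the transform from the truncated u to the weight, whose transform is a
  Gaussian of width \<epsilon> centred at x0. The substitution x = x0 + \<epsilon> z displays an
  average of u near x0, ready for the limit in \<epsilon>.\<close>

lemma gaussian_multiplication_formula:
  fixes R x0 :: real
  assumes u[measurable]: "u \<in> borel_measurable borel" and K: "\<And>x. \<bar>u x\<bar> \<le> (K :: real)" and \<epsilon>: "0 < \<epsilon>"
  defines "F \<equiv> \<lambda>k. LINT x:{-R..R}|lborel. cis (- (k * x)) * complex_of_real (u x)"
  defines "w \<equiv> \<lambda>k. std_normal_density (\<epsilon> * k) *\<^sub>R cis (k * x0)"
  shows "(LINT k|lborel. F k * w k) = complex_of_real (sqrt (2 * pi) *
      (LINT z|lborel. (indicator {-R..R} (x0 + \<epsilon> * z) * u (x0 + \<epsilon> * z)) * std_normal_density z))"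
    "integrable lborel (\<lambda>k. F k * w k)" "F \<in> borel_measurable borel"
proof -
  define U where "U x = indicator {-R..R} x * u x" for x
  have [measurable]: "U \<in> borel_measurable borel" unfolding U_def by measurable
  have "set_integrable lborel {-R..R} u" by (rule set_integrable_bounded_Icc) (use K in auto)
  then have iU: "integrable lborel U" by (simp add: set_integrable_def U_def[abs_def])
  define h where "h = (\<lambda>(k, x). (std_normal_density (\<epsilon> * k) * U x) *\<^sub>R cis (k * (x0 - x)))"
  have [measurable]: "h \<in> borel_measurable (borel \<Otimes>\<^sub>M borel)"
    unfolding h_def cis_conv_exp by measurable
  have ih: "integrable (lborel \<Otimes>\<^sub>M lborel) h"
  proof (rule lborel_pair.Fubini_integrable)
    show "integrable lborel (\<lambda>k. LINT x|lborel. norm (h (k, x)))"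
      using std_normal_density_fourier(2)[OF \<epsilon>] by (simp add: h_def abs_mult)
    show "AE k in lborel. integrable lborel (\<lambda>x. h (k, x))"
    proof (rule AE_I2, rule Bochner_Integration.integrable_bound)
      fix k
      show "integrable lborel (\<lambda>x. std_normal_density (\<epsilon> * k) * U x)" using iU by simp
      show "(\<lambda>x. h (k, x)) \<in> borel_measurable lborel" by simp
    qed (auto simp: h_def)
  qed simp
  have inner: "(LINT x|lborel. h (k, x)) = F k * w k" for k
  proof -
    have "F k * w k = (LINT x|lborel. (indicator {-R..R} x *\<^sub>R (cis (- (k * x)) * complex_of_real (u x))) * w k)"
      unfolding F_def set_lebesgue_integral_def by (rule integral_mult_left_zero[symmetric])
    also have "\<dots> = (LINT x|lborel. h (k, x))"
      by (rule Bochner_Integration.integral_cong)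
         (auto simp: h_def w_def U_def scaleR_conv_of_real cis_mult algebra_simps indicator_def)
    finally show ?thesis by simp
  qed
  show "integrable lborel (\<lambda>k. F k * w k)"
    using lborel_pair.integrable_fst'[OF ih] by (simp add: inner)
  show "F \<in> borel_measurable borel" 
    unfolding F_def set_lebesgue_integral_def cis_conv_exp by measurable
  have "(LINT k|lborel. F k * w k) = (LINT k|lborel. LINT x|lborel. h (k, x))"
    by (simp add: inner)
  also have "\<dots> = (LINT x|lborel. LINT k|lborel. h (k, x))"
    using lborel_pair.integral_fst'[OF ih] lborel_pair.integral_snd[of "\<lambda>k x. h (k, x)"] ih by simp
  also have "\<dots> = (LINT x|lborel. complex_of_real (U x * (sqrt (2 * pi) * std_normal_density ((x0 - x) / \<epsilon>) / \<epsilon>)))"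
  proof (rule Bochner_Integration.integral_cong)
    fix x
    have "(LINT k|lborel. h (k, x)) = (LINT k|lborel. U x *\<^sub>R (std_normal_density (\<epsilon> * k) *\<^sub>R cis (k * (x0 - x))))"
      by (simp add: h_def mult.commute)
    also have "\<dots> = complex_of_real (U x * (sqrt (2 * pi) * std_normal_density ((x0 - x) / \<epsilon>) / \<epsilon>))"
      unfolding integral_scaleR_right std_normal_density_fourier(1)[OF \<epsilon>] by (simp add: scaleR_conv_of_real)
    finally show "(LINT k|lborel. h (k, x)) = complex_of_real (U x * (sqrt (2 * pi) * std_normal_density ((x0 - x) / \<epsilon>) / \<epsilon>))" .
  qed simp
  also have "\<dots> = complex_of_real (LINT x|lborel. U x * (sqrt (2 * pi) * std_normal_density ((x0 - x) / \<epsilon>) / \<epsilon>))"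
    by (rule integral_complex_of_real)
  also have "(LINT x|lborel. U x * (sqrt (2 * pi) * std_normal_density ((x0 - x) / \<epsilon>) / \<epsilon>)) =
      \<epsilon> *\<^sub>R (LINT z|lborel. U (x0 + \<epsilon> * z) * (sqrt (2 * pi) * std_normal_density ((x0 - (x0 + \<epsilon> * z)) / \<epsilon>) / \<epsilon>))"
    using \<epsilon> by (subst lborel_integral_real_affine[where c = \<epsilon> and t = x0]) auto
  also have "\<dots> = (LINT z|lborel. sqrt (2 * pi) * (U (x0 + \<epsilon> * z) * std_normal_density z))"
    unfolding integral_scaleR_right[symmetric]
    using \<epsilon> by (intro Bochner_Integration.integral_cong) (auto simp: std_normal_density_def)
  also have "\<dots> = sqrt (2 * pi) * (LINT z|lborel. U (x0 + \<epsilon> * z) * std_normal_density z)"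
    by (rule integral_mult_right_zero)
  finally show "(LINT k|lborel. F k * w k) = complex_of_real (sqrt (2 * pi) *
      (LINT z|lborel. (indicator {-R..R} (x0 + \<epsilon> * z) * u (x0 + \<epsilon> * z)) * std_normal_density z))"
    by (simp add: U_def)
qed

text \<open>The truncated transforms converge to g only in mean square, so their limit is taken
  against a Gaussian weight, by Cauchy-Schwarz. Then \<epsilon> tends to 0: on one side g is
  integrable, on the other u is bounded and continuous, and dominated convergence applies to
  both.\<close>

lemma fourier_inversion:
  assumes cont: "continuous_on UNIV u" and K: "\<And>x. \<bar>u x\<bar> \<le> K"
    and pt: "plancherel_transform u g" and ig: "integrable lborel g"
  shows "complex_of_real (2 * pi * u x0) = (LINT k|lborel. g k * cis (k * x0))"
proof -
  have u[measurable]: "u \<in> borel_measurable borel"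
    using cont by (rule borel_measurable_continuous_onI)
  have g[measurable]: "g \<in> borel_measurable borel" using ig by (auto dest: borel_measurable_integrable)
  have cis_m[measurable]: "(\<lambda>k. cis (k * x)) \<in> borel_measurable borel" for x :: real
    by (intro borel_measurable_continuous_onI) (simp add: cis_conv_exp continuous_intros)
  let ?w = "\<lambda>\<epsilon> k. std_normal_density (\<epsilon> * k) *\<^sub>R cis (k * x0)"
  let ?F = "\<lambda>R k. LINT x:{-R..R}|lborel. cis (- (k * x)) * complex_of_real (u x)"
  have w1: "norm (?w \<epsilon> k) \<le> 1" for \<epsilon> k
    using std_normal_density_le_1[of "\<epsilon> * k"] by (simp add: normal_density_nonneg)
  have igw: "integrable lborel (\<lambda>k. g k * ?w \<epsilon> k)" for \<epsilon>
  proof (rule Bochner_Integration.integrable_bound[OF ig])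
    show "AE k in lborel. norm (g k * ?w \<epsilon> k) \<le> norm (g k)"
      unfolding norm_mult using w1 by (intro AE_I2 mult_left_le) auto
  qed simp
  have gauss: "(LINT k|lborel. g k * ?w \<epsilon> k) =
      complex_of_real (sqrt (2 * pi) * (LINT z|lborel. u (x0 + \<epsilon> * z) * std_normal_density z))"
    if \<epsilon>: "0 < \<epsilon>" for \<epsilon>
  proof -
    note GF = gaussian_multiplication_formula[OF u K \<epsilon>]
    have "(\<lambda>n. LINT k|lborel. ?F (real n) k * ?w \<epsilon> k) \<longlonglongrightarrow> (LINT k|lborel. g k * ?w \<epsilon> k)"
    proof -
      \<comment> \<open>C is the squared L^2 norm of the weight; it is finite because the Gaussian
        is at most 1 and thus dominates its own square.\<close>
      define C where "C = (\<integral>\<^sup>+k. (ennreal (norm (?w \<epsilon> k)))\<^sup>2 \<partial>lborel)"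
      have "C \<le> (\<integral>\<^sup>+k. ennreal (std_normal_density (\<epsilon> * k)) \<partial>lborel)"
        unfolding C_def
      proof (rule nn_integral_mono)
        fix k
        have "(norm (?w \<epsilon> k))\<^sup>2 \<le> std_normal_density (\<epsilon> * k)"
          using std_normal_density_le_1[of "\<epsilon> * k"]
          by (simp add: power2_eq_square mult_left_le normal_density_nonneg)
        then show "(ennreal (norm (?w \<epsilon> k)))\<^sup>2 \<le> ennreal (std_normal_density (\<epsilon> * k))"
          by (simp add: ennreal_power)
      qed
      also have "\<dots> < \<infinity>"
        using std_normal_density_fourier(2)[OF \<epsilon>]
        by (subst nn_integral_eq_integral) (auto simp: normal_density_nonneg)
      finally have C: "C < \<infinity>" .
      define d where "d n = (\<integral>\<^sup>+k. ennreal ((norm (?F (real n) k - g k))\<^sup>2) \<partial>lborel)" for n :: nat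
      have "d \<longlonglongrightarrow> 0"
        using pt unfolding plancherel_transform_def d_def
        by (auto intro: filterlim_compose[OF _ filterlim_real_sequentially])
      then have lim: "(\<lambda>n. d n * C) \<longlonglongrightarrow> 0"
        using C ennreal_tendsto_cmult[of C d 0 sequentially] by (simp add: mult.commute)
      define r where "r n = norm ((LINT k|lborel. ?F (real n) k * ?w \<epsilon> k) - (LINT k|lborel. g k * ?w \<epsilon> k))" for n
      have le: "ennreal ((r n)\<^sup>2) \<le> d n * C" for n
      proof -
        have [measurable]: "?F (real n) \<in> borel_measurable borel" by (rule GF(3))
        have i: "integrable lborel (\<lambda>k. (?F (real n) k - g k) * ?w \<epsilon> k)"
          unfolding left_diff_distrib by (intro Bochner_Integration.integrable_diff GF(2) igw)
        have "(LINT k|lborel. ?F (real n) k * ?w \<epsilon> k) - (LINT k|lborel. g k * ?w \<epsilon> k)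
            = (LINT k|lborel. (?F (real n) k - g k) * ?w \<epsilon> k)"
          unfolding left_diff_distrib by (intro Bochner_Integration.integral_diff[symmetric] GF(2) igw)
        then have "ennreal (norm ((LINT k|lborel. ?F (real n) k * ?w \<epsilon> k) - (LINT k|lborel. g k * ?w \<epsilon> k)))
            \<le> (\<integral>\<^sup>+k. norm ((?F (real n) k - g k) * ?w \<epsilon> k) \<partial>lborel)"
          using integral_norm_bound_ennreal[OF i] by simp
        also have "\<dots> = (\<integral>\<^sup>+k. ennreal (norm (?F (real n) k - g k)) * ennreal (norm (?w \<epsilon> k)) \<partial>lborel)"
          by (simp only: norm_mult ennreal_mult'[OF norm_ge_zero])
        finally have "(ennreal (norm ((LINT k|lborel. ?F (real n) k * ?w \<epsilon> k) - (LINT k|lborel. g k * ?w \<epsilon> k))))\<^sup>2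
            \<le> (\<integral>\<^sup>+k. ennreal (norm (?F (real n) k - g k)) * ennreal (norm (?w \<epsilon> k)) \<partial>lborel)\<^sup>2"
          by (intro power_mono) auto
        also have "\<dots> \<le> (\<integral>\<^sup>+k. (ennreal (norm (?F (real n) k - g k)))\<^sup>2 \<partial>lborel) * C"
          unfolding C_def by (rule Cauchy_Schwarz_nn_integral) auto
        finally show ?thesis by (simp add: ennreal_power d_def r_def)
      qed
      have "(\<lambda>n. ennreal ((r n)\<^sup>2)) \<longlonglongrightarrow> ennreal 0"
        unfolding ennreal_0
        by (rule tendsto_sandwich[OF _ _ tendsto_const lim]) (simp_all add: le)
      then have "(\<lambda>n. (r n)\<^sup>2) \<longlonglongrightarrow> 0"
        by (rule iffD1[OF tendsto_ennreal_iff, rotated 2]) simp_all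
      then have "(\<lambda>n. sqrt ((r n)\<^sup>2)) \<longlonglongrightarrow> sqrt 0"
        by (rule tendsto_real_sqrt)
      moreover have "sqrt ((r n)\<^sup>2) = r n" for n by (simp add: r_def)
      ultimately have "r \<longlonglongrightarrow> 0" by simp
      then show ?thesis unfolding r_def by (simp only: tendsto_norm_zero_iff LIM_zero_iff)
    qed
    moreover have "(\<lambda>n. LINT z|lborel. (indicator {-real n..real n} (x0 + \<epsilon> * z) * u (x0 + \<epsilon> * z)) * std_normal_density z)
        \<longlonglongrightarrow> (LINT z|lborel. u (x0 + \<epsilon> * z) * std_normal_density z)"
    proof (rule integral_dominated_convergence)
      show "integrable lborel (\<lambda>z. K * std_normal_density z)"
        using integrable_normal_density[of 1 0] by simp
      show "AE z in lborel. norm ((indicator {-real n..real n} (x0 + \<epsilon> * z) * u (x0 + \<epsilon> * z)) * std_normal_density z) \<le> K * std_normal_density z" for n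
      proof (rule AE_I2)
        fix z
        have "0 \<le> K" using K[of 0] by linarith
        then show "norm ((indicator {-real n..real n} (x0 + \<epsilon> * z) * u (x0 + \<epsilon> * z)) * std_normal_density z) \<le> K * std_normal_density z"
          using K[of "x0 + \<epsilon> * z"] by (auto simp: abs_mult indicator_def normal_density_nonneg intro!: mult_right_mono)
      qed
      show "AE z in lborel. (\<lambda>n. (indicator {-real n..real n} (x0 + \<epsilon> * z) * u (x0 + \<epsilon> * z)) * std_normal_density z) \<longlonglongrightarrow> u (x0 + \<epsilon> * z) * std_normal_density z"
      proof (rule AE_I2, rule tendsto_eventually)
        fix z
        obtain N where N: "\<bar>x0 + \<epsilon> * z\<bar> \<le> real N" using real_arch_simple by blast
        show "eventually (\<lambda>n. (indicator {-real n..real n} (x0 + \<epsilon> * z) * u (x0 + \<epsilon> * z)) * std_normal_density z = u (x0 + \<epsilon> * z) * std_normal_density z) sequentially"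
          using eventually_ge_at_top[of N]
        proof eventually_elim
          case (elim n)
          then have "x0 + \<epsilon> * z \<in> {-real n..real n}" using N by (auto simp: abs_le_iff)
          then show ?case by simp
        qed
      qed
    qed auto
    then have "(\<lambda>n. complex_of_real (sqrt (2 * pi) * (LINT z|lborel. (indicator {-real n..real n} (x0 + \<epsilon> * z) * u (x0 + \<epsilon> * z)) * std_normal_density z)))
        \<longlonglongrightarrow> complex_of_real (sqrt (2 * pi) * (LINT z|lborel. u (x0 + \<epsilon> * z) * std_normal_density z))"
      by (intro tendsto_intros)
    then have "(\<lambda>n. LINT k|lborel. ?F (real n) k * ?w \<epsilon> k) \<longlonglongrightarrow> complex_of_real (sqrt (2 * pi) * (LINT z|lborel. u (x0 + \<epsilon> * z) * std_normal_density z))"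
      by (simp only: GF(1))
    ultimately show ?thesis by (rule LIMSEQ_unique)
  qed
  define e where "e n = inverse (real (Suc n))" for n
  have e: "e \<longlonglongrightarrow> 0" "\<And>n. 0 < e n" unfolding e_def using LIMSEQ_inverse_real_of_nat by auto
  have nc: "isCont std_normal_density x" for x
    unfolding std_normal_density_def by (intro continuous_intros) auto
  have "(\<lambda>n. LINT k|lborel. g k * ?w (e n) k) \<longlonglongrightarrow> (LINT k|lborel. g k * ?w 0 k)"
  proof (rule integral_dominated_convergence)
    show "integrable lborel (\<lambda>k. norm (g k))" using ig by simp
    show "AE k in lborel. (\<lambda>n. g k * ?w (e n) k) \<longlonglongrightarrow> g k * ?w 0 k"
    proof (rule AE_I2)
      fix k
      have "(\<lambda>n. e n * k) \<longlonglongrightarrow> 0 * k" by (intro tendsto_intros e)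
      then show "(\<lambda>n. g k * ?w (e n) k) \<longlonglongrightarrow> g k * ?w 0 k"
        by (intro tendsto_intros isCont_tendsto_compose[OF nc] e)
    qed
    show "AE k in lborel. norm (g k * ?w (e n) k) \<le> norm (g k)" for n
      unfolding norm_mult using w1 by (intro AE_I2 mult_left_le) auto
  qed auto
  moreover have "(\<lambda>n. LINT z|lborel. u (x0 + e n * z) * std_normal_density z) \<longlonglongrightarrow> (LINT z|lborel. u x0 * std_normal_density z)"
  proof (rule integral_dominated_convergence)
    show "integrable lborel (\<lambda>z. K * std_normal_density z)"
      using integrable_normal_density[of 1 0] by simp
    show "AE z in lborel. norm (u (x0 + e n * z) * std_normal_density z) \<le> K * std_normal_density z" for n
      using K by (auto simp: abs_mult normal_density_nonneg intro!: mult_right_mono)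
    show "AE z in lborel. (\<lambda>n. u (x0 + e n * z) * std_normal_density z) \<longlonglongrightarrow> u x0 * std_normal_density z"
    proof (rule AE_I2)
      fix z
      have "(\<lambda>n. x0 + e n * z) \<longlonglongrightarrow> x0 + 0 * z" by (intro tendsto_intros e)
      moreover have "isCont u x0" using cont by (simp add: continuous_on_eq_continuous_at)
      ultimately show "(\<lambda>n. u (x0 + e n * z) * std_normal_density z) \<longlonglongrightarrow> u x0 * std_normal_density z"
        by (intro tendsto_intros isCont_tendsto_compose[of x0 u]) auto
    qed
  qed auto
  then have "(\<lambda>n. complex_of_real (sqrt (2 * pi) * (LINT z|lborel. u (x0 + e n * z) * std_normal_density z)))
      \<longlonglongrightarrow> complex_of_real (sqrt (2 * pi) * (LINT z|lborel. u x0 * std_normal_density z))"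
    by (intro tendsto_intros)
  ultimately have lim: "(LINT k|lborel. g k * ?w 0 k) = complex_of_real (sqrt (2 * pi) * (LINT z|lborel. u x0 * std_normal_density z))"
    using LIMSEQ_unique by (simp only: gauss[OF e(2)]) blast
  have one: "(LINT z|lborel. std_normal_density z) = 1"
    by (rule integral_normal_density) simp
  define I where "I = (LINT k|lborel. g k * cis (k * x0))"
  \<comment> \<open>At \<epsilon> = 0 the Gaussian factor is the constant 1 / sqrt (2 pi); with the
    factor sqrt (2 pi) on the other side it produces the 2 pi of the statement.\<close>
  have "(LINT k|lborel. g k * ?w 0 k) = complex_of_real (1 / sqrt (2 * pi)) * I"
    unfolding I_def integral_mult_right_zero[symmetric]
    by (rule Bochner_Integration.integral_cong) (simp_all add: std_normal_density_def scaleR_conv_of_real)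
  then have "complex_of_real (1 / sqrt (2 * pi)) * I = complex_of_real (sqrt (2 * pi) * u x0)"
    using lim unfolding integral_mult_right_zero one by (simp only: mult_1_right)
  then have "complex_of_real (sqrt (2 * pi)) * (complex_of_real (1 / sqrt (2 * pi)) * I)
      = complex_of_real (sqrt (2 * pi) * (sqrt (2 * pi) * u x0))"
    by (simp only: of_real_mult)
  moreover have "complex_of_real (sqrt (2 * pi)) * (complex_of_real (1 / sqrt (2 * pi)) * I) = I"
    unfolding mult.assoc[symmetric] of_real_mult[symmetric] by simp
  ultimately have "I = complex_of_real (sqrt (2 * pi) * (sqrt (2 * pi) * u x0))" by (simp only:)
  also have "sqrt (2 * pi) * (sqrt (2 * pi) * u x0) = 2 * pi * u x0"
    by (simp add: mult.assoc[symmetric])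
  finally show ?thesis unfolding I_def by (simp only:)
qed

text \<open>Put a = (1 + k^2)^(s/2) |g|, which is square integrable. Then sqrt (1 + k^2) |g| \<le> a
  (1 + k^2)^(-1/2) \<le> a^2 + 1/(1 + k^2), so g and k g are integrable and the inversion formula
  may be differentiated under the integral.\<close>

lemma sobolev_differentiable:
  assumes s: "s \<ge> 3" and sob: "sobolev s u" and cont: "continuous_on UNIV u" and K: "\<And>x. \<bar>u x\<bar> \<le> K"
  shows "\<exists>u'. continuous_on UNIV u' \<and> (\<forall>x. (u has_real_derivative u' x) (at x))"
proof -
  obtain g where pt: "plancherel_transform u g"
    and W: "square_integrable (\<lambda>k. complex_of_real ((1 + k\<^sup>2) powr (s / 2)) * g k)"
    using sob by (auto simp: sobolev_def)
  have g[measurable]: "g \<in> borel_measurable borel"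
    using pt by (auto simp: plancherel_transform_def square_integrable_def)
  define h where "h k = (norm (complex_of_real ((1 + k\<^sup>2) powr (s / 2)) * g k))\<^sup>2 + inverse (1 + k\<^sup>2)" for k
  have ih: "integrable lborel h"
    using W integrable_inverse_1_plus_square unfolding h_def square_integrable_def
    by (auto simp: set_integrable_def)
  have bound: "sqrt (1 + k\<^sup>2) * norm (g k) \<le> h k" for k
  proof -
    define a where "a = (1 + k\<^sup>2) powr (s / 2) * norm (g k)"
    have p: "1 \<le> 1 + k\<^sup>2" by simp
    have "sqrt (1 + k\<^sup>2) = (1 + k\<^sup>2) powr (1/2)" by (simp add: powr_half_sqrt)
    also have "\<dots> \<le> (1 + k\<^sup>2) powr (s / 2 + (- 1 / 2))"
      using s p by (intro powr_mono) auto
    also have "\<dots> = (1 + k\<^sup>2) powr (s / 2) * (1 + k\<^sup>2) powr (- 1 / 2)" by (rule powr_add)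
    finally have "sqrt (1 + k\<^sup>2) * norm (g k) \<le> a * (1 + k\<^sup>2) powr (- 1 / 2)"
      using mult_right_mono[OF _ norm_ge_zero[of "g k"]] by (fastforce simp: a_def mult_ac)
    also have "\<dots> \<le> a\<^sup>2 + ((1 + k\<^sup>2) powr (- 1 / 2))\<^sup>2"
    proof -
      have "0 \<le> (a - (1 + k\<^sup>2) powr (- 1 / 2))\<^sup>2" "0 \<le> a\<^sup>2" "0 \<le> ((1 + k\<^sup>2) powr (- 1 / 2))\<^sup>2" by auto
      then show ?thesis unfolding power2_diff by linarith
    qed
    also have "((1 + k\<^sup>2) powr (- 1 / 2))\<^sup>2 = inverse (1 + k\<^sup>2)"
      by (simp add: powr_minus powr_half_sqrt power_inverse)
    finally show ?thesis by (simp add: h_def a_def norm_mult)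
  qed
  have g_le: "norm (g k) \<le> h k" and kg_le: "\<bar>k\<bar> * norm (g k) \<le> h k" for k
  proof -
    have "1 \<le> sqrt (1 + k\<^sup>2)" "\<bar>k\<bar> \<le> sqrt (1 + k\<^sup>2)"
      by (auto intro: real_le_rsqrt)
    note this[THEN mult_right_mono, OF norm_ge_zero[of "g k"]]
    then show "norm (g k) \<le> h k" "\<bar>k\<bar> * norm (g k) \<le> h k" using bound[of k] by auto
  qed
  have ig: "integrable lborel g"
    by (rule Bochner_Integration.integrable_bound[OF ih]) (use g_le in \<open>auto intro: order_trans[OF _ abs_ge_self]\<close>)
  define f where "f x k = Re (g k) * cos (x * k) - Im (g k) * sin (x * k)" for x k
  define f' where "f' x k = - (Re (g k) * k * sin (x * k)) - Im (g k) * k * cos (x * k)" for x k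
  have [measurable]: "(\<lambda>k. Re (g k)) \<in> borel_measurable borel" "(\<lambda>k. Im (g k)) \<in> borel_measurable borel"
    by measurable
  have f_eq: "f x k = Re (g k * cis (k * x))" for x k
    by (simp add: f_def mult.commute)
  have f'_eq: "f' x k = Re (g k * (\<i> * k * cis (k * x)))" for x k
    by (simp add: f'_def algebra_simps)
  have cis_m[measurable]: "(\<lambda>k. cis (k * x)) \<in> borel_measurable borel" for x :: real
    by (intro borel_measurable_continuous_onI) (simp add: cis_conv_exp continuous_intros)
  have igc: "integrable lborel (\<lambda>k. g k * cis (k * x))" for x
    by (rule Bochner_Integration.integrable_bound[OF ig]) (auto simp: norm_mult)
  have int: "integrable lborel (f x)" for x
    unfolding f_eq[abs_def] using igc by (rule integrable_Re)
  have u_eq: "u x = (LINT k|lborel. f x k) / (2 * pi)" for x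
  proof -
    have "2 * pi * u x = Re (LINT k|lborel. g k * cis (k * x))"
      using fourier_inversion[OF cont K pt ig, of x] by (metis Re_complex_of_real)
    also have "\<dots> = (LINT k|lborel. f x k)" by (simp only: f_eq integral_Re[OF igc])
    finally show ?thesis by (simp add: field_simps)
  qed
  have f'_le: "\<bar>f' x k\<bar> \<le> h k" for x k
  proof -
    have "\<bar>f' x k\<bar> \<le> norm (g k * (\<i> * k * cis (k * x)))" unfolding f'_eq by (rule abs_Re_le_cmod)
    also have "\<dots> = \<bar>k\<bar> * norm (g k)" by (simp add: norm_mult)
    finally show ?thesis using kg_le[of k] by linarith
  qed
  have fm: "f' x \<in> borel_measurable lborel" for x unfolding f'_def by measurable
  have "((\<lambda>x. LINT k|lborel. f x k) has_real_derivative (LINT k|lborel. f' x k)) (at x within UNIV)" for x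
  proof (rule has_derivative_integral_dominated[OF _ _ int _ ih _ fm])
    show "AE k in lborel. \<forall>r\<in>UNIV. ((\<lambda>r. f r k) has_real_derivative f' r k) (at r within UNIV)"
      by (auto intro!: derivative_eq_intros simp: f_def f'_def)
  qed (use f'_le in auto)
  then have "(u has_real_derivative (LINT k|lborel. f' x k) / (2 * pi)) (at x)" for x
    unfolding u_eq[abs_def] by (auto intro: DERIV_cdivide)
  moreover have "continuous_on UNIV (\<lambda>x. LINT k|lborel. f' x k)"
  proof (rule continuous_on_integral_dominated[OF fm _ ih])
    show "AE k in lborel. continuous_on UNIV (\<lambda>r. f' r k)"
      unfolding f'_def by (intro AE_I2 continuous_intros)
  qed (use f'_le in auto)
  then have "continuous_on UNIV (\<lambda>x. (LINT k|lborel. f' x k) / (2 * pi))"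
    by (intro continuous_intros) auto
  ultimately show ?thesis by blast
qed

section \<open>Vanishing of the limit measure\<close>

text \<open>If f is not integrable, its Bochner integral is 0 by convention and the bound holds
  because g is nonnegative. This serves integrands for which no joint measurability in time and
  space is at hand.\<close>

lemma abs_integral_le_integral:
  fixes f g :: "'a \<Rightarrow> real"
  assumes "integrable M g" "\<And>x. \<bar>f x\<bar> \<le> g x"
  shows "\<bar>LINT x|M. f x\<bar> \<le> (LINT x|M. g x)"
proof (cases "integrable M f")
  case True
  have "\<bar>LINT x|M. f x\<bar> \<le> (LINT x|M. \<bar>f x\<bar>)" by (rule integral_abs_bound)
  also have "\<dots> \<le> (LINT x|M. g x)"
    using assms True by (intro integral_mono) auto
  finally show ?thesis .
next
  case False
  have "0 \<le> g x" for x using assms(2)[of x] by linarith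
  then show ?thesis using False by (simp add: not_integrable_integral_eq)
qed

text \<open>\<open>Linf_measures\<close> gives measurability in time for the mass of a fixed set;
  simple functions and monotone limits extend it to integrals. Times are restricted to t \<ge> 0,
  since nothing is known about the measures at negative times.\<close>

lemma nn_integral_measure_family_measurable:
  assumes \<mu>: "Linf_measures \<mu>" and f: "f \<in> borel_measurable (borel :: real measure)"
  shows "(\<lambda>t. \<integral>\<^sup>+ x. f x \<partial>\<mu> t) \<in> borel_measurable (restrict_space borel {0..})"
proof -
  have sets: "sets (\<mu> t) = sets borel" if "0 \<le> t" for t using \<mu> that by (auto simp: Linf_measures_def)
  then have sp: "space (\<mu> t) = UNIV" if "0 \<le> t" for t using sets_eq_imp_space_eq[OF sets[OF that]] by simp
  have meas: "h \<in> borel_measurable (\<mu> t)" if "0 \<le> t" "h \<in> borel_measurable borel" for t and h :: "real \<Rightarrow> ennreal"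
    using that sets by (subst measurable_cong_sets[OF sets refl]) auto
  have eq_on: "k \<in> borel_measurable (restrict_space borel {0..})"
    if "h \<in> borel_measurable (restrict_space borel {0..})" "\<And>t. 0 \<le> t \<Longrightarrow> h t = k t" for h k :: "real \<Rightarrow> ennreal"
    using that(1) measurable_cong[of "restrict_space borel {0..}" h k borel] that(2) by (simp add: space_restrict_space)
  show ?thesis using f
  proof (induction rule: borel_measurable_induct)
    case (cong f g)
    then have "f = g" by (auto simp: fun_eq_iff)
    then show ?case using cong by simp
  next
    case (set A)
    have "(\<lambda>t. emeasure (\<mu> t) A) \<in> borel_measurable (restrict_space borel {0..})"
      using \<mu> set by (auto simp: Linf_measures_def)
    then show ?case
      by (rule eq_on) (use set sets in simp)
  next
    case (mult u c)
    have "(\<lambda>t. c * (\<integral>\<^sup>+ x. u x \<partial>\<mu> t)) \<in> borel_measurable (restrict_space borel {0..})"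
      using mult by auto
    then show ?case
    proof (rule eq_on)
      fix t :: real assume "0 \<le> t"
      then show "c * (\<integral>\<^sup>+ x. u x \<partial>\<mu> t) = (\<integral>\<^sup>+ x. c * u x \<partial>\<mu> t)"
        by (intro nn_integral_cmult[symmetric] meas mult(2))
    qed
  next
    case (add u v)
    have "(\<lambda>t. (\<integral>\<^sup>+ x. v x \<partial>\<mu> t) + (\<integral>\<^sup>+ x. u x \<partial>\<mu> t)) \<in> borel_measurable (restrict_space borel {0..})"
      using add by auto
    then show ?case
    proof (rule eq_on)
      fix t :: real assume "0 \<le> t"
      then show "(\<integral>\<^sup>+ x. v x \<partial>\<mu> t) + (\<integral>\<^sup>+ x. u x \<partial>\<mu> t) = (\<integral>\<^sup>+ x. v x + u x \<partial>\<mu> t)"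
        by (intro nn_integral_add[symmetric] meas add.hyps)
    qed
  next
    case (seq U)
    have "(\<lambda>t. SUP i. \<integral>\<^sup>+ x. U i x \<partial>\<mu> t) \<in> borel_measurable (restrict_space borel {0..})"
      using seq by (intro borel_measurable_SUP) auto
    then show ?case
    proof (rule eq_on)
      fix t :: real assume "0 \<le> t"
      then have "(\<integral>\<^sup>+ x. (SUP i. U i x) \<partial>\<mu> t) = (SUP i. \<integral>\<^sup>+ x. U i x \<partial>\<mu> t)"
        by (intro nn_integral_monotone_convergence_SUP meas seq)
      then show "(SUP i. \<integral>\<^sup>+ x. U i x \<partial>\<mu> t) = (\<integral>\<^sup>+ x. (SUP i. U i) x \<partial>\<mu> t)"
        by (simp add: image_comp)
    qed
  qed
qed

text \<open>Testing with a product of a tent in time and a tent in space gives integrals bounded by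
  a multiple of \<open>(L n)\<^sup>2\<close>, hence the limit 0. Tents and measures are nonnegative,
  so for almost every t < T the measure has no mass on any [-m, m].\<close>

lemma limit_measure_zero:
  assumes \<mu>: "Linf_measures \<mu>" and conv: "converges_measure (\<lambda>n t x. (L n)\<^sup>2 * p n t x) \<mu>"
    and L: "L \<longlonglongrightarrow> 0" and bound: "\<And>n t x. 0 \<le> t \<Longrightarrow> t \<le> T \<Longrightarrow> \<bar>p n t x\<bar> \<le> C"
  shows "AE t in lborel. 0 \<le> t \<and> t < T \<longrightarrow> \<mu> t = null_measure borel"
proof (cases "0 \<le> T")
  case T: True
  have C: "0 \<le> C" using bound[of 0 undefined undefined] T by linarith
  have sets: "sets (\<mu> t) = sets borel" and fin: "finite_measure (\<mu> t)" if "0 \<le> t" for t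
    using \<mu> that by (auto simp: Linf_measures_def)
  \<comment> \<open>This tent is positive for |t| < T and vanishes from T on, where p is not
    controlled; the spatial tents are at least 1 on [-m, m].\<close>
  define \<theta> where "\<theta> t = max 0 (T - \<bar>t\<bar>)" for t :: real
  define \<psi> where "\<psi> m x = max 0 (real m + 1 - \<bar>x\<bar>)" for m :: nat and x :: real
  have [measurable]: "\<theta> \<in> borel_measurable borel" "\<psi> m \<in> borel_measurable borel" for m
    unfolding \<theta>_def \<psi>_def by measurable
  have \<psi>_le: "0 \<le> \<psi> m x" "\<psi> m x \<le> real m + 1" for m x by (auto simp: \<psi>_def)
  have \<theta>_le: "0 \<le> \<theta> t" "\<theta> t \<le> T" for t using T by (auto simp: \<theta>_def)
  have \<psi>_int: "integrable lborel (\<psi> m)" for m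
    by (rule integrableI_bounded_set[where A = "{- real m - 1..real m + 1}" and B = "real m + 1"])
       (use \<psi>_le in \<open>auto simp: \<psi>_def emeasure_lborel_Icc_eq\<close>)
  have \<theta>_int: "integrable lborel (\<lambda>t. indicator {0..} t * \<theta> t)"
    by (rule integrableI_bounded_set[where A = "{0..T}" and B = T])
       (use \<theta>_le in \<open>auto simp: \<theta>_def emeasure_lborel_Icc_eq indicator_def\<close>)
  define \<Psi> where "\<Psi> m t = (LINT x|\<mu> t. \<psi> m x)" for m t
  have \<psi>_meas: "\<psi> m \<in> borel_measurable (\<mu> t)" if "0 \<le> t" for m t
    by (subst measurable_cong_sets[OF sets[OF that] refl]) simp
  have \<psi>_\<mu>: "integrable (\<mu> t) (\<psi> m)" if "0 \<le> t" for m t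
  proof -
    interpret finite_measure "\<mu> t" using fin[OF that] .
    show ?thesis using \<psi>_le by (intro integrable_const_bound[of _ "real m + 1"] \<psi>_meas[OF that]) auto
  qed
  have \<Psi>0: "0 \<le> \<Psi> m t" for m t using \<psi>_le by (simp add: \<Psi>_def)
  have \<Psi>_enn: "ennreal (\<Psi> m t) = (\<integral>\<^sup>+ x. ennreal (\<psi> m x) \<partial>\<mu> t)" if "0 \<le> t" for m t
    unfolding \<Psi>_def by (rule nn_integral_eq_integral[symmetric]) (use \<psi>_\<mu>[OF that] \<psi>_le in auto)
  have zero: "(LINT t:{0..}|lborel. \<theta> t * \<Psi> m t) = 0" for m
  proof -
    let ?\<phi> = "\<lambda>z. \<theta> (fst z) * \<psi> m (snd z)"
    have c: "continuous_on UNIV ?\<phi>" unfolding \<theta>_def \<psi>_def by (intro continuous_intros)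
    have b: "bounded {z. ?\<phi> z \<noteq> 0}"
      by (rule bounded_subset[of "{-T..T} \<times> {- real m - 1..real m + 1}"])
         (auto intro!: bounded_Times simp: \<theta>_def \<psi>_def)
    have "(\<lambda>n. LINT t:{0..}|lborel. (LINT x|lborel. ((L n)\<^sup>2 * p n t x) * ?\<phi> (t, x)))
        \<longlonglongrightarrow> (LINT t:{0..}|lborel. (LINT x|\<mu> t. ?\<phi> (t, x)))"
      using conv c b unfolding converges_measure_def by blast
    moreover have "(\<lambda>n. LINT t:{0..}|lborel. (LINT x|lborel. ((L n)\<^sup>2 * p n t x) * ?\<phi> (t, x))) \<longlonglongrightarrow> 0"
    proof (rule Lim_null_comparison)
      define J where "J = (LINT t|lborel. indicator {0..} t * \<theta> t) * (LINT x|lborel. \<psi> m x)"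
      have "(\<lambda>n. (L n)\<^sup>2 * C * J) \<longlonglongrightarrow> 0\<^sup>2 * C * J" by (intro tendsto_intros L)
      then show "(\<lambda>n. (L n)\<^sup>2 * C * J) \<longlonglongrightarrow> 0" by simp
      have inner: "\<bar>LINT x|lborel. ((L n)\<^sup>2 * p n t x) * ?\<phi> (t, x)\<bar> \<le> (L n)\<^sup>2 * C * \<theta> t * (LINT x|lborel. \<psi> m x)"
        if "0 \<le> t" for n t
      proof -
        have "\<bar>LINT x|lborel. ((L n)\<^sup>2 * p n t x) * ?\<phi> (t, x)\<bar> \<le> (LINT x|lborel. (L n)\<^sup>2 * C * \<theta> t * \<psi> m x)"
        proof (rule abs_integral_le_integral)
          fix x
          have "\<bar>p n t x\<bar> * \<theta> t \<le> C * \<theta> t"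
            using bound[OF that, of n x] \<theta>_le by (cases "t \<le> T") (auto simp: \<theta>_def intro!: mult_right_mono)
          then have "((L n)\<^sup>2 * \<psi> m x) * (\<bar>p n t x\<bar> * \<theta> t) \<le> ((L n)\<^sup>2 * \<psi> m x) * (C * \<theta> t)"
            using \<psi>_le by (intro mult_left_mono) auto
          then show "\<bar>((L n)\<^sup>2 * p n t x) * ?\<phi> (t, x)\<bar> \<le> (L n)\<^sup>2 * C * \<theta> t * \<psi> m x"
            using \<psi>_le \<theta>_le by (simp add: abs_mult mult_ac)
        qed (use \<psi>_int in simp)
        then show ?thesis by simp
      qed
      have "\<bar>LINT t:{0..}|lborel. (LINT x|lborel. ((L n)\<^sup>2 * p n t x) * ?\<phi> (t, x))\<bar> \<le> (L n)\<^sup>2 * C * J" for n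
      proof -
        have "\<bar>LINT t:{0..}|lborel. (LINT x|lborel. ((L n)\<^sup>2 * p n t x) * ?\<phi> (t, x))\<bar>
            \<le> (LINT t|lborel. (L n)\<^sup>2 * C * (indicator {0..} t * \<theta> t) * (LINT x|lborel. \<psi> m x))"
          unfolding set_lebesgue_integral_def
        proof (rule abs_integral_le_integral)
          fix t
          show "\<bar>indicator {0..} t *\<^sub>R (LINT x|lborel. ((L n)\<^sup>2 * p n t x) * ?\<phi> (t, x))\<bar>
              \<le> (L n)\<^sup>2 * C * (indicator {0..} t * \<theta> t) * (LINT x|lborel. \<psi> m x)"
            using inner[of t n] by (cases "0 \<le> t") auto
        qed (use \<theta>_int in simp)
        then show ?thesis by (simp add: J_def)
      qed
      then show "eventually (\<lambda>n. norm (LINT t:{0..}|lborel. (LINT x|lborel. ((L n)\<^sup>2 * p n t x) * ?\<phi> (t, x))) \<le> (L n)\<^sup>2 * C * J) sequentially"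
        by simp
    qed
    ultimately have "(LINT t:{0..}|lborel. (LINT x|\<mu> t. ?\<phi> (t, x))) = 0" by (rule LIMSEQ_unique)
    then show ?thesis by (simp add: \<Psi>_def)
  qed
  have meas: "(\<lambda>t. indicator {0..} t * (\<theta> t * \<Psi> m t)) \<in> borel_measurable borel" for m
  proof -
    have "(\<lambda>t. enn2real (\<integral>\<^sup>+ x. ennreal (\<psi> m x) \<partial>\<mu> t)) \<in> borel_measurable (restrict_space borel {0..})"
      using nn_integral_measure_family_measurable[OF \<mu>, of "\<lambda>x. ennreal (\<psi> m x)"] by simp
    then have "(\<lambda>t. indicator {0..} t *\<^sub>R enn2real (\<integral>\<^sup>+ x. ennreal (\<psi> m x) \<partial>\<mu> t)) \<in> borel_measurable borel"
      by (subst (asm) borel_measurable_restrict_space_iff) (auto simp: mult.commute)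
    then have "(\<lambda>t. \<theta> t * (indicator {0..} t *\<^sub>R enn2real (\<integral>\<^sup>+ x. ennreal (\<psi> m x) \<partial>\<mu> t))) \<in> borel_measurable borel"
      by (intro borel_measurable_times) auto
    moreover have "\<theta> t * (indicator {0..} t *\<^sub>R enn2real (\<integral>\<^sup>+ x. ennreal (\<psi> m x) \<partial>\<mu> t)) = indicator {0..} t * (\<theta> t * \<Psi> m t)" for t
      using \<Psi>_enn[of t m] \<Psi>0[of m t] by (cases "0 \<le> t") (simp_all add: \<Psi>_enn[symmetric])
    ultimately show ?thesis by (simp only:)
  qed
  obtain C' :: real where C': "AE t in lborel. t \<ge> 0 \<longrightarrow> emeasure (\<mu> t) UNIV \<le> ennreal C'"
    using \<mu> by (auto simp: Linf_measures_def)
  have "AE t in lborel. 0 \<le> t \<and> t < T \<longrightarrow> \<Psi> m t = 0" for m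
  proof -
    \<comment> \<open>A vanishing Bochner integral says nothing about a nonintegrable integrand,
      whose integral is 0 by default. The essential bound C' on the masses supplies the
      integrability.\<close>
    have i: "integrable lborel (\<lambda>t. indicator {0..} t * (\<theta> t * \<Psi> m t))"
    proof (rule integrableI_bounded_set[where A = "{0..T}" and B = "T * ((real m + 1) * max 0 C')"])
      show "AE x\<in>{0..T} in lborel. norm (indicator {0..} x * (\<theta> x * \<Psi> m x)) \<le> T * ((real m + 1) * max 0 C')"
        using C'
      proof eventually_elim
        case (elim t)
        show ?case
        proof
          assume t: "t \<in> {0..T}"
          then have t0: "0 \<le> t" by simp
          interpret finite_measure "\<mu> t" using fin[OF t0] .
          have "\<Psi> m t \<le> (LINT x|\<mu> t. real m + 1)"
            unfolding \<Psi>_def using \<psi>_\<mu>[OF t0] \<psi>_le by (intro integral_mono) auto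
          also have "\<dots> = (real m + 1) * measure (\<mu> t) UNIV"
            using sets_eq_imp_space_eq[OF sets[OF t0]] by simp
          also have "measure (\<mu> t) UNIV \<le> max 0 C'"
          proof -
            have "measure (\<mu> t) UNIV = enn2real (emeasure (\<mu> t) UNIV)" by (simp add: measure_def)
            also have "\<dots> \<le> enn2real (ennreal C')" using elim t0 by (intro enn2real_mono) auto
            also have "\<dots> \<le> max 0 C'" by (cases "0 \<le> C'") (auto simp: ennreal_neg)
            finally show ?thesis .
          qed
          finally have "\<Psi> m t \<le> (real m + 1) * max 0 C'" by (simp add: mult_left_mono)
          then have "\<theta> t * \<Psi> m t \<le> T * ((real m + 1) * max 0 C')"
            using \<theta>_le[of t] \<Psi>0[of m t] T by (intro mult_mono) auto
          then show "norm (indicator {0..} t * (\<theta> t * \<Psi> m t)) \<le> T * ((real m + 1) * max 0 C')"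
            using t0 \<theta>_le[of t] \<Psi>0[of m t] by (simp add: abs_mult)
        qed
      qed
    qed (use meas in \<open>auto simp: emeasure_lborel_Icc_eq \<theta>_def\<close>)
    have "AE t in lborel. indicator {0..} t * (\<theta> t * \<Psi> m t) = 0"
      using zero[of m] integral_nonneg_eq_0_iff_AE[OF i] \<theta>_le \<Psi>0 by (simp add: set_lebesgue_integral_def)
    then show ?thesis
      by eventually_elim (auto simp: \<theta>_def)
  qed
  then have "AE t in lborel. \<forall>m. 0 \<le> t \<and> t < T \<longrightarrow> \<Psi> m t = 0"
    by (intro iffD2[OF AE_all_countable] allI)
  then show ?thesis
  proof eventually_elim
    case (elim t)
    show ?case
    proof (intro impI)
      assume t: "0 \<le> t \<and> t < T"
      then have t0: "0 \<le> t" by simp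
      have "emeasure (\<mu> t) {- real m..real m} = 0" for m
      proof -
        have "emeasure (\<mu> t) {- real m..real m} = (\<integral>\<^sup>+ x. indicator {- real m..real m} x \<partial>\<mu> t)"
          using sets[OF t0] by simp
        also have "\<dots> \<le> (\<integral>\<^sup>+ x. ennreal (\<psi> m x) \<partial>\<mu> t)"
          by (rule nn_integral_mono) (auto simp: indicator_def \<psi>_def)
        also have "\<dots> = 0" using \<Psi>_enn[OF t0, of m] elim t by simp
        finally show ?thesis by simp
      qed
      then have "emeasure (\<mu> t) (\<Union>m::nat. {- real m..real m}) = 0"
        using sets[OF t0] by (subst emeasure_UN_eq_0) auto
      moreover have "(\<Union>m::nat. {- real m..real m}) = UNIV"
      proof -
        have "\<exists>m::nat. - real m \<le> x \<and> x \<le> real m" for x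
        proof -
          obtain m where "\<bar>x\<bar> \<le> real m" using real_arch_simple by blast
          then show ?thesis by (intro exI[of _ m]) auto
        qed
        then show ?thesis by auto
      qed
      ultimately have U: "emeasure (\<mu> t) UNIV = 0" by simp
      show "\<mu> t = null_measure borel"
      proof (rule measure_eqI)
        fix A assume "A \<in> sets (\<mu> t)"
        have "emeasure (\<mu> t) A \<le> emeasure (\<mu> t) UNIV" using sets[OF t0] by (intro emeasure_mono) auto
        then show "emeasure (\<mu> t) A = emeasure (null_measure borel) A" using U by simp
      qed (simp add: sets[OF t0])
    qed
  qed
qed (auto intro!: AE_I2)

section \<open>The pressure in Lagrangian coordinates at a fixed time\<close>

text \<open>The hypothesis is the slope bound |tan (x/2)| \<le> B in a form that also confines x to
  (-pi, pi); the bound on the tangent alone would not determine the branch.\<close>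

lemma half_angle_bounds:
  assumes "\<bar>x\<bar> \<le> 2 * arctan B"
  shows "- pi < x" "x < pi" "0 < cos (x / 2)" "(tan (x / 2))\<^sup>2 \<le> B\<^sup>2" "\<bar>tan (x / 2)\<bar> \<le> B"
    "1 / (1 + B\<^sup>2) \<le> (cos (x / 2))\<^sup>2"
proof -
  have b: "arctan B < pi / 2" using arctan_ubound .
  then show x: "- pi < x" "x < pi" using assms by auto
  then have h: "- (pi / 2) < x / 2" "x / 2 < pi / 2" by auto
  then show c: "0 < cos (x / 2)" by (rule cos_gt_zero_pi)
  have "\<bar>arctan (tan (x / 2))\<bar> \<le> arctan B" using arctan_tan[OF h] assms by auto
  then have "arctan (tan (x / 2)) \<le> arctan B" "arctan (- tan (x / 2)) \<le> arctan B"
    by (auto simp: arctan_minus abs_le_iff)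
  then show t: "\<bar>tan (x / 2)\<bar> \<le> B" by (simp add: arctan_le_iff abs_le_iff)
  then show t2: "(tan (x / 2))\<^sup>2 \<le> B\<^sup>2" by (metis abs_ge_zero power2_abs power_mono)
  have "(cos (x / 2))\<^sup>2 * (1 + (tan (x / 2))\<^sup>2) = 1"
    using c by (simp add: tan_def field_simps power_divide)
  moreover have "0 < 1 + (tan (x / 2))\<^sup>2" by (simp add: add_pos_nonneg)
  ultimately have "(cos (x / 2))\<^sup>2 = 1 / (1 + (tan (x / 2))\<^sup>2)" by (simp add: field_simps)
  also have "1 / (1 + B\<^sup>2) \<le> \<dots>" using t2 by (intro divide_left_mono) (auto simp: add_pos_nonneg)
  finally show "1 / (1 + B\<^sup>2) \<le> (cos (x / 2))\<^sup>2" .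
qed

lemma interval_integral_primitive:
  assumes "primitive F f" "AE x in lborel. g x = f x" "g \<in> borel_measurable borel"
  shows "(LBINT x=ereal a..ereal b. g x) = F b - F a"
proof -
  have g: "primitive F g" by (rule primitive_cong_AE[OF assms(1)]) (use assms(2,3) in auto)
  show ?thesis
  proof (cases "a \<le> b")
    case True
    then show ?thesis using interval_integral_Icc[OF True, of g] primitiveD(2)[OF g True] by simp
  next
    case False
    then have "b \<le> a" by simp
    then show ?thesis
      using interval_integral_Icc[of b a g] primitiveD(2)[OF g, of b a]
      by (subst interval_integral_endpoints_reverse) simp
  qed
qed

text \<open>A single time is isolated so that the slope bound B may vary with it: the slice is used
  with one constant for a whole time interval and, in the comparison argument, with the current
  value of a growing bound.\<close>

locale pressure_slice =
  fixes l :: real and v q :: "real \<Rightarrow> real \<Rightarrow> real" and t B c C :: real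
  assumes l: "0 < l" and c: "0 < c" and v[measurable]: "v t \<in> borel_measurable borel"
    and q[measurable]: "q t \<in> borel_measurable borel"
    and bounds: "AE \<xi> in lborel. \<bar>v t \<xi>\<bar> \<le> 2 * arctan B \<and> c \<le> q t \<xi> \<and> q t \<xi> \<le> C"
begin

text \<open>The label density q cos^2 (v/2) and the squared slope obey their bounds only for almost
  every label. Truncation changes them on a null set and makes the bounds hold everywhere, as
  \<open>bi_Lipschitz_primitive\<close> and the kernel estimates require; the same device gives
  \<open>\<tau>\<close>.\<close>

definition "\<rho> \<xi> = max (c / (1 + B\<^sup>2)) (min C (q t \<xi> * (cos (v t \<xi> / 2))\<^sup>2))"

definition "\<tau> \<xi> = min (B\<^sup>2) ((tan (v t \<xi> / 2))\<^sup>2)"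

definition "Y x = (if 0 \<le> x then LINT z:{0..x}|lborel. \<rho> z else - (LINT z:{x..0}|lborel. \<rho> z))"

lemma measurable_cutoffs [measurable]: "\<rho> \<in> borel_measurable borel" "\<tau> \<in> borel_measurable borel"
proof -
  have "(\<lambda>\<xi>. tan (v t \<xi> / 2)) \<in> borel_measurable borel" unfolding tan_def by measurable
  then show "\<rho> \<in> borel_measurable borel" "\<tau> \<in> borel_measurable borel"
    unfolding \<rho>_def \<tau>_def by measurable
qed

lemma \<tau>_bounds: "0 \<le> \<tau> \<xi>" "\<tau> \<xi> \<le> B\<^sup>2"
  by (auto simp: \<tau>_def)

lemma \<rho>_bounds: "c / (1 + B\<^sup>2) \<le> \<rho> \<xi>" "\<rho> \<xi> \<le> max (c / (1 + B\<^sup>2)) C"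
  by (auto simp: \<rho>_def)

lemma lower_pos: "0 < c / (1 + B\<^sup>2)"
  using c by (simp add: add_pos_nonneg)

lemma primitive_Y: "primitive Y \<rho>"
proof -
  have "\<bar>\<rho> x\<bar> \<le> max (c / (1 + B\<^sup>2)) C" for x using \<rho>_bounds[of x] lower_pos by linarith
  then show ?thesis unfolding Y_def[abs_def] by (intro primitive_bounded) measurable
qed

sublocale bi_Lipschitz_primitive Y \<rho> "c / (1 + B\<^sup>2)" "max (c / (1 + B\<^sup>2)) C"
  by unfold_locales (rule primitive_Y lower_pos \<rho>_bounds)+

lemma AE_cutoffs:
  "AE \<xi> in lborel. \<rho> \<xi> = q t \<xi> * (cos (v t \<xi> / 2))\<^sup>2 \<and> \<rho> \<xi> * \<tau> \<xi> = q t \<xi> * (sin (v t \<xi> / 2))\<^sup>2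
     \<and> q_bar v q t \<xi> = q t \<xi> \<and> \<rho> \<xi> \<le> C"
  using bounds
proof eventually_elim
  case (elim \<xi>)
  note h = half_angle_bounds[of "v t \<xi>" B]
  have "c * (1 / (1 + B\<^sup>2)) \<le> q t \<xi> * (cos (v t \<xi> / 2))\<^sup>2"
    using elim h(6) c by (intro mult_mono) (auto simp: add_pos_nonneg)
  moreover have "q t \<xi> * (cos (v t \<xi> / 2))\<^sup>2 \<le> q t \<xi> * 1"
    using elim c by (intro mult_left_mono) (auto simp: abs_square_le_1)
  ultimately have \<rho>: "\<rho> \<xi> = q t \<xi> * (cos (v t \<xi> / 2))\<^sup>2" "\<rho> \<xi> \<le> C" using elim by (auto simp: \<rho>_def)
  have "\<tau> \<xi> = (tan (v t \<xi> / 2))\<^sup>2" using h(4) elim by (auto simp: \<tau>_def)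
  moreover have "(cos (v t \<xi> / 2))\<^sup>2 * (tan (v t \<xi> / 2))\<^sup>2 = (sin (v t \<xi> / 2))\<^sup>2"
    using h(3) elim by (simp add: tan_def power_divide)
  ultimately show ?case using \<rho> h(1) elim by (auto simp: q_bar_def)
qed

lemma q_bar_measurable [measurable]: "q_bar v q t \<in> borel_measurable borel"
  unfolding q_bar_def[abs_def] by measurable

lemma kern_eq: "kern l v q t \<xi> \<xi>' = exp (- \<bar>Y \<xi> - Y \<xi>'\<bar> / l)"
proof -
  have "(LBINT s=ereal \<xi>..ereal \<xi>'. q_bar v q t s * (cos (v t s / 2))\<^sup>2) = Y \<xi>' - Y \<xi>"
  proof (rule interval_integral_primitive[OF primitive_Y])
    show "AE x in lborel. q_bar v q t x * (cos (v t x / 2))\<^sup>2 = \<rho> x"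
      using AE_cutoffs by eventually_elim auto
  qed measurable
  then show ?thesis by (simp add: kern_def abs_minus_commute)
qed

lemma kern_le: "kern l v q t \<xi> \<xi>' \<le> exp (- (c / (1 + B\<^sup>2) / l) * \<bar>\<xi> - \<xi>'\<bar>)"
proof -
  have "c / (1 + B\<^sup>2) * \<bar>\<xi> - \<xi>'\<bar> \<le> \<bar>Y \<xi> - Y \<xi>'\<bar>"
    using increment_bounds(1)[of \<xi> \<xi>'] increment_bounds(1)[of \<xi>' \<xi>]
    by (cases "\<xi> \<le> \<xi>'") auto
  then have "c / (1 + B\<^sup>2) * \<bar>\<xi> - \<xi>'\<bar> / l \<le> \<bar>Y \<xi> - Y \<xi>'\<bar> / l" using l by (intro divide_right_mono) auto
  then show ?thesis by (simp add: kern_eq)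
qed

lemma AE_P_integrand:
  "AE \<xi>' in lborel. P_integrand l v q t \<xi> \<xi>' = \<rho> \<xi>' * (exp (- \<bar>Y \<xi> - Y \<xi>'\<bar> / l) * \<tau> (G (Y \<xi>')))"
  using AE_cutoffs by eventually_elim (auto simp: P_integrand_def kern_eq)

lemma P_integrand_measurable [measurable]: "P_integrand l v q t \<xi> \<in> borel_measurable borel"
  unfolding P_integrand_def[abs_def] kern_eq by measurable

text \<open>The lower Lipschitz constant of \<open>Y\<close> turns decay in position into decay in
  the label. The bound involves only B, c, C and l, so it is a dominating function for all times of
  an interval.\<close>

lemma AE_P_integrand_le:
  "AE \<xi>' in lborel. \<bar>P_integrand l v q t \<xi> \<xi>'\<bar> \<le> C * exp (- (c / (1 + B\<^sup>2) / l) * \<bar>\<xi> - \<xi>'\<bar>)"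
  using bounds AE_cutoffs
proof eventually_elim
  case (elim \<xi>')
  have k: "0 \<le> kern l v q t \<xi> \<xi>'" by (simp add: kern_def)
  have "q t \<xi>' * (sin (v t \<xi>' / 2))\<^sup>2 \<le> C * 1"
    using elim c by (intro mult_mono) (auto simp: abs_square_le_1)
  then have "kern l v q t \<xi> \<xi>' * (q t \<xi>' * (sin (v t \<xi>' / 2))\<^sup>2) \<le> exp (- (c / (1 + B\<^sup>2) / l) * \<bar>\<xi> - \<xi>'\<bar>) * C"
    using kern_le k elim c by (intro mult_mono) auto
  moreover have "0 \<le> kern l v q t \<xi> \<xi>' * (q t \<xi>' * (sin (v t \<xi>' / 2))\<^sup>2)"
    using k elim c by auto
  ultimately show ?case using elim by (simp add: P_integrand_def mult_ac)
qed

text \<open>\<open>Y\<close> is the Eulerian position up to a constant; substituting it turns the Lagrangian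
  integrals into the exponential kernels above, applied to the squared slope.\<close>

definition "R x = (LINT z:{x..}|lborel. exp (- (z - x) / l) * \<tau> (G z))"

definition "L x = (LINT z:{..x}|lborel. exp (- (x - z) / l) * \<tau> (G z))"

lemma \<tau>G: "(\<lambda>z. \<tau> (G z)) \<in> borel_measurable borel" "\<bar>\<tau> (G z)\<bar> \<le> B\<^sup>2"
  using \<tau>_bounds by auto

lemmas R_props = primitive_exp_kernel_right[OF l \<tau>G, folded R_def]
lemmas L_props = primitive_exp_kernel_left[OF l \<tau>G, folded L_def]

lemma vimage_half_lines: "Y -` {Y \<xi>..} = {\<xi>..}" "Y -` {..Y \<xi>} = {..\<xi>}"
  by auto

text \<open>The monotone map \<open>Y\<close> takes half lines of labels to half lines of positions,
  and there the absolute value in the kernel has a fixed sign; substitution yields the two one-sided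
  kernels.\<close>

lemma half_integrals:
  "(LINT \<xi>':{\<xi>..}|lborel. P_integrand l v q t \<xi> \<xi>') = R (Y \<xi>)"
  "(LINT \<xi>':{..\<xi>}|lborel. P_integrand l v q t \<xi> \<xi>') = L (Y \<xi>)"
  "(LINT \<xi>'|lborel. P_integrand l v q t \<xi> \<xi>') = R (Y \<xi>) + L (Y \<xi>)"
proof -
  let ?h = "\<lambda>z. exp (- \<bar>Y \<xi> - z\<bar> / l) * \<tau> (G z)"
  have [measurable]: "?h \<in> borel_measurable borel" by measurable
  have h: "(LINT \<xi>':Y -` A|lborel. P_integrand l v q t \<xi> \<xi>') = (LINT z:A|lborel. ?h z)"
    "set_integrable lborel A ?h \<Longrightarrow> set_integrable lborel (Y -` A) (P_integrand l v q t \<xi>)"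
    if [measurable]: "A \<in> sets borel" for A
  proof -
    have [measurable]: "Y -` A \<in> sets borel"
      using measurable_sets[OF F_measurable that] by simp
    have ae: "AE \<xi>' \<in> Y -` A in lborel. P_integrand l v q t \<xi> \<xi>' = \<rho> \<xi>' * ?h (Y \<xi>')"
      using AE_P_integrand[of \<xi>] by eventually_elim auto
    have "(LINT \<xi>':Y -` A|lborel. P_integrand l v q t \<xi> \<xi>') = (LINT \<xi>':Y -` A|lborel. \<rho> \<xi>' * ?h (Y \<xi>'))"
      by (rule set_lebesgue_integral_cong_AE) (use ae in auto)
    then show "(LINT \<xi>':Y -` A|lborel. P_integrand l v q t \<xi> \<xi>') = (LINT z:A|lborel. ?h z)"
      using set_integral_subst(1)[of ?h A] by simp
    assume "set_integrable lborel A ?h"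
    then have "set_integrable lborel (Y -` A) (\<lambda>\<xi>'. \<rho> \<xi>' * ?h (Y \<xi>'))"
      using set_integral_subst(2)[of ?h A] by simp
    then show "set_integrable lborel (Y -` A) (P_integrand l v q t \<xi>)"
      by (subst set_integrable_cong_AE) (use ae in auto)
  qed
  have R: "(LINT z:{Y \<xi>..}|lborel. ?h z) = R (Y \<xi>)"
    unfolding R_def by (rule set_lebesgue_integral_cong) auto
  have iR: "set_integrable lborel {Y \<xi>..} ?h"
    using R_props(3)[of "Y \<xi>"] by (rule iffD1[OF set_integrable_cong, rotated -1]) auto
  have L: "(LINT z:{..Y \<xi>}|lborel. ?h z) = L (Y \<xi>)"
    unfolding L_def by (rule set_lebesgue_integral_cong) auto
  have iL: "set_integrable lborel {..Y \<xi>} ?h"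
    using L_props(3)[of "Y \<xi>"] by (rule iffD1[OF set_integrable_cong, rotated -1]) auto
  show r: "(LINT \<xi>':{\<xi>..}|lborel. P_integrand l v q t \<xi> \<xi>') = R (Y \<xi>)"
    using h(1)[of "{Y \<xi>..}"] R by (simp add: vimage_half_lines)
  show l: "(LINT \<xi>':{..\<xi>}|lborel. P_integrand l v q t \<xi> \<xi>') = L (Y \<xi>)"
    using h(1)[of "{..Y \<xi>}"] L by (simp add: vimage_half_lines)
  have "(LINT \<xi>':{\<xi>..} \<union> {..\<xi>}|lborel. P_integrand l v q t \<xi> \<xi>') = R (Y \<xi>) + L (Y \<xi>)"
    unfolding r[symmetric] l[symmetric]
  proof (rule set_integral_Un_AE)
    show "AE x in lborel. \<not> (x \<in> {\<xi>..} \<and> x \<in> {..\<xi>})"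
      using AE_lborel_singleton[of \<xi>] by eventually_elim auto
    show "set_integrable lborel {\<xi>..} (P_integrand l v q t \<xi>)"
      using h(2)[OF _ iR] by (simp add: vimage_half_lines)
    show "set_integrable lborel {..\<xi>} (P_integrand l v q t \<xi>)"
      using h(2)[OF _ iL] by (simp add: vimage_half_lines)
  qed auto
  moreover have "{\<xi>..} \<union> {..\<xi>} = UNIV" by auto
  ultimately show "(LINT \<xi>'|lborel. P_integrand l v q t \<xi> \<xi>') = R (Y \<xi>) + L (Y \<xi>)"
    by (simp add: set_lebesgue_integral_def)
qed

lemma P_lag_eq: "P_lag l v q t \<xi> = (R (Y \<xi>) + L (Y \<xi>)) / (4 * l)"
  and Px_lag_eq: "Px_lag l v q t \<xi> = (R (Y \<xi>) - L (Y \<xi>)) / (4 * l\<^sup>2)"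
  by (simp_all add: P_lag_def Px_lag_def half_integrals)

lemma P_lag_nonneg: "0 \<le> P_lag l v q t \<xi>"
  using l \<tau>_bounds unfolding P_lag_eq R_def L_def set_lebesgue_integral_def
  by (intro divide_nonneg_pos add_nonneg_nonneg integral_nonneg_AE AE_I2) auto

text \<open>A one-sided exponential has mass l, so each half is at most l B^2, and the prefactor
  1/(4 l) removes the dependence on l.\<close>

lemma P_lag_le: "P_lag l v q t \<xi> \<le> B\<^sup>2 / 2"
proof -
  have "R (Y \<xi>) + L (Y \<xi>) \<le> B\<^sup>2 * l + B\<^sup>2 * l"
    using R_props(2)[of "Y \<xi>"] L_props(2)[of "Y \<xi>"] by (intro add_mono) auto
  then have "(R (Y \<xi>) + L (Y \<xi>)) / (4 * l) \<le> (B\<^sup>2 * l + B\<^sup>2 * l) / (4 * l)"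
    using l by (intro divide_right_mono) auto
  then show ?thesis using l by (simp add: P_lag_eq field_simps)
qed

lemma P_lag_measurable [measurable]: "P_lag l v q t \<in> borel_measurable borel"
proof -
  have [measurable]: "R \<in> borel_measurable borel" "L \<in> borel_measurable borel"
    using R_props(1) L_props(1) by (auto intro!: borel_measurable_continuous_onI primitive_continuous)
  show ?thesis unfolding P_lag_eq[abs_def] by measurable
qed

text \<open>The Lagrangian form of - l^2 P_xx = w^2/2 - P with w = tan (v/2). The densities R/l -
  \<tau> and \<tau> - L/l combine to \<tau>/2 - P, and composition with \<open>Y\<close> contributes
  the factor q cos^2 (v/2).\<close>

lemma primitive_Px_lag:
  "primitive (\<lambda>\<xi>. - (l\<^sup>2 * Px_lag l v q t \<xi>))
     (\<lambda>\<xi>. q t \<xi> * (sin (v t \<xi> / 2))\<^sup>2 / 2 - P_lag l v q t \<xi> * (q t \<xi> * (cos (v t \<xi> / 2))\<^sup>2))"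
proof (rule primitive_cong_AE)
  have "primitive (\<lambda>x. (- 1 / 4) * R x + (1 / 4) * L x) (\<lambda>x. (- 1 / 4) * (R x / l - \<tau> (G x)) + (1 / 4) * (\<tau> (G x) - L x / l))"
    by (intro primitive_add primitive_cmult R_props(1) L_props(1))
  note p = primitive_compose[OF this]
  have e: "- (l\<^sup>2 * Px_lag l v q t \<xi>) = (- 1 / 4) * R (Y \<xi>) + (1 / 4) * L (Y \<xi>)"
    "\<tau> \<xi> / 2 - P_lag l v q t \<xi>
      = (- 1 / 4) * (R (Y \<xi>) / l - \<tau> (G (Y \<xi>))) + (1 / 4) * (\<tau> (G (Y \<xi>)) - L (Y \<xi>) / l)" for \<xi>
    using l by (simp_all add: Px_lag_eq P_lag_eq field_simps)
  show "primitive (\<lambda>\<xi>. - (l\<^sup>2 * Px_lag l v q t \<xi>)) (\<lambda>\<xi>. \<rho> \<xi> * (\<tau> \<xi> / 2 - P_lag l v q t \<xi>))"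
    unfolding e by (rule p)
  show "AE \<xi> in lborel. \<rho> \<xi> * (\<tau> \<xi> / 2 - P_lag l v q t \<xi>)
      = q t \<xi> * (sin (v t \<xi> / 2))\<^sup>2 / 2 - P_lag l v q t \<xi> * (q t \<xi> * (cos (v t \<xi> / 2))\<^sup>2)"
    using AE_cutoffs
  proof eventually_elim
    case (elim \<xi>)
    have "\<rho> \<xi> * (\<tau> \<xi> / 2 - P_lag l v q t \<xi>) = \<rho> \<xi> * \<tau> \<xi> / 2 - P_lag l v q t \<xi> * \<rho> \<xi>"
      by (simp add: algebra_simps)
    then show ?case using elim by metis
  qed
qed measurable

end

section \<open>Time evolution in Lagrangian coordinates\<close>

text \<open>The exceptional set in the hypothesis depends on t. Those of a countable dense set of
  times have a null union, and continuity extends the inequality to the remaining times.\<close>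

lemma continuous_AE_le_on_Icc:
  fixes f :: "real \<Rightarrow> 'a \<Rightarrow> real"
  assumes cont: "AE x in M. continuous_on {a..b} (\<lambda>t. f t x)" and le: "\<And>t. t \<in> {a..b} \<Longrightarrow> AE x in M. f t x \<le> 0"
  shows "AE x in M. \<forall>t\<in>{a..b}. f t x \<le> 0"
proof -
  obtain T where T: "countable T" "T \<subseteq> {a..b}" "{a..b} \<subseteq> closure T" by (rule separable)
  have "AE x in M. \<forall>t\<in>T. f t x \<le> 0"
    using T le by (intro AE_ball_countable[THEN iffD2]) auto
  then show ?thesis
    using cont
  proof eventually_elim
    case (elim x)
    have "closed {t \<in> {a..b}. f t x \<le> 0}"
      using elim(2) by (intro continuous_on_closed_Collect_le continuous_intros) auto
    moreover have "T \<subseteq> {t \<in> {a..b}. f t x \<le> 0}" using T elim by auto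
    ultimately have "closure T \<subseteq> {t \<in> {a..b}. f t x \<le> 0}" by (intro closure_minimal)
    then show ?case using T by auto
  qed
qed

lemma integrable_exp_abs_diff:
  assumes "0 < (a :: real)" shows "integrable lborel (\<lambda>\<xi>'. exp (- a * \<bar>\<xi> - \<xi>'\<bar>))"
  using exp_kernel(1)[of "1 / a" \<xi>] assms by (simp add: mult.commute)

lemma lagrangian_solution_AE:
  assumes "lagrangian_solution l u0 v q"
  shows "AE \<xi> in lborel. v 0 \<xi> = 2 * arctan (deriv u0 (y_init u0 \<xi>)) \<and> q 0 \<xi> = 1"
    "AE \<xi> in lborel. \<forall>t\<ge>0.
     ((\<lambda>r. if v r \<xi> > - pi
           then - P_lag l v q r \<xi> * (1 + cos (v r \<xi>)) - (sin (v r \<xi> / 2))\<^sup>2 else 0)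
        has_integral (v t \<xi> - v 0 \<xi>)) {0..t} \<and>
     ((\<lambda>r. if v r \<xi> > - pi
           then q r \<xi> * (1 / 2 - P_lag l v q r \<xi>) * sin (v r \<xi>) else 0)
        has_integral (q t \<xi> - q 0 \<xi>)) {0..t}"
proof -
  have sol: "AE \<xi> in lborel. v 0 \<xi> = 2 * arctan (deriv u0 (y_init u0 \<xi>)) \<and> q 0 \<xi> = 1 \<and> (\<forall>t\<ge>0.
     ((\<lambda>r. if v r \<xi> > - pi
           then - P_lag l v q r \<xi> * (1 + cos (v r \<xi>)) - (sin (v r \<xi> / 2))\<^sup>2 else 0)
        has_integral (v t \<xi> - v 0 \<xi>)) {0..t} \<and>
     ((\<lambda>r. if v r \<xi> > - pi
           then q r \<xi> * (1 / 2 - P_lag l v q r \<xi>) * sin (v r \<xi>) else 0)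
        has_integral (q t \<xi> - q 0 \<xi>)) {0..t})"
    using assms unfolding lagrangian_solution_def by (elim conjE)
  show "AE \<xi> in lborel. v 0 \<xi> = 2 * arctan (deriv u0 (y_init u0 \<xi>)) \<and> q 0 \<xi> = 1"
    using sol by (rule eventually_mono) (elim conjE, intro conjI)
  show "AE \<xi> in lborel. \<forall>t\<ge>0.
     ((\<lambda>r. if v r \<xi> > - pi
           then - P_lag l v q r \<xi> * (1 + cos (v r \<xi>)) - (sin (v r \<xi> / 2))\<^sup>2 else 0)
        has_integral (v t \<xi> - v 0 \<xi>)) {0..t} \<and>
     ((\<lambda>r. if v r \<xi> > - pi
           then q r \<xi> * (1 / 2 - P_lag l v q r \<xi>) * sin (v r \<xi>) else 0)
        has_integral (q t \<xi> - q 0 \<xi>)) {0..t}"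
    using sol by (rule eventually_mono) (elim conjE)
qed

lemma continuous_on_indefinite_integral:
  fixes f g :: "real \<Rightarrow> real"
  assumes "0 \<le> T" and i: "\<And>t. 0 \<le> t \<Longrightarrow> (f has_integral (g t - g 0)) {0..t}"
  shows "continuous_on {0..T} g"
proof -
  have "continuous_on {0..T} (\<lambda>t. g 0 + integral {0..t} f)"
    using i[OF assms(1)] by (intro continuous_intros indefinite_integral_continuous_1) (auto simp: integrable_on_def)
  moreover have "g 0 + integral {0..t} f = g t" if "t \<in> {0..T}" for t
    using that i[of t] by (simp add: integral_unique)
  ultimately show ?thesis by (rule continuous_on_eq)
qed

lemma lagrangian_solution_AE_continuous:
  assumes "lagrangian_solution l u0 v q" "0 \<le> T"
  shows "AE \<xi> in lborel. continuous_on {0..T} (\<lambda>t. v t \<xi>) \<and> continuous_on {0..T} (\<lambda>t. q t \<xi>)"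
  using lagrangian_solution_AE(2)[OF assms(1)]
proof eventually_elim
  case (elim \<xi>)
  show ?case
    using elim by (intro conjI continuous_on_indefinite_integral[OF assms(2)]) blast+
qed

text \<open>The right-hand side of the system jumps at v = -pi. While v stays above that value it
  agrees with a continuous h, and the integrated equation becomes a classical one.\<close>

lemma has_derivative_if_integral:
  fixes f g h :: "real \<Rightarrow> real"
  assumes i: "\<And>t. 0 \<le> t \<Longrightarrow> (f has_integral (g t - g 0)) {0..t}" and h: "continuous_on {0..T} h"
    and eq: "\<And>t. t \<in> {0..T} \<Longrightarrow> f t = h t" and t: "t \<in> {0..T}"
  shows "(g has_real_derivative h t) (at t within {0..T})"
proof -
  have "((\<lambda>t. g 0 + integral {0..t} h) has_real_derivative 0 + h t) (at t within {0..T})"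
    by (intro DERIV_add DERIV_const integral_has_real_derivative h t)
  moreover have "g 0 + integral {0..s} h = g s" if "s \<in> {0..T}" for s
  proof -
    have "(h has_integral (g s - g 0)) {0..s}"
      by (rule has_integral_eq[OF _ i]) (use eq that in auto)
    then show ?thesis by (simp add: integral_unique)
  qed
  ultimately show ?thesis using t by (auto intro: has_field_derivative_transform_within[of _ _ _ _ 1])
qed

text \<open>The locale is entered at every intermediate final time of the continuation argument,
  where its bounds are improved, and once more with the full interval when Eulerian coordinates are
  recovered.\<close>

locale lagrangian_bounds =
  fixes l :: real and u0 :: "real \<Rightarrow> real" and v q :: "real \<Rightarrow> real \<Rightarrow> real" and T B c C :: real
  assumes l: "0 < l" and T: "0 \<le> T" and c: "0 < c" and sol: "lagrangian_solution l u0 v q"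
    and bounds: "\<And>t. t \<in> {0..T} \<Longrightarrow> AE \<xi> in lborel. \<bar>v t \<xi>\<bar> \<le> 2 * arctan B \<and> c \<le> q t \<xi> \<and> q t \<xi> \<le> C"
begin

lemma vq_measurable: "0 \<le> t \<Longrightarrow> v t \<in> borel_measurable borel" "0 \<le> t \<Longrightarrow> q t \<in> borel_measurable borel"
  using sol by (auto simp: lagrangian_solution_def continuous_Linf_def)

lemma slice: "t \<in> {0..T} \<Longrightarrow> pressure_slice l v q t B c C"
  using l c vq_measurable bounds by unfold_locales auto

lemmas AE_continuous = lagrangian_solution_AE_continuous[OF sol T]

lemma AE_bounds: "AE \<xi> in lborel. \<forall>t\<in>{0..T}. \<bar>v t \<xi>\<bar> \<le> 2 * arctan B \<and> c \<le> q t \<xi> \<and> q t \<xi> \<le> C"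
proof -
  have "AE \<xi> in lborel. \<forall>t\<in>{0..T}. \<bar>v t \<xi>\<bar> - 2 * arctan B \<le> 0"
  proof (rule continuous_AE_le_on_Icc)
    show "AE \<xi> in lborel. continuous_on {0..T} (\<lambda>t. \<bar>v t \<xi>\<bar> - 2 * arctan B)"
      using AE_continuous by eventually_elim (intro continuous_intros; simp)
    show "AE \<xi> in lborel. \<bar>v t \<xi>\<bar> - 2 * arctan B \<le> 0" if "t \<in> {0..T}" for t
      using bounds[OF that] by eventually_elim auto
  qed
  moreover have "AE \<xi> in lborel. \<forall>t\<in>{0..T}. c - q t \<xi> \<le> 0"
  proof (rule continuous_AE_le_on_Icc)
    show "AE \<xi> in lborel. continuous_on {0..T} (\<lambda>t. c - q t \<xi>)"
      using AE_continuous by eventually_elim (intro continuous_intros; simp)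
    show "AE \<xi> in lborel. c - q t \<xi> \<le> 0" if "t \<in> {0..T}" for t
      using bounds[OF that] by eventually_elim auto
  qed
  moreover have "AE \<xi> in lborel. \<forall>t\<in>{0..T}. q t \<xi> - C \<le> 0"
  proof (rule continuous_AE_le_on_Icc)
    show "AE \<xi> in lborel. continuous_on {0..T} (\<lambda>t. q t \<xi> - C)"
      using AE_continuous by eventually_elim (intro continuous_intros; simp)
    show "AE \<xi> in lborel. q t \<xi> - C \<le> 0" if "t \<in> {0..T}" for t
      using bounds[OF that] by eventually_elim auto
  qed
  ultimately show ?thesis by eventually_elim auto
qed

lemma AE_q_bar: "AE \<xi> in lborel. \<forall>t\<in>{0..T}. - pi < v t \<xi> \<and> q_bar v q t \<xi> = q t \<xi>"
  using AE_bounds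
proof eventually_elim
  case (elim \<xi>)
  then have "- pi < v t \<xi>" if "t \<in> {0..T}" for t using half_angle_bounds(1) that by blast
  then show ?case by (simp add: q_bar_def)
qed

lemma kern_continuous: "continuous_on {0..T} (\<lambda>t. kern l v q t \<xi> \<xi>')"
proof -
  have "continuous_on {0..T} (\<lambda>t. LINT s:{a..b}|lborel. q_bar v q t s * (cos (v t s / 2))\<^sup>2)" for a b
    unfolding set_lebesgue_integral_def
  proof (rule continuous_on_integral_dominated)
    show "(\<lambda>s. indicator {a..b} s *\<^sub>R (q_bar v q t s * (cos (v t s / 2))\<^sup>2)) \<in> borel_measurable lborel" if "t \<in> {0..T}" for t
    proof -
      interpret pressure_slice l v q t B c C using slice[OF that] .
      show ?thesis by measurable
    qed
    show "AE s in lborel. continuous_on {0..T} (\<lambda>t. indicator {a..b} s *\<^sub>R (q_bar v q t s * (cos (v t s / 2))\<^sup>2))"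
      using AE_continuous AE_q_bar
    proof eventually_elim
      case (elim s)
      have "continuous_on {0..T} (\<lambda>t. indicator {a..b} s *\<^sub>R (q t s * (cos (v t s / 2))\<^sup>2))"
        using elim(1) by (intro continuous_intros) auto
      then show ?case
        by (rule continuous_on_eq) (use elim(2) in auto)
    qed
    show "integrable lborel (\<lambda>s. indicator {a..b} s * C)"
      by (intro integrable_mult_left) (simp add: emeasure_lborel_Icc_eq)
    show "AE s in lborel. \<bar>indicator {a..b} s *\<^sub>R (q_bar v q t s * (cos (v t s / 2))\<^sup>2)\<bar> \<le> indicator {a..b} s * C"
      if "t \<in> {0..T}" for t
    proof -
      interpret pressure_slice l v q t B c C using slice[OF that] .
      show ?thesis using AE_cutoffs
      proof eventually_elim
        case (elim s)
        then have "\<bar>q_bar v q t s * (cos (v t s / 2))\<^sup>2\<bar> \<le> C" using density_pos(1)[of s] by auto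
        then show ?case by (auto simp: indicator_def)
      qed
    qed
  qed
  then have "continuous_on {0..T} (\<lambda>t. LBINT s=ereal a..ereal b. q_bar v q t s * (cos (v t s / 2))\<^sup>2)" for a b
  proof (cases "a \<le> b")
    case False
    then have "b \<le> a" by simp
    then have "continuous_on {0..T} (\<lambda>t. - (LBINT s=ereal b..ereal a. q_bar v q t s * (cos (v t s / 2))\<^sup>2))"
      using \<open>\<And>a b. continuous_on {0..T} (\<lambda>t. LINT s:{a..b}|lborel. q_bar v q t s * (cos (v t s / 2))\<^sup>2)\<close>[of b a]
      by (intro continuous_intros) (simp add: interval_integral_Icc)
    then show ?thesis by (subst interval_integral_endpoints_reverse)
  qed (simp add: interval_integral_Icc)
  then show ?thesis unfolding kern_def by (intro continuous_intros)
qed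

lemma P_integrand_integral_continuous:
  assumes [measurable]: "A \<in> sets borel"
  shows "continuous_on {0..T} (\<lambda>t. LINT \<xi>':A|lborel. P_integrand l v q t \<xi> \<xi>')"
  unfolding set_lebesgue_integral_def
proof (rule continuous_on_integral_dominated)
  let ?K = "\<lambda>\<xi>'. C * exp (- (c / (1 + B\<^sup>2) / l) * \<bar>\<xi> - \<xi>'\<bar>)"
  show "(\<lambda>\<xi>'. indicator A \<xi>' *\<^sub>R P_integrand l v q t \<xi> \<xi>') \<in> borel_measurable lborel" if "t \<in> {0..T}" for t
  proof -
    interpret pressure_slice l v q t B c C using slice[OF that] .
    show ?thesis by measurable
  qed
  show "AE \<xi>' in lborel. continuous_on {0..T} (\<lambda>t. indicator A \<xi>' *\<^sub>R P_integrand l v q t \<xi> \<xi>')"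
    using AE_continuous AE_q_bar
  proof eventually_elim
    case (elim s)
    have "continuous_on {0..T} (\<lambda>t. indicator A s *\<^sub>R (kern l v q t \<xi> s * q t s * (sin (v t s / 2))\<^sup>2))"
      using elim(1) kern_continuous by (intro continuous_intros) auto
    then show ?case
      by (rule continuous_on_eq)
         (use elim(2) in \<open>auto simp: P_integrand_def\<close>)
  qed
  have "0 < c / (1 + B\<^sup>2) / l" using l c by (simp add: add_pos_nonneg)
  then show "integrable lborel ?K" by (intro integrable_mult_right integrable_exp_abs_diff)
  show "AE \<xi>' in lborel. \<bar>indicator A \<xi>' *\<^sub>R P_integrand l v q t \<xi> \<xi>'\<bar> \<le> ?K \<xi>'" if "t \<in> {0..T}" for t
  proof -
    interpret pressure_slice l v q t B c C using slice[OF that] .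
    show ?thesis using AE_P_integrand_le[of \<xi>]
      by eventually_elim (auto simp: indicator_def intro: order_trans[OF abs_ge_zero])
  qed
qed

lemma P_lag_continuous: "continuous_on {0..T} (\<lambda>t. P_lag l v q t \<xi>)"
  using P_integrand_integral_continuous[of UNIV \<xi>] unfolding P_lag_def set_lebesgue_integral_def
  by (intro continuous_intros) simp

lemma Px_lag_continuous: "continuous_on {0..T} (\<lambda>t. Px_lag l v q t \<xi>)"
  unfolding Px_lag_def by (intro continuous_intros P_integrand_integral_continuous) auto

lemma P_lag_bounds: "t \<in> {0..T} \<Longrightarrow> 0 \<le> P_lag l v q t \<xi>" "t \<in> {0..T} \<Longrightarrow> P_lag l v q t \<xi> \<le> B\<^sup>2 / 2"
  using pressure_slice.P_lag_nonneg[OF slice] pressure_slice.P_lag_le[OF slice] by auto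

lemma AE_derivatives:
  "AE \<xi> in lborel. \<forall>t\<in>{0..T}.
     ((\<lambda>t. v t \<xi>) has_real_derivative - P_lag l v q t \<xi> * (1 + cos (v t \<xi>)) - (sin (v t \<xi> / 2))\<^sup>2) (at t within {0..T}) \<and>
     ((\<lambda>t. q t \<xi>) has_real_derivative q t \<xi> * (1 / 2 - P_lag l v q t \<xi>) * sin (v t \<xi>)) (at t within {0..T})"
  using lagrangian_solution_AE(2)[OF sol] AE_continuous AE_q_bar
proof eventually_elim
  case (elim \<xi>)
  have c: "continuous_on {0..T} (\<lambda>t. v t \<xi>)" "continuous_on {0..T} (\<lambda>t. q t \<xi>)" using elim(2) by auto
  have pi: "- pi < v t \<xi>" if "t \<in> {0..T}" for t using elim(3) that by blast
  note i = elim(1)[rule_format]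
  show ?case
  proof (intro ballI conjI)
    fix t assume t: "t \<in> {0..T}"
    show "((\<lambda>t. v t \<xi>) has_real_derivative - P_lag l v q t \<xi> * (1 + cos (v t \<xi>)) - (sin (v t \<xi> / 2))\<^sup>2) (at t within {0..T})"
      by (rule has_derivative_if_integral[OF i[THEN conjunct1] _ _ t])
         (use pi in \<open>auto intro!: continuous_intros P_lag_continuous c\<close>)
    show "((\<lambda>t. q t \<xi>) has_real_derivative q t \<xi> * (1 / 2 - P_lag l v q t \<xi>) * sin (v t \<xi>)) (at t within {0..T})"
      by (rule has_derivative_if_integral[OF i[THEN conjunct2] _ _ t])
         (use pi in \<open>auto intro!: continuous_intros P_lag_continuous c\<close>)
  qed
qed

end

section \<open>Continuation argument for the slope bound\<close>

lemma nondecreasing_within: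
  fixes g :: "real \<Rightarrow> real"
  assumes "0 \<le> T" and d: "\<And>t. t \<in> {0..T} \<Longrightarrow> (g has_real_derivative g' t) (at t within {0..T})"
    and nonneg: "\<And>t. t \<in> {0..T} \<Longrightarrow> 0 \<le> g' t"
  shows "g 0 \<le> g T"
proof (rule DERIV_nonneg_imp_increasing_open[OF assms(1)])
  fix x assume x: "0 < x" "x < T"
  then have "(g has_real_derivative g' x) (at x)" using d[of x] by (simp add: at_within_Icc_at)
  then show "\<exists>y. (g has_real_derivative y) (at x) \<and> 0 \<le> y" using nonneg[of x] x by auto
next
  show "continuous_on {0..T} g" using d by (rule DERIV_continuous_on)
qed

text \<open>At the supremum S of the times up to which P holds throughout, \<open>left\<close> gives
  P; if S were smaller than T, \<open>right\<close> would extend P beyond S.\<close>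

lemma real_interval_induct [consumes 1, case_names zero right left]:
  fixes t T :: real
  assumes t: "t \<in> {0..T}" and zero: "P 0"
    and right: "\<And>s. 0 \<le> s \<Longrightarrow> s < T \<Longrightarrow> (\<And>r. r \<in> {0..s} \<Longrightarrow> P r) \<Longrightarrow> \<exists>\<delta>>0. \<forall>r. s < r \<and> r < s + \<delta> \<and> r \<le> T \<longrightarrow> P r"
    and left: "\<And>s. 0 < s \<Longrightarrow> s \<le> T \<Longrightarrow> (\<And>r. r \<in> {0..<s} \<Longrightarrow> P r) \<Longrightarrow> P s"
  shows "P t"
proof -
  define A where "A = {s \<in> {0..T}. \<forall>r\<in>{0..s}. P r}"
  have A0: "0 \<in> A" using zero t by (auto simp: A_def)
  have bdd: "bdd_above A" by (auto simp: A_def intro!: bdd_aboveI[of _ T])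
  define S where "S = Sup A"
  have S: "0 \<le> S" "S \<le> T" unfolding S_def
    using A0 bdd by (auto intro: cSup_upper intro!: cSup_least simp: A_def)
  have less: "P r" if "r \<in> {0..<S}" for r
  proof -
    have "r < Sup A" using that by (simp add: S_def)
    then obtain s where "s \<in> A" "r < s" using less_cSupD[of A r] A0 by blast
    then show ?thesis using that by (auto simp: A_def)
  qed
  have "P S" using zero left[OF _ S(2) less] S(1) by (cases "S = 0") auto
  then have le: "P r" if "r \<in> {0..S}" for r using less that by (cases "r = S") auto
  have "S = T"
  proof (rule ccontr)
    assume "S \<noteq> T"
    then have "S < T" using S by simp
    then obtain \<delta> where \<delta>: "0 < \<delta>" "\<forall>r. S < r \<and> r < S + \<delta> \<and> r \<le> T \<longrightarrow> P r"
      using right[OF S(1) _ le] by blast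
    define s where "s = min (S + \<delta> / 2) T"
    have "P r" if "r \<in> {0..s}" for r
      using that \<delta> le[of r] by (cases "r \<le> S") (auto simp: s_def)
    then have "s \<in> A" using S \<delta>(1) by (auto simp: A_def s_def)
    then have "s \<le> S" unfolding S_def using bdd by (rule cSup_upper)
    then show False using \<delta>(1) \<open>S < T\<close> by (auto simp: s_def)
  qed
  then show ?thesis using le t by auto
qed

text \<open>The end point is a limit of a countable dense set of earlier times, whose exceptional
  sets have a null union. This is the closedness half of the continuation argument.\<close>

lemma continuous_AE_le_right_endpoint:
  fixes f :: "real \<Rightarrow> 'a \<Rightarrow> real"
  assumes "a < b" and cont: "AE x in M. continuous_on {a..b} (\<lambda>t. f t x)"
    and le: "\<And>t. t \<in> {a..<b} \<Longrightarrow> AE x in M. f t x \<le> 0"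
  shows "AE x in M. f b x \<le> 0"
proof -
  obtain T where T: "countable T" "T \<subseteq> {a..<b}" "{a..<b} \<subseteq> closure T" by (rule separable)
  have b: "b \<in> closure T"
    using closure_mono[OF T(3)] assms(1) by (auto simp: closure_atLeastLessThan)
  have "AE x in M. \<forall>t\<in>T. f t x \<le> 0"
    using T le by (intro AE_ball_countable[THEN iffD2]) auto
  then show ?thesis
    using cont
  proof eventually_elim
    case (elim x)
    have "closed {t \<in> {a..b}. f t x \<le> 0}"
      using elim(2) by (intro continuous_on_closed_Collect_le continuous_intros) auto
    moreover have "T \<subseteq> {t \<in> {a..b}. f t x \<le> 0}" using T elim by auto
    ultimately have "closure T \<subseteq> {t \<in> {a..b}. f t x \<le> 0}" by (intro closure_minimal)
    then show ?case using b by auto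
  qed
qed

lemma continuous_LinfD:
  assumes "continuous_Linf w" "0 \<le> t" "0 < \<epsilon>"
  obtains \<delta> where "0 < \<delta>" "\<And>r. 0 \<le> r \<Longrightarrow> \<bar>r - t\<bar> < \<delta> \<Longrightarrow> AE \<xi> in lborel. \<bar>w r \<xi> - w t \<xi>\<bar> \<le> \<epsilon>"
proof -
  have "\<exists>\<delta>>0. \<forall>r\<ge>0. \<bar>r - t\<bar> < \<delta> \<longrightarrow> (AE \<xi> in lborel. \<bar>w r \<xi> - w t \<xi>\<bar> \<le> \<epsilon>)"
    using assms unfolding continuous_Linf_def by (elim conjE allE[of _ t] allE[of _ \<epsilon>]) simp
  then obtain \<delta> where d: "0 < \<delta>" "\<forall>r\<ge>0. \<bar>r - t\<bar> < \<delta> \<longrightarrow> (AE \<xi> in lborel. \<bar>w r \<xi> - w t \<xi>\<bar> \<le> \<epsilon>)"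
    by (elim exE conjE)
  show ?thesis by (rule that[OF d(1) d(2)[rule_format]])
qed

context lagrangian_bounds
begin

lemma AE_slope_derivative:
  "AE \<xi> in lborel. \<forall>t\<in>{0..T}. ((\<lambda>t. tan (v t \<xi> / 2)) has_real_derivative
      - ((tan (v t \<xi> / 2))\<^sup>2 / 2) - P_lag l v q t \<xi>) (at t within {0..T})"
  using AE_derivatives AE_bounds
proof eventually_elim
  case (elim \<xi>)
  show ?case
  proof
    fix t assume t: "t \<in> {0..T}"
    have c: "0 < cos (v t \<xi> / 2)" using elim(2) half_angle_bounds(3) t by blast
    have d: "((\<lambda>t. v t \<xi>) has_real_derivative - P_lag l v q t \<xi> * (1 + cos (v t \<xi>)) - (sin (v t \<xi> / 2))\<^sup>2) (at t within {0..T})"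
      using elim(1) t by blast
    \<comment> \<open>In this form the factor of P cancels 1 / cos^2 (v/2) from the derivative of
      the tangent.\<close>
    have cc: "1 + cos (v t \<xi>) = 2 * (cos (v t \<xi> / 2))\<^sup>2"
      using cos_double_cos[of "v t \<xi> / 2"] by simp
    have "((\<lambda>t. tan (v t \<xi> / 2)) has_real_derivative inverse ((cos (v t \<xi> / 2))\<^sup>2) *
        ((- P_lag l v q t \<xi> * (1 + cos (v t \<xi>)) - (sin (v t \<xi> / 2))\<^sup>2) / 2)) (at t within {0..T})"
      by (rule DERIV_chain2[OF DERIV_tan DERIV_cdivide[OF d]]) (use c in simp)
    also have "inverse ((cos (v t \<xi> / 2))\<^sup>2) * ((- P_lag l v q t \<xi> * (1 + cos (v t \<xi>)) - (sin (v t \<xi> / 2))\<^sup>2) / 2)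
        = - ((tan (v t \<xi> / 2))\<^sup>2 / 2) - P_lag l v q t \<xi>"
      unfolding cc using c by (simp add: tan_def field_simps power_divide)
    finally show "((\<lambda>t. tan (v t \<xi> / 2)) has_real_derivative - ((tan (v t \<xi> / 2))\<^sup>2 / 2) - P_lag l v q t \<xi>) (at t within {0..T})" .
  qed
qed

text \<open>A supersolution of the Riccati inequality for the slope remains one: $w = \tan(v/2)$ satisfies
  $w' = - w^2/2 - P$ and a bound $|w| \<le> b$ gives $0 \<le> P \<le> b^2/2$, so $|w'| \<le> b^2$.\<close>

lemma slope_comparison:
  assumes b: "continuous_on {0..T} b" "\<And>t. t \<in> {0..T} \<Longrightarrow> AE \<xi> in lborel. \<bar>v t \<xi>\<bar> \<le> 2 * arctan (b t)"
    and D: "\<And>t. t \<in> {0..T} \<Longrightarrow> (D has_real_derivative D' t) (at t within {0..T})" "\<And>t. t \<in> {0..T} \<Longrightarrow> (b t)\<^sup>2 \<le> D' t"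
    and init: "AE \<xi> in lborel. \<bar>tan (v 0 \<xi> / 2)\<bar> \<le> D 0"
  shows "AE \<xi> in lborel. \<bar>tan (v T \<xi> / 2)\<bar> \<le> D T"
proof -
  \<comment> \<open>The slice is taken with b t in place of B, so that the pressure is controlled by
    the current slope bound.\<close>
  have P: "0 \<le> P_lag l v q t \<xi>" "P_lag l v q t \<xi> \<le> (b t)\<^sup>2 / 2" if t: "t \<in> {0..T}" for t \<xi>
  proof -
    have "AE \<xi> in lborel. \<bar>v t \<xi>\<bar> \<le> 2 * arctan (b t) \<and> c \<le> q t \<xi> \<and> q t \<xi> \<le> C"
      using b(2)[OF t] bounds[OF t] by eventually_elim auto
    then interpret pressure_slice l v q t "b t" c C
      using l c vq_measurable t by unfold_locales auto
    show "0 \<le> P_lag l v q t \<xi>" "P_lag l v q t \<xi> \<le> (b t)\<^sup>2 / 2" using P_lag_nonneg P_lag_le by auto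
  qed
  have "AE \<xi> in lborel. \<forall>t\<in>{0..T}. \<bar>v t \<xi>\<bar> - 2 * arctan (b t) \<le> 0"
  proof (rule continuous_AE_le_on_Icc)
    show "AE \<xi> in lborel. continuous_on {0..T} (\<lambda>t. \<bar>v t \<xi>\<bar> - 2 * arctan (b t))"
      using AE_continuous by eventually_elim (intro continuous_intros b; simp)
  qed (use b(2) in auto)
  then show ?thesis
    using AE_slope_derivative init
  proof eventually_elim
    case (elim \<xi>)
    have w: "(tan (v t \<xi> / 2))\<^sup>2 \<le> (b t)\<^sup>2" if "t \<in> {0..T}" for t
      using half_angle_bounds(4)[of "v t \<xi>" "b t"] elim(1) that by auto
    have der: "((\<lambda>t. tan (v t \<xi> / 2)) has_real_derivative - ((tan (v t \<xi> / 2))\<^sup>2 / 2) - P_lag l v q t \<xi>) (at t within {0..T})"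
      if "t \<in> {0..T}" for t using elim(2) that by blast
    \<comment> \<open>With w the slope, D - w is nondecreasing because D' \<ge> 0 and both terms of
      w' are nonpositive. For D + w, treated next, D' \<ge> b^2 absorbs w^2/2 and P, each at most
      b^2/2.\<close>
    have "D 0 - tan (v 0 \<xi> / 2) \<le> D T - tan (v T \<xi> / 2)"
    proof (rule nondecreasing_within[OF T DERIV_diff[OF D(1) der]])
      fix t assume "t \<in> {0..T}"
      then have "(b t)\<^sup>2 \<le> D' t" "0 \<le> P_lag l v q t \<xi>" using D(2) P(1) by auto
      then show "0 \<le> D' t - (- ((tan (v t \<xi> / 2))\<^sup>2 / 2) - P_lag l v q t \<xi>)"
        using zero_le_power2[of "b t"] zero_le_power2[of "tan (v t \<xi> / 2)"] by linarith
    qed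
    moreover have "D 0 + tan (v 0 \<xi> / 2) \<le> D T + tan (v T \<xi> / 2)"
    proof (rule nondecreasing_within[OF T DERIV_add[OF D(1) der]])
      fix t assume "t \<in> {0..T}"
      then show "0 \<le> D' t + (- ((tan (v t \<xi> / 2))\<^sup>2 / 2) - P_lag l v q t \<xi>)"
        using D(2)[of t] P(2)[of t \<xi>] w[of t] by linarith
    qed
    ultimately show ?case using elim(3) by auto
  qed
qed

text \<open>The logarithmic derivative of q is (1/2 - P) sin v, and 0 \<le> P \<le> B^2/2 bounds its
  modulus by 1/2 + B^2/2.\<close>

lemma q_comparison:
  assumes init: "AE \<xi> in lborel. q 0 \<xi> = 1"
  shows "AE \<xi> in lborel. exp (- ((1 / 2 + B\<^sup>2 / 2) * T)) \<le> q T \<xi> \<and> q T \<xi> \<le> exp ((1 / 2 + B\<^sup>2 / 2) * T)"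
  using AE_derivatives AE_bounds init
proof eventually_elim
  case (elim \<xi>)
  define k where "k = 1 / 2 + B\<^sup>2 / 2"
  have qpos: "0 < q t \<xi>" if "t \<in> {0..T}" for t using elim(2) c that by force
  have der: "((\<lambda>t. ln (q t \<xi>)) has_real_derivative (1 / 2 - P_lag l v q t \<xi>) * sin (v t \<xi>)) (at t within {0..T})"
    if t: "t \<in> {0..T}" for t
  proof -
    have "((\<lambda>t. ln (q t \<xi>)) has_real_derivative 1 / q t \<xi> * (q t \<xi> * (1 / 2 - P_lag l v q t \<xi>) * sin (v t \<xi>))) (at t within {0..T})"
      using elim(1) t qpos[OF t] by (intro DERIV_chain2[OF DERIV_ln_divide]) auto
    then show ?thesis using qpos[OF t] by simp
  qed
  have bound: "\<bar>(1 / 2 - P_lag l v q t \<xi>) * sin (v t \<xi>)\<bar> \<le> k" if "t \<in> {0..T}" for t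
  proof -
    have "\<bar>1 / 2 - P_lag l v q t \<xi>\<bar> * \<bar>sin (v t \<xi>)\<bar> \<le> k * 1"
      using P_lag_bounds[OF that, of \<xi>] by (intro mult_mono) (auto simp: k_def abs_le_iff)
    then show ?thesis by (simp add: abs_mult)
  qed
  have lin: "((\<lambda>t. k * t) has_real_derivative k) (at t within {0..T})" for t
    by (auto intro!: derivative_eq_intros)
  have "k * 0 + ln (q 0 \<xi>) \<le> k * T + ln (q T \<xi>)"
    by (rule nondecreasing_within[OF T DERIV_add[OF lin der]]) (use bound in \<open>force simp: abs_le_iff\<close>)+
  moreover have "k * 0 - ln (q 0 \<xi>) \<le> k * T - ln (q T \<xi>)"
    by (rule nondecreasing_within[OF T DERIV_diff[OF lin der]]) (use bound in \<open>force simp: abs_le_iff\<close>)+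
  ultimately have "- (k * T) \<le> ln (q T \<xi>)" "ln (q T \<xi>) \<le> k * T" using elim(3) by auto
  then show ?case
    using qpos[of T] T unfolding k_def[symmetric]
    by (metis atLeastAtMost_iff exp_le_cancel_iff exp_ln order_refl)
qed

end

text \<open>Continuation in time. As long as the slope is bounded by b and q lies between c and C,
  the comparison lemmas improve b to the strictly smaller D and tighten both bounds on q by a factor
  2; continuity in L-infinity spends this margin on later times. The resulting slope bound does not
  involve l.\<close>

theorem lagrangian_bounds_exist:
  assumes l: "0 < l" and sol: "lagrangian_solution l u0 v q" and M: "\<And>x. \<bar>deriv u0 x\<bar> \<le> M"
    and T: "0 \<le> T" "M * T < 1"
  obtains c C where "lagrangian_bounds l u0 v q T (M / (1 - M * T) + 1) c C"
proof -
  have M0: "0 \<le> M" using M[of 0] by linarith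
  define B0 where "B0 t = M / (1 - M * t)" for t
  define B where "B = B0 T + 1"
  \<comment> \<open>D' = B0^2 + 2 B e must dominate b^2 = B0^2 + e (2 B0 + e), and 2 B0 + e \<le> 2
    B; hence K = 4 B. Since e is increasing and equals 1 at T, b stays below B = B0 T + 1.\<close>
  define K where "K = 4 * B"
  define e where "e t = exp (K * (t - T))" for t
  define b where "b t = B0 t + e t" for t
  define D where "D t = B0 t + e t / 2" for t
  define \<kappa> where "\<kappa> = 1 / 2 + B\<^sup>2 / 2"
  \<comment> \<open>The factors 1/2 here and 2 in C are the margin left over the exponential bounds
    of \<open>q_comparison\<close>.\<close>
  define c where "c = exp (- (\<kappa> * T)) / 2"
  define C where "C = 2 * exp (\<kappa> * T)"
  have pos: "0 < 1 - M * t" if "t \<in> {0..T}" for t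
  proof -
    have "M * t \<le> M * T" using that M0 by (intro mult_left_mono) auto
    then show ?thesis using T by simp
  qed
  have B0: "0 \<le> B0 t" "B0 t \<le> B0 r" if "t \<in> {0..T}" "r \<in> {0..T}" "t \<le> r" for t r
  proof -
    show "0 \<le> B0 t" using pos[OF that(1)] M0 by (simp add: B0_def)
    have "M * t \<le> M * r" using that M0 by (intro mult_left_mono) auto
    then show "B0 t \<le> B0 r"
      unfolding B0_def using pos[OF that(2)] M0 by (intro divide_left_mono mult_pos_pos pos that) auto
  qed
  have B0T: "0 \<le> B0 t" "B0 t \<le> B0 T" if "t \<in> {0..T}" for t using B0[OF that, of T] that T by auto
  have B1: "1 \<le> B" using B0T[of T] T by (simp add: B_def)
  then have K0: "0 < K" by (simp add: K_def)
  have e: "0 < e t" "t \<in> {0..T} \<Longrightarrow> e t \<le> 1" "t \<le> r \<Longrightarrow> e t \<le> e r" for t r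
    using K0 by (auto simp: e_def mult_le_0_iff)
  have bB: "b t \<le> B" if "t \<in> {0..T}" for t
    using B0T[OF that] e(2)[OF that] by (simp add: b_def B_def)
  have b_mono: "b t \<le> b r" if "t \<in> {0..T}" "r \<in> {0..T}" "t \<le> r" for t r
    using B0[OF that] e(3)[OF that(3)] by (simp add: b_def)
  have b_cont: "continuous_on {0..T} b"
    unfolding b_def B0_def e_def using pos by (intro continuous_intros) force
  have D_der: "(D has_real_derivative (B0 t)\<^sup>2 + K * e t / 2) (at t within S)" if "t \<in> {0..T}" for t S
    unfolding D_def B0_def e_def using pos[OF that]
    by (auto intro!: derivative_eq_intros simp: power2_eq_square)
  have bD: "(b t)\<^sup>2 \<le> (B0 t)\<^sup>2 + K * e t / 2" if t: "t \<in> {0..T}" for t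
  proof -
    have "e t * (2 * B0 t + e t) \<le> e t * (2 * B)"
      using B0T[OF t] e(1,2)[of t] t by (intro mult_left_mono) (auto simp: B_def)
    then show ?thesis by (simp add: b_def K_def power2_eq_square algebra_simps)
  qed
  have \<kappa>T: "0 \<le> \<kappa> * T" using T by (simp add: \<kappa>_def)
  have c0: "0 < c" by (simp add: c_def)
  define P where "P t \<longleftrightarrow> (AE \<xi> in lborel. \<bar>v t \<xi>\<bar> \<le> 2 * arctan (b t) \<and> c \<le> q t \<xi> \<and> q t \<xi> \<le> C)" for t
  note init = lagrangian_solution_AE(1)[OF sol]
  have q0: "AE \<xi> in lborel. q 0 \<xi> = 1" using init by eventually_elim auto
  have B00: "B0 0 = M" by (simp add: B0_def)
  have w0: "AE \<xi> in lborel. \<bar>tan (v 0 \<xi> / 2)\<bar> \<le> D 0"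
    using init
  proof eventually_elim
    case (elim \<xi>)
    then show ?case using M[of "y_init u0 \<xi>"] e(1)[of 0] by (simp add: D_def B00 tan_arctan)
  qed
  have locale_s: "lagrangian_bounds l u0 v q s B c C" if s: "s \<in> {0..T}" "\<And>r. r \<in> {0..s} \<Longrightarrow> P r" for s
  proof unfold_locales
    fix r assume r: "r \<in> {0..s}"
    then have "2 * arctan (b r) \<le> 2 * arctan B" using bB[of r] s by (simp add: arctan_le_iff)
    then show "AE \<xi> in lborel. \<bar>v r \<xi>\<bar> \<le> 2 * arctan B \<and> c \<le> q r \<xi> \<and> q r \<xi> \<le> C"
      using s(2)[OF r] unfolding P_def by (auto elim: eventually_mono)
  qed (use l c0 sol s in auto)
  note cont = lagrangian_solution_AE_continuous[OF sol]
  have "P t" if "t \<in> {0..T}" for t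
    using that
  proof (induction rule: real_interval_induct)
    case zero
    show ?case unfolding P_def using init
    proof eventually_elim
      case (elim \<xi>)
      have "\<bar>deriv u0 (y_init u0 \<xi>)\<bar> \<le> b 0" using M[of "y_init u0 \<xi>"] e(1)[of 0] by (simp add: b_def B00)
      then have "arctan (deriv u0 (y_init u0 \<xi>)) \<le> arctan (b 0)" "arctan (- deriv u0 (y_init u0 \<xi>)) \<le> arctan (b 0)"
        by (auto simp: arctan_le_iff abs_le_iff)
      then have "\<bar>v 0 \<xi>\<bar> \<le> 2 * arctan (b 0)" using elim by (simp add: abs_le_iff arctan_minus)
      moreover have "exp (- (\<kappa> * T)) \<le> 1" "1 \<le> exp (\<kappa> * T)" using \<kappa>T by auto
      then have "c \<le> 1" "1 \<le> C" unfolding c_def C_def by linarith+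
      ultimately show ?case using elim by simp
    qed
  next
    case (left s)
    then have s0: "0 \<le> s" by simp
    have "AE \<xi> in lborel. \<bar>v s \<xi>\<bar> - 2 * arctan (b s) \<le> 0"
    proof (rule continuous_AE_le_right_endpoint[OF left(1)])
      have bs: "continuous_on {0..s} b" using b_cont by (rule continuous_on_subset) (use left in auto)
      show "AE \<xi> in lborel. continuous_on {0..s} (\<lambda>t. \<bar>v t \<xi>\<bar> - 2 * arctan (b t))"
        using cont[OF s0] by eventually_elim (intro continuous_intros bs; simp)
      show "AE \<xi> in lborel. \<bar>v r \<xi>\<bar> - 2 * arctan (b r) \<le> 0" if "r \<in> {0..<s}" for r
        using left(3)[OF that] unfolding P_def by eventually_elim auto
    qed
    moreover have "AE \<xi> in lborel. c - q s \<xi> \<le> 0"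
    proof (rule continuous_AE_le_right_endpoint[OF left(1)])
      show "AE \<xi> in lborel. continuous_on {0..s} (\<lambda>t. c - q t \<xi>)"
        using cont[OF s0] by eventually_elim (intro continuous_intros; simp)
      show "AE \<xi> in lborel. c - q r \<xi> \<le> 0" if "r \<in> {0..<s}" for r
        using left(3)[OF that] unfolding P_def by eventually_elim auto
    qed
    moreover have "AE \<xi> in lborel. q s \<xi> - C \<le> 0"
    proof (rule continuous_AE_le_right_endpoint[OF left(1)])
      show "AE \<xi> in lborel. continuous_on {0..s} (\<lambda>t. q t \<xi> - C)"
        using cont[OF s0] by eventually_elim (intro continuous_intros; simp)
      show "AE \<xi> in lborel. q r \<xi> - C \<le> 0" if "r \<in> {0..<s}" for r
        using left(3)[OF that] unfolding P_def by eventually_elim auto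
    qed
    ultimately show ?case unfolding P_def by eventually_elim auto
  next
    case (right s)
    have s: "s \<in> {0..T}" using right by auto
    interpret lagrangian_bounds l u0 v q s B c C using locale_s[OF s right(3)] .
    have sub: "t \<in> {0..T}" if "t \<in> {0..s}" for t using that s by auto
    have w: "AE \<xi> in lborel. \<bar>tan (v s \<xi> / 2)\<bar> \<le> D s"
      by (rule slope_comparison[OF _ _ D_der bD w0])
         (use right(3) sub in \<open>auto simp: P_def elim: eventually_mono intro: continuous_on_subset[OF b_cont]\<close>)
    have "\<kappa> * s \<le> \<kappa> * T" using s by (intro mult_left_mono) (auto simp: \<kappa>_def)
    then have ex: "exp (- (\<kappa> * T)) \<le> exp (- (\<kappa> * s))" "exp (\<kappa> * s) \<le> exp (\<kappa> * T)" by auto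
    have qs: "AE \<xi> in lborel. 2 * c \<le> q s \<xi> \<and> q s \<xi> \<le> C / 2"
      using q_comparison[OF q0] unfolding \<kappa>_def[symmetric]
    proof eventually_elim
      case (elim \<xi>)
      then show ?case using ex unfolding c_def C_def by linarith
    qed
    have vs: "AE \<xi> in lborel. \<bar>v s \<xi>\<bar> \<le> 2 * arctan (D s)"
      using w AE_bounds
    proof eventually_elim
      case (elim \<xi>)
      have "\<bar>v s \<xi>\<bar> \<le> 2 * arctan B" using elim(2) T by auto
      note h = half_angle_bounds(1,2)[OF this]
      have "arctan (tan (v s \<xi> / 2)) = v s \<xi> / 2" by (rule arctan_tan) (use h in auto)
      moreover have "arctan (tan (v s \<xi> / 2)) \<le> arctan (D s)" "arctan (- tan (v s \<xi> / 2)) \<le> arctan (D s)"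
        using elim(1) by (auto simp: arctan_le_iff abs_le_iff)
      ultimately show ?case by (simp add: arctan_minus abs_le_iff)
    qed
    \<comment> \<open>The gap between the angles of b and D at time s. Because b is nondecreasing, a
      change of v by at most \<eta> respects the bound b at later times.\<close>
    define \<eta> where "\<eta> = 2 * arctan (b s) - 2 * arctan (D s)"
    have \<eta>: "0 < \<eta>" using e(1)[of s] by (simp add: \<eta>_def b_def D_def arctan_less_iff)
    have cL: "continuous_Linf v" "continuous_Linf q" 
      using sol by (simp_all only: lagrangian_solution_def)
    obtain \<delta>1 where \<delta>1: "0 < \<delta>1" "\<And>r. 0 \<le> r \<Longrightarrow> \<bar>r - s\<bar> < \<delta>1 \<Longrightarrow> AE \<xi> in lborel. \<bar>v r \<xi> - v s \<xi>\<bar> \<le> \<eta>"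
      using cL(1) right(1) \<eta> by (rule continuous_LinfD) (rule that)
    obtain \<delta>2 where \<delta>2: "0 < \<delta>2" "\<And>r. 0 \<le> r \<Longrightarrow> \<bar>r - s\<bar> < \<delta>2 \<Longrightarrow> AE \<xi> in lborel. \<bar>q r \<xi> - q s \<xi>\<bar> \<le> c"
      using cL(2) right(1) c0 by (rule continuous_LinfD) (rule that)
    \<comment> \<open>With this, a change of q by at most c leads from the interval [2 c, C/2] into
      [c, C].\<close>
    have cC: "c \<le> C / 2"
    proof -
      have "exp (- (\<kappa> * T)) \<le> exp (\<kappa> * T)" using \<kappa>T by simp
      moreover have "0 < exp (\<kappa> * T)" by simp
      ultimately show ?thesis unfolding c_def C_def by linarith
    qed
    show ?case
    proof (intro exI[of _ "min \<delta>1 \<delta>2"] conjI allI impI)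
      show "0 < min \<delta>1 \<delta>2" using \<delta>1 \<delta>2 by simp
      fix r assume r: "s < r \<and> r < s + min \<delta>1 \<delta>2 \<and> r \<le> T"
      have bs: "2 * arctan (b s) \<le> 2 * arctan (b r)"
        using b_mono[of s r] s r by (simp add: arctan_le_iff)
      have "AE \<xi> in lborel. \<bar>v r \<xi> - v s \<xi>\<bar> \<le> \<eta>" "AE \<xi> in lborel. \<bar>q r \<xi> - q s \<xi>\<bar> \<le> c"
        using r right(1) by (auto intro!: \<delta>1 \<delta>2)
      then show "P r" unfolding P_def using vs qs
      proof eventually_elim
        case (elim \<xi>)
        then show ?case using bs cC unfolding \<eta>_def by (auto simp: abs_le_iff)
      qed
    qed
  qed
  then have "lagrangian_bounds l u0 v q T B c C" by (intro locale_s) (use T in auto)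
  then show ?thesis by (intro that) (simp add: B_def B0_def)
qed

section \<open>From Lagrangian to Eulerian coordinates\<close>

text \<open>The integral of 1 + u0'^2 has a density between 1 and 1 + M^2, so it is a bijection of
  the line and the definite description in \<open>y_init\<close> denotes its inverse. The densities
  follow from the inverse function rule.\<close>

lemma primitive_y_init:
  assumes d: "\<And>x. (u0 has_real_derivative u0' x) (at x)" and cont: "continuous_on UNIV u0'"
    and M: "\<And>x. \<bar>u0' x\<bar> \<le> M"
  shows "primitive (y_init u0) (\<lambda>\<xi>. 1 / (1 + (u0' (y_init u0 \<xi>))\<^sup>2))"
    "primitive (\<lambda>\<xi>. u0 (y_init u0 \<xi>)) (\<lambda>\<xi>. u0' (y_init u0 \<xi>) / (1 + (u0' (y_init u0 \<xi>))\<^sup>2))"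
proof -
  define g where "g x = 1 + (u0' x)\<^sup>2" for x
  define Y where "Y x = (if 0 \<le> x then LINT z:{0..x}|lborel. g z else - (LINT z:{x..0}|lborel. g z))" for x
  have g[measurable]: "g \<in> borel_measurable borel"
    unfolding g_def[abs_def] by (intro borel_measurable_continuous_onI continuous_intros cont)
  have le: "1 \<le> g x" "g x \<le> 1 + M\<^sup>2" for x
    using M[of x] power_mono[OF M abs_ge_zero, of x 2] by (auto simp: g_def)
  have p: "primitive Y g"
    unfolding Y_def[abs_def]
  proof (rule primitive_bounded[OF g])
    show "\<bar>g x\<bar> \<le> 1 + M\<^sup>2" for x using le[of x] by linarith
  qed
  interpret bi_Lipschitz_primitive Y g 1 "1 + M\<^sup>2"
    by unfold_locales (use p le in auto)
  have der: "deriv u0 = u0'" using d by (auto intro!: DERIV_imp_deriv)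
  have Y0: "Y 0 = 0"
    using primitiveD(2)[OF p, of 0 0] by (simp add: Y_def)
  have "(LBINT x=ereal 0..ereal y. 1 + (deriv u0 x)\<^sup>2) = Y y" for y
  proof -
    have "(LBINT x=ereal 0..ereal y. g x) = Y y - Y 0"
      by (rule interval_integral_primitive[OF p _ g]) simp
    then show ?thesis by (simp only: der g_def Y0 diff_zero)
  qed
  then have y: "y_init u0 = G"
    unfolding y_init_def by (auto intro!: the_equality simp: fun_eq_iff)
  have "primitive (\<lambda>x. x) (\<lambda>_. 1)" by (rule primitive_deriv) auto
  from primitive_compose_inverse[OF this]
  show "primitive (y_init u0) (\<lambda>\<xi>. 1 / (1 + (u0' (y_init u0 \<xi>))\<^sup>2))"
    unfolding y g_def .
  have "primitive u0 u0'" by (rule primitive_deriv[OF d cont])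
  from primitive_compose_inverse[OF this]
  show "primitive (\<lambda>\<xi>. u0 (y_init u0 \<xi>)) (\<lambda>\<xi>. u0' (y_init u0 \<xi>) / (1 + (u0' (y_init u0 \<xi>))\<^sup>2))"
    unfolding y g_def .
qed

context lagrangian_bounds
begin

text \<open>The next two functions turn out to be $y_\xi$ and $u_\xi$, and the third is $u_{\xi t}$.\<close>

definition "y_density t \<xi> = q t \<xi> * (cos (v t \<xi> / 2))\<^sup>2"

definition "u_density t \<xi> = q t \<xi> * sin (v t \<xi>) / 2"

definition "u_density_rate t \<xi> =
  q t \<xi> * (sin (v t \<xi> / 2))\<^sup>2 / 2 - P_lag l v q t \<xi> * (q t \<xi> * (cos (v t \<xi> / 2))\<^sup>2)"

text \<open>In terms of s = sin (v/2) and k = cos (v/2), with s^2 = 1 - k^2, both claims become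
  polynomial identities. The rate in the second is the label density of - l^2 P_x, which
  \<open>u_lag\<close> integrates in time.\<close>

lemma AE_density_derivatives:
  "AE \<xi> in lborel. \<forall>t\<in>{0..T}.
     ((\<lambda>t. y_density t \<xi>) has_real_derivative u_density t \<xi>) (at t within {0..T}) \<and>
     ((\<lambda>t. u_density t \<xi>) has_real_derivative u_density_rate t \<xi>) (at t within {0..T})"
  using AE_derivatives
proof eventually_elim
  case (elim \<xi>)
  show ?case
  proof (intro ballI conjI)
    fix t assume t: "t \<in> {0..T}"
    define s k p Q where "s = sin (v t \<xi> / 2)" and "k = cos (v t \<xi> / 2)" and "p = P_lag l v q t \<xi>" and "Q = q t \<xi>"
    have sc: "s * s = 1 - k * k" using sin_cos_squared_add[of "v t \<xi> / 2"] by (simp add: s_def k_def power2_eq_square)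
    have sv: "sin (v t \<xi>) = 2 * s * k" and cv: "cos (v t \<xi>) = k * k - s * s"
      using sin_double[of "v t \<xi> / 2"] cos_double[of "v t \<xi> / 2"] by (auto simp: s_def k_def power2_eq_square)
    have dv: "((\<lambda>t. v t \<xi>) has_real_derivative - p * (1 + cos (v t \<xi>)) - s\<^sup>2) (at t within {0..T})"
      and dq: "((\<lambda>t. q t \<xi>) has_real_derivative Q * (1 / 2 - p) * sin (v t \<xi>)) (at t within {0..T})"
      using elim t by (auto simp: p_def s_def Q_def)
    define W where "W = - p * (1 + cos (v t \<xi>)) - s\<^sup>2"
    have dc: "((\<lambda>t. cos (v t \<xi> / 2)) has_real_derivative - s * (W / 2)) (at t within {0..T})"
      unfolding s_def W_def by (rule DERIV_chain2[OF DERIV_cos DERIV_cdivide[OF dv[unfolded s_def]]])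
    have ds: "((\<lambda>t. sin (v t \<xi>)) has_real_derivative cos (v t \<xi>) * W) (at t within {0..T})"
      unfolding W_def by (rule DERIV_chain2[OF DERIV_sin dv])
    have "((\<lambda>t. y_density t \<xi>) has_real_derivative
        Q * (1 / 2 - p) * sin (v t \<xi>) * (k * k) + (- s * (W / 2) * k + - s * (W / 2) * k) * Q) (at t within {0..T})"
      unfolding y_density_def power2_eq_square k_def Q_def
      by (rule DERIV_mult[OF dq[unfolded Q_def] DERIV_mult[OF dc dc]])
    also have "Q * (1 / 2 - p) * sin (v t \<xi>) * (k * k) + (- s * (W / 2) * k + - s * (W / 2) * k) * Q = u_density t \<xi>"
    proof -
      have W: "W = - (2 * p * (k * k)) - (1 - k * k)"
        unfolding W_def cv power2_eq_square sc by (simp add: algebra_simps)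
      show ?thesis
        unfolding W sv u_density_def Q_def[symmetric] by (simp add: field_simps)
    qed
    finally show "((\<lambda>t. y_density t \<xi>) has_real_derivative u_density t \<xi>) (at t within {0..T})" .
    have "((\<lambda>t. u_density t \<xi>) has_real_derivative
        (Q * (1 / 2 - p) * sin (v t \<xi>) * sin (v t \<xi>) + cos (v t \<xi>) * W * Q) / 2) (at t within {0..T})"
      unfolding u_density_def Q_def
      by (rule DERIV_cdivide[OF DERIV_mult[OF dq[unfolded Q_def] ds]])
    also have "(Q * (1 / 2 - p) * sin (v t \<xi>) * sin (v t \<xi>) + cos (v t \<xi>) * W * Q) / 2 = u_density_rate t \<xi>"
    proof -
      have W: "W = - (2 * p * (k * k)) - (1 - k * k)"
        unfolding W_def cv power2_eq_square sc by (simp add: algebra_simps)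
      have "sin (v t \<xi>) * sin (v t \<xi>) = 4 * (1 - k * k) * (k * k)"
        unfolding sv by (simp add: sc[symmetric])
      then have "Q * (1 / 2 - p) * sin (v t \<xi>) * sin (v t \<xi>) = Q * (1 / 2 - p) * (4 * (1 - k * k) * (k * k))"
        by (simp only: mult.assoc)
      then show ?thesis
        unfolding u_density_rate_def W cv Q_def[symmetric] p_def[symmetric] s_def[symmetric] k_def[symmetric] power2_eq_square sc
        by (simp add: field_simps)
    qed
    finally show "((\<lambda>t. u_density t \<xi>) has_real_derivative u_density_rate t \<xi>) (at t within {0..T})" .
  qed
qed

lemma density_measurable:
  assumes "t \<in> {0..T}"
  shows "y_density t \<in> borel_measurable borel" "u_density t \<in> borel_measurable borel"
    "u_density_rate t \<in> borel_measurable borel"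
proof -
  interpret pressure_slice l v q t B c C using slice[OF assms] .
  show "y_density t \<in> borel_measurable borel" "u_density t \<in> borel_measurable borel"
    "u_density_rate t \<in> borel_measurable borel"
    unfolding y_density_def[abs_def] u_density_def[abs_def] u_density_rate_def[abs_def] by measurable
qed

lemma AE_density_bounds:
  "AE \<xi> in lborel. \<forall>t\<in>{0..T}. \<bar>y_density t \<xi>\<bar> \<le> C * (1 + B\<^sup>2) \<and> \<bar>u_density t \<xi>\<bar> \<le> C * (1 + B\<^sup>2) \<and> \<bar>u_density_rate t \<xi>\<bar> \<le> C * (1 + B\<^sup>2)"
  using AE_bounds
proof eventually_elim
  case (elim \<xi>)
  show ?case
  proof
    fix t assume t: "t \<in> {0..T}"
    have "c \<le> q t \<xi>" and qC: "q t \<xi> \<le> C" using elim t by auto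
    then have q: "0 \<le> q t \<xi>" "q t \<xi> \<le> C" using c by auto
    have C: "0 \<le> C" "C \<le> C * (1 + B\<^sup>2)" using q by (auto simp: algebra_simps)
    have sq: "(cos x)\<^sup>2 \<le> 1" "(sin x)\<^sup>2 \<le> 1" for x :: real by (auto simp: abs_square_le_1)
    have y: "0 \<le> y_density t \<xi>" "y_density t \<xi> \<le> C"
      using mult_mono[OF q(2) sq(1)[of "v t \<xi> / 2"] C(1)] q by (auto simp: y_density_def)
    have s: "0 \<le> q t \<xi> * (sin (v t \<xi> / 2))\<^sup>2" "q t \<xi> * (sin (v t \<xi> / 2))\<^sup>2 \<le> C"
      using mult_mono[OF q(2) sq(2)[of "v t \<xi> / 2"] C(1)] q by auto
    have "P_lag l v q t \<xi> * y_density t \<xi> \<le> B\<^sup>2 / 2 * C"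
      using P_lag_bounds[OF t] y C by (intro mult_mono) auto
    moreover have "0 \<le> P_lag l v q t \<xi> * y_density t \<xi>"
      using P_lag_bounds[OF t] y by auto
    moreover have "B\<^sup>2 / 2 * C \<le> C * (1 + B\<^sup>2)" using C by (simp add: algebra_simps)
    ultimately have r: "\<bar>u_density_rate t \<xi>\<bar> \<le> C * (1 + B\<^sup>2)"
      using s C unfolding u_density_rate_def y_density_def[symmetric] by linarith
    have "q t \<xi> * \<bar>sin (v t \<xi>)\<bar> \<le> C * 1" using q C by (intro mult_mono) auto
    then have "\<bar>u_density t \<xi>\<bar> \<le> C" using q C by (simp add: u_density_def abs_mult)
    then show "\<bar>y_density t \<xi>\<bar> \<le> C * (1 + B\<^sup>2) \<and> \<bar>u_density t \<xi>\<bar> \<le> C * (1 + B\<^sup>2) \<and> \<bar>u_density_rate t \<xi>\<bar> \<le> C * (1 + B\<^sup>2)"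
      using y C r by linarith
  qed
qed

lemma set_integrable_AE_bounded:
  fixes a b :: real
  assumes "f \<in> borel_measurable borel" "AE x in lborel. \<bar>f x\<bar> \<le> (K :: real)"
  shows "set_integrable lborel {a..b} f"
  unfolding set_integrable_def
proof (rule integrableI_bounded_set[where A = "{a..b}" and B = K])
  note [measurable] = assms(1)
  show "(\<lambda>x. indicator {a..b} x *\<^sub>R f x) \<in> borel_measurable lborel" by measurable
  show "AE x\<in>{a..b} in lborel. norm (indicator {a..b} x *\<^sub>R f x) \<le> K"
    using assms(2) by eventually_elim simp
qed (auto simp: emeasure_lborel_Icc_eq)

text \<open>Differentiation of both sides in time identifies an integral over labels with an
  increment of the characteristics.\<close>

lemma has_derivative_increment:
  assumes F: "\<And>t. t \<in> {0..T} \<Longrightarrow> f t \<in> borel_measurable borel" "\<And>t. t \<in> {0..T} \<Longrightarrow> f' t \<in> borel_measurable borel"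
    and bound: "AE \<xi> in lborel. \<forall>t\<in>{0..T}. \<bar>f t \<xi>\<bar> \<le> K \<and> \<bar>f' t \<xi>\<bar> \<le> (K :: real)"
    and der: "AE \<xi> in lborel. \<forall>t\<in>{0..T}. ((\<lambda>t. f t \<xi>) has_real_derivative f' t \<xi>) (at t within {0..T})"
    and init: "primitive g (f 0)"
    and rate: "\<And>t. t \<in> {0..T} \<Longrightarrow> primitive (h t) (f' t)"
    and cont: "\<And>\<xi>. continuous_on {0..T} (\<lambda>t. h t \<xi>)"
    and t: "t \<in> {0..T}"
  shows "primitive (\<lambda>\<xi>. g \<xi> + integral {0..t} (\<lambda>r. h r \<xi>)) (f t)"
  unfolding primitive_def
proof (intro allI impI conjI)
  fix a b :: real assume ab: "a \<le> b"
  have si: "set_integrable lborel {a..b} (f r)" if "r \<in> {0..T}" for r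
  proof (rule set_integrable_AE_bounded[OF F(1)[OF that]])
    show "AE \<xi> in lborel. \<bar>f r \<xi>\<bar> \<le> K" using bound by eventually_elim (use that in auto)
  qed
  show "set_integrable lborel {a..b} (f t)" using si[OF t] .
  define I where "I r = (LINT \<xi>|lborel. indicator {a..b} \<xi> * f r \<xi>)" for r
  have I: "I r = (LINT \<xi>:{a..b}|lborel. f r \<xi>)" for r by (simp add: I_def set_lebesgue_integral_def)
  have "(I has_real_derivative (LINT \<xi>|lborel. indicator {a..b} \<xi> * f' r \<xi>)) (at r within {0..T})" if r: "r \<in> {0..T}" for r
    unfolding I_def[abs_def]
  proof (rule has_derivative_integral_dominated[OF _ r])
    show "integrable lborel (\<lambda>\<xi>. indicator {a..b} \<xi> * f r \<xi>)" if "r \<in> {0..T}" for r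
      using si[OF that] by (simp add: set_integrable_def)
    show "AE \<xi> in lborel. \<forall>r\<in>{0..T}. ((\<lambda>r. indicator {a..b} \<xi> * f r \<xi>) has_real_derivative indicator {a..b} \<xi> * f' r \<xi>) (at r within {0..T})"
      using der by eventually_elim (auto intro: DERIV_cmult)
    show "integrable lborel (\<lambda>\<xi>. indicator {a..b} \<xi> * K)"
      by (intro integrable_mult_left) (simp add: emeasure_lborel_Icc_eq)
    show "AE \<xi> in lborel. \<forall>r\<in>{0..T}. \<bar>indicator {a..b} \<xi> * f' r \<xi>\<bar> \<le> indicator {a..b} \<xi> * K"
      using bound by eventually_elim (auto simp: indicator_def)
    show "(\<lambda>\<xi>. indicator {a..b} \<xi> * f' r \<xi>) \<in> borel_measurable lborel"
      using F(2)[OF r] by measurable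
  qed simp
  moreover have "(LINT \<xi>|lborel. indicator {a..b} \<xi> * f' r \<xi>) = h r b - h r a" if "r \<in> {0..T}" for r
    using primitiveD(2)[OF rate[OF that] ab] by (simp add: set_lebesgue_integral_def)
  ultimately have I_der: "(I has_real_derivative h r b - h r a) (at r within {0..T})" if "r \<in> {0..T}" for r
    using that by simp
  \<comment> \<open>The integral over the labels in [a, b] changes at the rate h b - h a;
    integration in time recovers its value at t.\<close>
  have "((\<lambda>r. h r b - h r a) has_integral I t - I 0) {0..t}"
  proof (intro fundamental_theorem_of_calculus)
    fix r assume "r \<in> {0..t}"
    then have "(I has_real_derivative h r b - h r a) (at r within {0..T})" using I_der[of r] t by auto
    then have "(I has_real_derivative h r b - h r a) (at r within {0..t})" by (rule DERIV_subset) (use t in auto)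
    then show "(I has_vector_derivative h r b - h r a) (at r within {0..t})"
      by (simp add: has_real_derivative_iff_has_vector_derivative)
  qed (use t in auto)
  then have "I t - I 0 = integral {0..t} (\<lambda>r. h r b - h r a)" by (simp add: integral_unique)
  also have "\<dots> = integral {0..t} (\<lambda>r. h r b) - integral {0..t} (\<lambda>r. h r a)"
    using t by (intro integral_diff integrable_continuous_interval continuous_on_subset[OF cont]) auto
  finally show "(LINT \<xi>:{a..b}|lborel. f t \<xi>) = g b + integral {0..t} (\<lambda>r. h r b) - (g a + integral {0..t} (\<lambda>r. h r a))"
    using primitiveD(2)[OF init ab] by (simp add: I)
qed

text \<open>The increment lemma is used twice: the label density of - l^2 P_x yields that of u, and
  this one yields that of y. The initial densities come from cos^2 (arctan p) = 1/(1 + p^2), with p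
  the initial slope.\<close>

lemma primitive_u_lag:
  assumes d: "\<And>x. (u0 has_real_derivative u0' x) (at x)" and cont: "continuous_on UNIV u0'"
    and M: "\<And>x. \<bar>u0' x\<bar> \<le> M" and t: "t \<in> {0..T}"
  shows "primitive (u_lag l u0 v q t) (u_density t)" "primitive (y_lag l u0 v q t) (y_density t)"
proof -
  have der: "deriv u0 = u0'" using d by (auto intro!: DERIV_imp_deriv)
  note y = primitive_y_init[OF d cont M]
  have T0: "0 \<in> {0..T}" using T by simp
  have init: "AE \<xi> in lborel. 1 / (1 + (u0' (y_init u0 \<xi>))\<^sup>2) = y_density 0 \<xi> \<and>
      u0' (y_init u0 \<xi>) / (1 + (u0' (y_init u0 \<xi>))\<^sup>2) = u_density 0 \<xi>"
    using lagrangian_solution_AE(1)[OF sol]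
  proof eventually_elim
    case (elim \<xi>)
    let ?p = "u0' (y_init u0 \<xi>)"
    have two: "2 * ?p / (2 + ?p\<^sup>2 * 2) = ?p / (1 + ?p\<^sup>2)"
    proof -
      have e: "2 + ?p\<^sup>2 * 2 = 2 * (1 + ?p\<^sup>2)" by simp
      show ?thesis unfolding e by (rule mult_divide_mult_cancel_left) simp
    qed
    have "y_density 0 \<xi> = 1 / (1 + ?p\<^sup>2)"
      using elim by (simp add: y_density_def der cos_arctan power_divide add_nonneg_nonneg)
    moreover have "u_density 0 \<xi> = ?p / (1 + ?p\<^sup>2)"
      using elim two by (simp add: u_density_def der sin_double sin_arctan cos_arctan)
    ultimately show ?case by simp
  qed
  have iy: "primitive (y_init u0) (y_density 0)"
    by (rule primitive_cong_AE[OF y(1) _ density_measurable(1)[OF T0]]) (use init in \<open>auto elim: eventually_mono\<close>)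
  have iu: "primitive (\<lambda>\<xi>. u0 (y_init u0 \<xi>)) (u_density 0)"
    by (rule primitive_cong_AE[OF y(2) _ density_measurable(2)[OF T0]]) (use init in \<open>auto elim: eventually_mono\<close>)
  have Pc: "continuous_on {0..T} (\<lambda>t. - (l\<^sup>2 * Px_lag l v q t \<xi>))" for \<xi>
    by (intro continuous_intros Px_lag_continuous)
  have u_lag: "u_lag l u0 v q t = (\<lambda>\<xi>. u0 (y_init u0 \<xi>) + integral {0..t} (\<lambda>r. - (l\<^sup>2 * Px_lag l v q r \<xi>)))" for t
    by (simp add: u_lag_def fun_eq_iff)
  have u: "primitive (u_lag l u0 v q t) (u_density t)" if t: "t \<in> {0..T}" for t
    unfolding u_lag
  proof (rule has_derivative_increment[where f = u_density and f' = u_density_rate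
        and h = "\<lambda>t \<xi>. - (l\<^sup>2 * Px_lag l v q t \<xi>)", OF density_measurable(2,3) _ _ iu _ Pc t])
    show "AE \<xi> in lborel. \<forall>t\<in>{0..T}. \<bar>u_density t \<xi>\<bar> \<le> C * (1 + B\<^sup>2) \<and> \<bar>u_density_rate t \<xi>\<bar> \<le> C * (1 + B\<^sup>2)"
      using AE_density_bounds by eventually_elim auto
    show "AE \<xi> in lborel. \<forall>t\<in>{0..T}. ((\<lambda>t. u_density t \<xi>) has_real_derivative u_density_rate t \<xi>) (at t within {0..T})"
      using AE_density_derivatives by eventually_elim auto
    show "primitive (\<lambda>\<xi>. - (l\<^sup>2 * Px_lag l v q t \<xi>)) (u_density_rate t)" if "t \<in> {0..T}" for t
      unfolding u_density_rate_def[abs_def] by (rule pressure_slice.primitive_Px_lag[OF slice[OF that]])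
  qed
  show "primitive (u_lag l u0 v q t) (u_density t)" using u[OF t] .
  have uc: "continuous_on {0..T} (\<lambda>t. u_lag l u0 v q t \<xi>)" for \<xi>
    unfolding u_lag
    by (intro continuous_intros indefinite_integral_continuous_1 integrable_continuous_interval Px_lag_continuous)
  show "primitive (y_lag l u0 v q t) (y_density t)"
    unfolding y_lag_def[abs_def]
  proof (rule has_derivative_increment[where f = y_density and f' = u_density
        and h = "\<lambda>t. u_lag l u0 v q t", OF density_measurable(1,2) _ _ iy u uc t])
    show "AE \<xi> in lborel. \<forall>t\<in>{0..T}. \<bar>y_density t \<xi>\<bar> \<le> C * (1 + B\<^sup>2) \<and> \<bar>u_density t \<xi>\<bar> \<le> C * (1 + B\<^sup>2)"
      using AE_density_bounds by eventually_elim auto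
    show "AE \<xi> in lborel. \<forall>t\<in>{0..T}. ((\<lambda>t. y_density t \<xi>) has_real_derivative u_density t \<xi>) (at t within {0..T})"
      using AE_density_derivatives by eventually_elim auto
  qed
qed

text \<open>At time t the map \<open>y_lag\<close> is a bi-Lipschitz bijection and w is
  \<open>u_lag\<close> composed with its inverse. The weak derivative of w is therefore the quotient
  of the two label densities, which is tan (v/2) almost everywhere and bounded by B.\<close>

lemma eulerian_pressure_bounds:
  assumes d: "\<And>x. (u0 has_real_derivative u0' x) (at x)" and cont: "continuous_on UNIV u0'"
    and M: "\<And>x. \<bar>u0' x\<bar> \<le> M" and t: "t \<in> {0..T}"
    and w: "\<And>\<xi>. w (y_lag l u0 v q t \<xi>) = u_lag l u0 v q t \<xi>"
  shows "0 \<le> pressure l w x" "pressure l w x \<le> B\<^sup>2 / 2"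
proof -
  interpret S: pressure_slice l v q t B c C using slice[OF t] .
  note p = primitive_u_lag[OF d cont M t]
  have y: "primitive (y_lag l u0 v q t) S.\<rho>"
    by (rule primitive_cong_AE[OF p(2)])
       (use S.AE_cutoffs in \<open>auto simp: y_density_def elim: eventually_mono\<close>)
  interpret E: bi_Lipschitz_primitive "y_lag l u0 v q t" S.\<rho> "c / (1 + B\<^sup>2)" "max (c / (1 + B\<^sup>2)) C"
    by unfold_locales (rule y S.lower_pos S.\<rho>_bounds)+
  have "w x = u_lag l u0 v q t (E.G x)" for x
    using w[of "E.G x"] by simp
  then have "primitive w (\<lambda>x. u_density t (E.G x) / S.\<rho> (E.G x))"
    using E.primitive_compose_inverse[OF p(1)] by presburger
  then have wd: "has_weak_derivative w (\<lambda>x. u_density t (E.G x) / S.\<rho> (E.G x))"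
    by (rule primitive_has_weak_derivative)
  have "AE \<xi> in lborel. \<bar>u_density t \<xi> / S.\<rho> \<xi>\<bar> \<le> B"
    using S.AE_cutoffs bounds[OF t]
  proof eventually_elim
    case (elim \<xi>)
    then have h: "0 < cos (v t \<xi> / 2)" "\<bar>tan (v t \<xi> / 2)\<bar> \<le> B" "0 < q t \<xi>"
      using half_angle_bounds(3,5)[of "v t \<xi>" B] c by auto
    have "u_density t \<xi> = q t \<xi> * (sin (v t \<xi> / 2) * cos (v t \<xi> / 2))"
      using sin_double[of "v t \<xi> / 2"] by (simp add: u_density_def)
    then have "u_density t \<xi> / S.\<rho> \<xi> = tan (v t \<xi> / 2)"
      using elim h by (simp add: tan_def power2_eq_square)
    then show ?case using h by simp
  qed
  then have ae: "AE x in lborel. \<bar>u_density t (E.G x) / S.\<rho> (E.G x)\<bar> \<le> B"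
    by (rule E.AE_G)
  show "0 \<le> pressure l w x" "pressure l w x \<le> B\<^sup>2 / 2"
    using pressure_bounds[OF l wd ae] by auto
qed

end

theorem proposition7p5:
  fixes s :: real and u0 :: "real \<Rightarrow> real" and U :: "real \<Rightarrow> real \<Rightarrow> real \<Rightarrow> real"
    and u :: "real \<Rightarrow> real \<Rightarrow> real" and \<mu> :: "real \<Rightarrow> real measure"
  assumes "s \<ge> 3" and "sobolev s u0" and "continuous_on UNIV u0" and "total_variation u0 < \<infinity>"
    and "\<And>l. l > 0 \<Longrightarrow> dissipative_solution l u0 (U l)"
    and "limit_pair U u \<mu>"
  shows "AE t in lborel. 0 \<le> t \<and> ereal t < 1 / (SUP x. ereal \<bar>deriv u0 x\<bar>) \<longrightarrow> \<mu> t = null_measure borel"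
proof (cases "(SUP x. ereal \<bar>deriv u0 x\<bar>) = \<infinity>")
  case True
  \<comment> \<open>Here 1 / \<infinity> = 0, so no t with 0 \<le> t qualifies.\<close>
  then show ?thesis by (auto intro!: AE_I2 simp: zero_ereal_def)
next
  case False
  have "ereal \<bar>deriv u0 0\<bar> \<le> (SUP x. ereal \<bar>deriv u0 x\<bar>)" by (rule SUP_upper) simp
  then obtain M where SM: "(SUP x. ereal \<bar>deriv u0 x\<bar>) = ereal M"
    using False by (cases "SUP x. ereal \<bar>deriv u0 x\<bar>") auto
  have M: "\<bar>deriv u0 x\<bar> \<le> M" for x
    using SUP_upper[of x UNIV "\<lambda>x. ereal \<bar>deriv u0 x\<bar>"] unfolding SM by simp
  then have M0: "0 \<le> M" using abs_ge_zero order_trans by blast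
  obtain K where "\<And>x. \<bar>u0 x\<bar> \<le> K" using bounded_if_total_variation_finite[OF assms(4)] by blast
  then obtain u0' where u0': "continuous_on UNIV u0'" "\<And>x. (u0 has_real_derivative u0' x) (at x)"
    using sobolev_differentiable[OF assms(1-3)] by blast
  then have der: "deriv u0 = u0'" by (auto intro!: DERIV_imp_deriv)
  obtain L where \<mu>: "Linf_measures \<mu>" and L: "\<And>n. L n > 0" "L \<longlonglongrightarrow> 0"
    and conv: "converges_measure (\<lambda>n t x. (L n)\<^sup>2 * pressure (L n) (U (L n) t) x) \<mu>"
    using assms(6) unfolding limit_pair_def by blast
  have AE_T: "AE t in lborel. 0 \<le> t \<and> t < T \<longrightarrow> \<mu> t = null_measure borel" if T: "0 \<le> T" "M * T < 1" for T
  proof (rule limit_measure_zero[OF \<mu> conv L(2)])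
    fix n t x assume t: "0 \<le> t" "t \<le> T"
    obtain v q where sol: "lagrangian_solution (L n) u0 v q"
      and w: "\<forall>t\<ge>0. \<forall>\<xi>. U (L n) t (y_lag (L n) u0 v q t \<xi>) = u_lag (L n) u0 v q t \<xi>"
      using assms(5)[OF L(1)[of n]] unfolding dissipative_solution_def by blast
    \<comment> \<open>c and C are obtained anew for each n, but the pressure estimate contains only
      the slope bound M / (1 - M T) + 1, which is the same for all n.\<close>
    obtain c C where "lagrangian_bounds (L n) u0 v q T (M / (1 - M * T) + 1) c C"
      by (rule lagrangian_bounds_exist[OF L(1) sol M T])
    then interpret lagrangian_bounds "L n" u0 v q T "M / (1 - M * T) + 1" c C .
    show "\<bar>pressure (L n) (U (L n) t) x\<bar> \<le> (M / (1 - M * T) + 1)\<^sup>2 / 2"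
      using eulerian_pressure_bounds[OF u0'(2,1) M[unfolded der], of t "U (L n) t" x] t w by auto
  qed
  \<comment> \<open>The exceptional null set depends on T; rational T give countably many and still
    lie above every admissible time.\<close>
  have "AE t in lborel. \<forall>T\<in>{T \<in> \<rat>. 0 \<le> T \<and> M * T < 1}. 0 \<le> t \<and> t < T \<longrightarrow> \<mu> t = null_measure borel"
    using AE_T by (intro AE_ball_countable[THEN iffD2]) (auto intro: countable_subset[OF _ countable_rat])
  then show ?thesis
  proof eventually_elim
    case (elim t)
    show ?case
    proof (intro impI, elim conjE)
      assume t: "0 \<le> t" "ereal t < 1 / (SUP x. ereal \<bar>deriv u0 x\<bar>)"
      obtain T where "T \<in> \<rat>" "t < T" "M * T < 1"
      \<comment> \<open>For M = 0 the quotient 1 / 0 is \<infinity> in \<open>ereal\<close>, so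
        every nonnegative time is admissible and any rational T above t serves.\<close>
      proof (cases "M = 0")
        case True
        obtain T where "T \<in> \<rat>" "t < T" using Rats_dense_in_real[of t "t + 1"] by auto
        then show ?thesis using that[of T] True by simp
      next
        case False
        then have "t < 1 / M" using t(2) M0 unfolding SM by (simp add: one_ereal_def)
        then obtain T where "T \<in> \<rat>" "t < T" "T < 1 / M" using Rats_dense_in_real by blast
        then show ?thesis using that[of T] False M0 by (simp add: field_simps)
      qed
      then show "\<mu> t = null_measure borel" using elim t(1) by auto
    qed
  qed
qed

end
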